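(* Let $K=\mathbb R$ or an algebraically closed field of characteristic zero. For $$f=f_n=\sum_{1\le i\le j\le n}A_{i,j}X_iX_j\in K[\{A_{i,j}\},\{X_i\}]$$ the index of stabilization is $\rho(f)=1$ and the strata $\mathcal B_{k(q)}=\{(\{a_{ij}\},\{0\}):\mathrm{rk}(f)=q\}\subset\mathrm{Sing}(f)$, $0\le q\le n$, form a functorial Thom-Whitney-a stratification with respect to $f$.
   Context: Let $N=n+\binom{n+1}{2}$ and regard $f:K^N\to K$ as a function of all variables $A_{i,j}$ ($1\le i\le j\le n$), $X_i$ ($1\le i\le n$). $\mathrm{Sing}(f)$ is the set of points of $f^{-1}(0)$ at which $df=0$; here $\mathrm{Sing}(f)=\{X_1=\dots=X_n=0\}$. For a point $(\{a_{ij}\},\{0\})\in\mathrm{Sing}(f)$, $\mathrm{rk}(f)$ is the rank of the quadratic form $\sum_{i\le j}a_{ij}X_iX_j$ in $X_1,\dots,X_n$. The index $k(q)$ denotes the dimension of the fibers of $G$ (defined below) over the set of forms of rank $q$. At noncritical points $df(x)$ also denotes the line $\mathrm{Span}_K\{df(x)\}\subset (K^N)^*$. The topology is Zariski by default; for $K=\mathbb R$ or $\mathbb C$ limits and closures of bundles are Euclidean. $V\perp T$ means that elements of $V\subset(K^N)^*$ vanish on $T\subset K^N$. An irreducible component of a constructible set is its intersection with an irreducible component of its closure. Glaeser bundle and index. For $\mathcal T\subset K^N\times (K^N)^*$ let $\mathcal T^{(0)}=\mathcal T$ and let $\mathcal T^{(p+1)}$ have as fiber over $x$ the linear hull of the fiber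 over $x$ of $\overline{\mathcal T^{(p)}}$. The chain stabilizes with final term $Gl(\mathcal T)$. With $\mathcal T=\{(x,df(x))\}$, $x$ ranging over noncritical points, put $G^{(p)}:=\mathcal T^{(p)}|_{\mathrm{Sing}(f)}$, $G:=Gl(\mathcal T)|_{\mathrm{Sing}(f)}$; $\rho(f)$ is the smallest $\rho$ with $G^{(\rho)}=G$. Quasistrata: $\mathcal G_k:=\{x\in\mathrm{Sing}(f):\dim G_x=k\}$. Stratifications. A set $S$ open in its closure is G-regular if its Gauss map $x\mapsto T_x(S)$ on nonsingular points extends continuously (uniquely) to $S$. A TWG-stratification is a finite partition of $\mathrm{Sing}(f)$ into pairwise disjoint G-regular constructible sets $S_i$, open in their closures, satisfying: (Thom) if noncritical $x_m\to x_0\in S_i$ and $df(x_m)\to V$ (as lines), then $V\perp T_{x_0}(S_i)$; (Whitney-a) if $x_m\in S_i$, $x_m\to x_0\in S_j$ and $T_{x_m}(S_i)\to W$, then $W\supset T_{x_0}(S_j)$. It is a Thom-Whitney-a stratification if the strata are smooth. A TWG-stratification $\{S_i\}$ is universal if for every irreducible component $S$ of every $S_i$ and any TWG-stratification $\{S'_j\}$ there is an irreducible component $S'$ of some $S'_j$ with $S\cap S'$ open and dense in both. A stratification is functorial if it is universal and coincides with the partition of $\mathrm{Sing}(f)$ into the quasistrata $\mathcal G_k$. *)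

theory Defs
  imports
    "HOL-Analysis.Analysis"
    "HOL-Library.Poly_Mapping"
    "HOL-Library.Disjoint_Sets"
    "HOL-Computational_Algebra.Polynomial"
begin

section \<open>Polynomials in several variables\<close>

type_synonym ('v, 'k) mpoly = "('v \<Rightarrow>\<^sub>0 nat) \<Rightarrow>\<^sub>0 'k"

definition peval :: "('v, 'k::field) mpoly \<Rightarrow> ('v \<Rightarrow> 'k) \<Rightarrow> 'k" where
  "peval P x = (\<Sum>m\<in>Poly_Mapping.keys P.
     Poly_Mapping.lookup P m * (\<Prod>i\<in>Poly_Mapping.keys m. x i ^ Poly_Mapping.lookup m i))"

definition pvar :: "'v \<Rightarrow> ('v, 'k::field) mpoly" where
  "pvar i = Poly_Mapping.single (Poly_Mapping.single i 1) 1"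

definition ppartial :: "'v \<Rightarrow> ('v, 'k::field) mpoly \<Rightarrow> ('v, 'k) mpoly" where
  "ppartial i P = (\<Sum>m\<in>Poly_Mapping.keys P.
     Poly_Mapping.single (m - Poly_Mapping.single i 1)
       (of_nat (Poly_Mapping.lookup m i) * Poly_Mapping.lookup P m))"

text \<open>Points of affine space are vectors over a finite index type. The dual space
  is identified with the same type of vectors by means of the dual basis, so that
  the differential of a polynomial is the vector of its partial derivatives.\<close>

definition pval :: "('v::finite, 'k::field) mpoly \<Rightarrow> 'k ^ 'v \<Rightarrow> 'k" where
  "pval P x = peval P (\<lambda>i. x $ i)"

definition pdiff :: "('v::finite, 'k::field) mpoly \<Rightarrow> 'k ^ 'v \<Rightarrow> 'k ^ 'v" where
  "pdiff P x = (\<chi> i. pval (ppartial i P) x)"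

definition pairing :: "'k::field ^ 'v::finite \<Rightarrow> 'k ^ 'v \<Rightarrow> 'k" where
  "pairing v t = (\<Sum>i\<in>UNIV. v $ i * t $ i)"

definition annihilates :: "('k::field ^ 'v::finite) set \<Rightarrow> ('k ^ 'v) set \<Rightarrow> bool" where
  "annihilates V T \<longleftrightarrow> (\<forall>v\<in>V. \<forall>t\<in>T. pairing v t = 0)"

section \<open>Zariski topologies\<close>

text \<open>The type \<^typ>\<open>'p\<close> is regarded as an affine space with coordinate functions \<open>c\<close>; the
  topology is generated by the distinguished open sets.\<close>

definition zariski_coords :: "('i \<Rightarrow> 'p \<Rightarrow> 'k::field) \<Rightarrow> 'p topology" where
  "zariski_coords c =
     topology_generated_by {{z. peval P (\<lambda>i. c i z) \<noteq> 0} |P. P \<in> (UNIV :: ('i, 'k) mpoly set)}"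

definition zariski :: "('k::field ^ 'v::finite) topology" where
  "zariski = zariski_coords (\<lambda>i x. x $ i)"

text \<open>On the two product spaces below this is the Zariski topology of the product
  variety, not the product of the Zariski topologies.\<close>

definition zariski_pair :: "(('k::field ^ 'v::finite) \<times> ('k ^ 'v)) topology" where
  "zariski_pair = zariski_coords
     (case_sum (\<lambda>i z. fst z $ i) (\<lambda>i z. snd z $ i))"

definition zariski_frame :: "(('k::field ^ 'v::finite) \<times> ('k ^ 'v ^ 'v)) topology" where
  "zariski_frame = zariski_coords
     (case_sum (\<lambda>i z. fst z $ i) (\<lambda>(i, j) z. snd z $ i $ j))"

definition constructible :: "('k::field ^ 'v::finite) set \<Rightarrow> bool" where
  "constructible S \<longleftrightarrow> (\<exists>\<F>. finite \<F> \<and> S = \<Union>\<F> \<and>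
     (\<forall>F\<in>\<F>. \<exists>U C. openin zariski U \<and> closedin zariski C \<and> F = U \<inter> C))"

definition open_in_closure :: "('k::field ^ 'v::finite) set \<Rightarrow> bool" where
  "open_in_closure S \<longleftrightarrow> openin (subtopology zariski (zariski closure_of S)) S"

definition zariski_irreducible :: "('k::field ^ 'v::finite) set \<Rightarrow> bool" where
  "zariski_irreducible C \<longleftrightarrow> C \<noteq> {} \<and>
     (\<forall>F1 F2. closedin zariski F1 \<and> closedin zariski F2 \<and> C \<subseteq> F1 \<union> F2 \<longrightarrow> C \<subseteq> F1 \<or> C \<subseteq> F2)"

definition irreducible_components :: "('k::field ^ 'v::finite) set \<Rightarrow> ('k ^ 'v) set set" where
  "irreducible_components V = {C. C \<subseteq> V \<and> zariski_irreducible C \<and>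
     (\<forall>D. D \<subseteq> V \<and> zariski_irreducible D \<and> C \<subseteq> D \<longrightarrow> D = C)}"

definition constructible_components :: "('k::field ^ 'v::finite) set \<Rightarrow> ('k ^ 'v) set set" where
  "constructible_components S = {S \<inter> C |C. C \<in> irreducible_components (zariski closure_of S)}"

definition open_dense_in :: "('k::field ^ 'v::finite) set \<Rightarrow> ('k ^ 'v) set \<Rightarrow> bool" where
  "open_dense_in U S \<longleftrightarrow> openin (subtopology zariski S) U \<and> S \<subseteq> zariski closure_of U"

section \<open>Nonsingular points and tangent spaces\<close>

definition vanishing_ideal :: "('k::field ^ 'v::finite) set \<Rightarrow> ('v, 'k) mpoly set" where
  "vanishing_ideal S = {P. \<forall>x\<in>S. pval P x = 0}"

text \<open>Jacobian form of regularity, for \<open>S\<close> open in its closure: in a Zariski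
  neighbourhood of \<open>x\<close> the set \<open>S\<close> is the zero set of polynomials vanishing on \<open>S\<close> with
  linearly independent differentials at \<open>x\<close>. Components of different dimensions are allowed.\<close>

definition nonsingular_point :: "('k::field ^ 'v::finite) set \<Rightarrow> 'k ^ 'v \<Rightarrow> bool" where
  "nonsingular_point S x \<longleftrightarrow> x \<in> S \<and>
     (\<exists>\<P> U. finite \<P> \<and> \<P> \<subseteq> vanishing_ideal S \<and>
        inj_on (\<lambda>P. pdiff P x) \<P> \<and> vec.independent ((\<lambda>P. pdiff P x) ` \<P>) \<and>
        openin zariski U \<and> x \<in> U \<and> S \<inter> U = {y\<in>U. \<forall>P\<in>\<P>. pval P y = 0})"

definition zariski_tangent :: "('k::field ^ 'v::finite) set \<Rightarrow> 'k ^ 'v \<Rightarrow> ('k ^ 'v) set" where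
  "zariski_tangent S x = {t. \<forall>P\<in>vanishing_ideal S. pairing (pdiff P x) t = 0}"

definition smooth_stratum :: "('k::field ^ 'v::finite) set \<Rightarrow> bool" where
  "smooth_stratum S \<longleftrightarrow> (\<forall>x\<in>S. nonsingular_point S x)"

section \<open>Limits of families of subspaces\<close>

text \<open>Two topologies enter as parameters, so that limits can be taken either in the
  Euclidean sense (\<^const>\<open>euclidean\<close>) or in the Zariski sense (\<^const>\<open>zariski_pair\<close>,
  \<^const>\<open>zariski_frame\<close>): \<open>\<beta>\<close> on pairs of vectors and \<open>\<gamma>\<close> on pairs consisting of a
  vector and a square matrix.

  The pairs in \<open>plane_closure \<gamma> \<Z>\<close> form the closure of \<open>\<Z>\<close> in the product of affine space
  with the disjoint union of the Grassmannians. A Grassmannian carries the quotient topology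
  of the set of square matrices of the corresponding rank under the row space map; as this
  map is open, the closure may be computed upstairs. In the Euclidean case membership of
  \<open>(x, W)\<close> means that \<open>x\<^sub>m \<longlonglongrightarrow> x\<close> and \<open>W\<^sub>m \<longlonglongrightarrow> W\<close> for some
  sequence of pairs \<open>(x\<^sub>m, W\<^sub>m)\<close> in \<open>\<Z>\<close>.\<close>

definition plane_closure ::
  "(('k::field ^ 'v::finite) \<times> ('k ^ 'v ^ 'v)) topology \<Rightarrow>
   (('k ^ 'v) \<times> ('k ^ 'v) set) set \<Rightarrow> (('k ^ 'v) \<times> ('k ^ 'v) set) set" where
  "plane_closure \<gamma> \<Z> = {(x, vec.span (rows M)) |x M.
     (x, M) \<in> \<gamma> closure_of {(y, L). (y, vec.span (rows L)) \<in> \<Z> \<and> rank L = rank M}}"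

section \<open>Gauss regularity\<close>

definition gauss_graph :: "('k::field ^ 'v::finite) set \<Rightarrow> (('k ^ 'v) \<times> ('k ^ 'v) set) set" where
  "gauss_graph S = {(x, zariski_tangent S x) |x. nonsingular_point S x}"

text \<open>A unique continuous extension of the Gauss map to \<open>S\<close> is expressed by saying that
  the closure of its graph is, over \<open>S\<close>, again the graph of a map. For the Euclidean
  topology this is the usual notion, because Grassmannians are compact. Continuity with
  respect to the Zariski topologies themselves would be too weak: a map from a curve to a
  projective line is Zariski continuous as soon as it has finite fibers.\<close>

definition gauss_regular ::
  "(('k::field ^ 'v::finite) \<times> ('k ^ 'v ^ 'v)) topology \<Rightarrow> ('k ^ 'v) set \<Rightarrow> bool" where
  "gauss_regular \<gamma> S \<longleftrightarrow> open_in_closure S \<and>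
     (\<forall>x\<in>S. \<exists>!W. (x, W) \<in> plane_closure \<gamma> (gauss_graph S))"

definition tangent_at ::
  "(('k::field ^ 'v::finite) \<times> ('k ^ 'v ^ 'v)) topology \<Rightarrow>
   ('k ^ 'v) set \<Rightarrow> 'k ^ 'v \<Rightarrow> ('k ^ 'v) set" where
  "tangent_at \<gamma> S x = (THE W. (x, W) \<in> plane_closure \<gamma> (gauss_graph S))"

section \<open>The Glaeser bundle of a polynomial\<close>

definition Sing :: "('v::finite, 'k::field) mpoly \<Rightarrow> ('k ^ 'v) set" where
  "Sing f = {x. pval f x = 0 \<and> pdiff f x = 0}"

text \<open>The fiber over a noncritical point is the whole line spanned by the differential.\<close>

definition df_bundle :: "('v::finite, 'k::field) mpoly \<Rightarrow> (('k ^ 'v) \<times> ('k ^ 'v)) set" where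
  "df_bundle f = {(x, v). pdiff f x \<noteq> 0 \<and> v \<in> vec.span {pdiff f x}}"

definition fiber :: "(('k ^ 'v) \<times> ('k ^ 'v)) set \<Rightarrow> 'k ^ 'v \<Rightarrow> ('k ^ 'v) set" where
  "fiber T x = {v. (x, v) \<in> T}"

fun glaeser_iter ::
  "(('k::field ^ 'v::finite) \<times> ('k ^ 'v)) topology \<Rightarrow> (('k ^ 'v) \<times> ('k ^ 'v)) set \<Rightarrow>
   nat \<Rightarrow> (('k ^ 'v) \<times> ('k ^ 'v)) set" where
  "glaeser_iter \<beta> T 0 = T"
| "glaeser_iter \<beta> T (Suc p) = {(x, v). v \<in> vec.span (fiber (\<beta> closure_of glaeser_iter \<beta> T p) x)}"

definition glaeser ::
  "(('k::field ^ 'v::finite) \<times> ('k ^ 'v)) topology \<Rightarrow> (('k ^ 'v) \<times> ('k ^ 'v)) set \<Rightarrow>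
   (('k ^ 'v) \<times> ('k ^ 'v)) set" where
  "glaeser \<beta> T = glaeser_iter \<beta> T (LEAST p. glaeser_iter \<beta> T (Suc p) = glaeser_iter \<beta> T p)"

definition restrict_bundle ::
  "(('k ^ 'v) \<times> ('k ^ 'v)) set \<Rightarrow> ('k ^ 'v) set \<Rightarrow> (('k ^ 'v) \<times> ('k ^ 'v)) set" where
  "restrict_bundle T S = {(x, v) \<in> T. x \<in> S}"

definition G_iter ::
  "(('k::field ^ 'v::finite) \<times> ('k ^ 'v)) topology \<Rightarrow> ('v, 'k) mpoly \<Rightarrow>
   nat \<Rightarrow> (('k ^ 'v) \<times> ('k ^ 'v)) set" where
  "G_iter \<beta> f p = restrict_bundle (glaeser_iter \<beta> (df_bundle f) p) (Sing f)"

definition G_bundle ::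
  "(('k::field ^ 'v::finite) \<times> ('k ^ 'v)) topology \<Rightarrow> ('v, 'k) mpoly \<Rightarrow>
   (('k ^ 'v) \<times> ('k ^ 'v)) set" where
  "G_bundle \<beta> f = restrict_bundle (glaeser \<beta> (df_bundle f)) (Sing f)"

definition stabilization_index ::
  "(('k::field ^ 'v::finite) \<times> ('k ^ 'v)) topology \<Rightarrow> ('v, 'k) mpoly \<Rightarrow> nat" where
  "stabilization_index \<beta> f = (LEAST \<rho>. G_iter \<beta> f \<rho> = G_bundle \<beta> f)"

definition quasistratum ::
  "(('k::field ^ 'v::finite) \<times> ('k ^ 'v)) topology \<Rightarrow> ('v, 'k) mpoly \<Rightarrow> nat \<Rightarrow> ('k ^ 'v) set" where
  "quasistratum \<beta> f k = {x \<in> Sing f. vec.dim (fiber (G_bundle \<beta> f) x) = k}"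

section \<open>Stratifications\<close>

definition df_lines :: "('v::finite, 'k::field) mpoly \<Rightarrow> (('k ^ 'v) \<times> ('k ^ 'v) set) set" where
  "df_lines f = {(x, vec.span {pdiff f x}) |x. pdiff f x \<noteq> 0}"

definition thom_condition ::
  "(('k::field ^ 'v::finite) \<times> ('k ^ 'v ^ 'v)) topology \<Rightarrow> ('v, 'k) mpoly \<Rightarrow> ('k ^ 'v) set \<Rightarrow> bool" where
  "thom_condition \<gamma> f S \<longleftrightarrow>
     (\<forall>x\<in>S. \<forall>V. (x, V) \<in> plane_closure \<gamma> (df_lines f) \<longrightarrow> annihilates V (tangent_at \<gamma> S x))"

definition whitney_a ::
  "(('k::field ^ 'v::finite) \<times> ('k ^ 'v ^ 'v)) topology \<Rightarrow> ('k ^ 'v) set \<Rightarrow> ('k ^ 'v) set \<Rightarrow> bool" where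
  "whitney_a \<gamma> S S' \<longleftrightarrow>
     (\<forall>x\<in>S'. \<forall>W. (x, W) \<in> plane_closure \<gamma> {(y, tangent_at \<gamma> S y) |y. y \<in> S} \<longrightarrow>
        tangent_at \<gamma> S' x \<subseteq> W)"

definition TWG_stratification ::
  "(('k::field ^ 'v::finite) \<times> ('k ^ 'v ^ 'v)) topology \<Rightarrow> ('v, 'k) mpoly \<Rightarrow>
   ('k ^ 'v) set set \<Rightarrow> bool" where
  "TWG_stratification \<gamma> f \<S> \<longleftrightarrow> finite \<S> \<and> partition_on (Sing f) \<S> \<and>
     (\<forall>S\<in>\<S>. constructible S \<and> gauss_regular \<gamma> S \<and> thom_condition \<gamma> f S) \<and>
     (\<forall>S\<in>\<S>. \<forall>S'\<in>\<S>. whitney_a \<gamma> S S')"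

definition thom_whitney_a_stratification ::
  "(('k::field ^ 'v::finite) \<times> ('k ^ 'v ^ 'v)) topology \<Rightarrow> ('v, 'k) mpoly \<Rightarrow>
   ('k ^ 'v) set set \<Rightarrow> bool" where
  "thom_whitney_a_stratification \<gamma> f \<S> \<longleftrightarrow>
     TWG_stratification \<gamma> f \<S> \<and> (\<forall>S\<in>\<S>. smooth_stratum S)"

definition universal_stratification ::
  "(('k::field ^ 'v::finite) \<times> ('k ^ 'v ^ 'v)) topology \<Rightarrow> ('v, 'k) mpoly \<Rightarrow>
   ('k ^ 'v) set set \<Rightarrow> bool" where
  "universal_stratification \<gamma> f \<S> \<longleftrightarrow> TWG_stratification \<gamma> f \<S> \<and>
     (\<forall>S\<in>(\<Union>Q\<in>\<S>. constructible_components Q). \<forall>\<S>'. TWG_stratification \<gamma> f \<S>' \<longrightarrow>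
        (\<exists>S'\<in>(\<Union>Q\<in>\<S>'. constructible_components Q).
           open_dense_in (S \<inter> S') S \<and> open_dense_in (S \<inter> S') S'))"

definition functorial_stratification ::
  "(('k::field ^ 'v::finite) \<times> ('k ^ 'v)) topology \<Rightarrow> (('k ^ 'v) \<times> ('k ^ 'v ^ 'v)) topology \<Rightarrow>
   ('v, 'k) mpoly \<Rightarrow> ('k ^ 'v) set set \<Rightarrow> bool" where
  "functorial_stratification \<beta> \<gamma> f \<S> \<longleftrightarrow> universal_stratification \<gamma> f \<S> \<and>
     \<S> = range (quasistratum \<beta> f) - {{}}"

section \<open>The generic quadratic form\<close>

text \<open>The number \<open>n\<close> of the variables \<open>X\<^sub>i\<close> is \<open>CARD('n)\<close>, and \<open>'n quad_var\<close> indexes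
  all the variables \<open>A\<^sub>i\<^sub>j\<close>, \<open>i \<le> j\<close>, and \<open>X\<^sub>i\<close>.\<close>

typedef (overloaded) ('n::linorder) upper_pair = "{(i :: 'n, j :: 'n). i \<le> j}"
  by auto

instance upper_pair :: ("{finite, linorder}") finite
proof
  have "inj (Rep_upper_pair :: 'a upper_pair \<Rightarrow> 'a \<times> 'a)"
    by (simp add: inj_def Rep_upper_pair_inject)
  then show "finite (UNIV :: 'a upper_pair set)"
    using finite_imageD[of Rep_upper_pair "UNIV :: 'a upper_pair set"] finite by blast
qed

type_synonym 'n quad_var = "'n upper_pair + 'n"

definition var_A :: "'n::linorder \<Rightarrow> 'n \<Rightarrow> 'n quad_var" where
  "var_A i j = Inl (Abs_upper_pair (i, j))"

definition var_X :: "'n::linorder \<Rightarrow> 'n quad_var" where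
  "var_X i = Inr i"

definition generic_quadric :: "('n::{finite,linorder} quad_var, 'k::field) mpoly" where
  "generic_quadric =
     (\<Sum>(i, j)\<in>{(i, j). i \<le> j}. pvar (var_A i j) * pvar (var_X i) * pvar (var_X j))"

text \<open>The symmetric matrix of the quadratic form with coefficients \<open>a\<^sub>i\<^sub>j\<close>, \<open>i \<le> j\<close>.\<close>

definition form_matrix ::
  "'k::field ^ ('n::{finite,linorder} quad_var) \<Rightarrow> (('k, 'n) vec, 'n) vec" where
  "form_matrix x = (\<chi> i j. if i = j then x $ var_A i i else x $ var_A (min i j) (max i j) / 2)"

definition rank_stratum :: "nat \<Rightarrow> ('k::field ^ ('n::{finite,linorder} quad_var)) set" where
  "rank_stratum q = {x. (\<forall>i. x $ var_X i = 0) \<and> rank (form_matrix x) = q}"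

end

theory Submission
  imports Defs
begin

text \<open>A point of affine space is a pair \<open>(A, X)\<close> of a symmetric matrix and a vector, and
  \<open>f = X\<^sup>T A X\<close>. A covector is likewise written \<open>(V, w)\<close> with \<open>V\<close> symmetric, the pairing being
  \<open>tr (V A) + w\<^sup>T X\<close>; the differential of \<open>f\<close> is \<open>(X X\<^sup>T, 2 A X)\<close>. It satisfies \<open>2 A V = w X\<^sup>T\<close>, and
  this closed condition forces every limit of differentials at a singular point \<open>(A, 0)\<close> into the
  linear space \<open>A V = 0\<close> (\<open>limit_covectors\<close>). Conversely limits along straight segments span that
  space (\<open>ann_df_limits\<close>). Hence the first Glaeser step already produces a closed bundle with
  linear fibers, the index of stabilization is 1, and \<open>G\<close> has the fibers \<open>{(V, w). A V = 0}\<close>, whose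
  dimension is a strictly decreasing function of the rank of \<open>A\<close> (\<open>dim_limit_covectors_less\<close>): the
  quasistrata are the sets of forms of given rank.

  The tangent space of a rank stratum at \<open>(A, 0)\<close> is the annihilator of the fiber \<open>{A V = 0}\<close>
  (\<open>tangent_rank_stratum\<close>): a symmetric matrix is tangent to the congruence orbit of \<open>A\<close> iff it
  vanishes as a quadratic form on the kernel of \<open>A\<close> (\<open>orbit_tangent\<close>), and explicit equations show
  that the stratum is smooth with no larger tangent space (\<open>rank_stratum_local_equations\<close>).
  The Thom condition is therefore the inclusion of limits of differentials in \<open>{A V = 0}\<close>, and
  the Whitney condition says that limits of the spaces \<open>{A V = 0}\<close> again satisfy \<open>A V = 0\<close>.

  For universality let \<open>R\<close> be a stratum of another Thom stratification that is dense in a rank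
  stratum \<open>B\<close>, which is irreducible. The Thom condition confines the tangent planes of \<open>R\<close> at
  points of \<open>B\<close> to the annihilator of all limits of differentials, that is, to the tangent space of
  \<open>B\<close>. If the closure of \<open>R\<close> had a component strictly larger than the closure of \<open>B\<close>, nearby
  nonsingular points of \<open>R\<close> would have tangent spaces of dimension larger than \<open>dim B\<close>
  (\<open>tangent_dimension_of_larger_irreducible_set\<close>), a contradiction (\<open>universal_component\<close>). The
  dimension estimate extends the partial derivatives of algebraically independent functions to vector
  fields along the larger component.

  All limits are taken in a topology for which polynomial equations are closed conditions and
  polynomial curves have their limits (\<open>poly_topology\<close>). The Euclidean and the Zariski topologies
  share these two properties, so that one argument covers the three cases.\<close>

section \<open>Polynomials in several variables\<close>

definition pconst :: "'k::field \<Rightarrow> ('v, 'k) mpoly" where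
  "pconst c = Poly_Mapping.single 0 c"

lemma mpoly_eq_sum_single:
  "P = (\<Sum>m\<in>Poly_Mapping.keys P. Poly_Mapping.single m (Poly_Mapping.lookup P m))"
  by (rule poly_mapping_eqI)
     (auto simp: lookup_sum lookup_single when_def in_keys_iff)

lemma mpoly_sum_induct [case_names zero single add]:
  fixes P :: "('v, 'k::field) mpoly"
  assumes "Q 0" "\<And>m c. Q (Poly_Mapping.single m c)" "\<And>A B. Q A \<Longrightarrow> Q B \<Longrightarrow> Q (A + B)"
  shows "Q P"
proof -
  have "Q (\<Sum>m\<in>A. Poly_Mapping.single m (Poly_Mapping.lookup P m))" if "finite A" for A
    using that by (induction A rule: finite_induct) (auto intro: assms)
  then show ?thesis by (subst mpoly_eq_sum_single) simp
qed

lemma mpoly_induct [case_names const var add mult]: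
  fixes P :: "('v, 'k::field) mpoly"
  assumes const: "\<And>c. Q (pconst c)" and var: "\<And>i. Q (pvar i)"
    and add: "\<And>A B. Q A \<Longrightarrow> Q B \<Longrightarrow> Q (A + B)"
    and mult: "\<And>A B. Q A \<Longrightarrow> Q B \<Longrightarrow> Q (A * B)"
  shows "Q P"
proof -
  have power: "Q (Poly_Mapping.single (Poly_Mapping.single i k) 1)" for i k
  proof (induction k)
    case 0
    show ?case using const[of 1] by (simp add: pconst_def)
  next
    case (Suc k)
    have "Poly_Mapping.single (Poly_Mapping.single i (Suc k)) (1::'k)
        = pvar i * Poly_Mapping.single (Poly_Mapping.single i k) 1"
      by (simp add: pvar_def mult_single flip: single_add)
    then show ?case using mult[OF var Suc] by metis
  qed
  have single: "Q (Poly_Mapping.single m c)" for m c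
  proof (induction m arbitrary: c rule: update_induct)
    case const
    show ?case using assms(1)[of c] by (simp add: pconst_def)
  next
    case (update f a b)
    have "Poly_Mapping.update a b f = Poly_Mapping.single a b + f"
      using update by (intro poly_mapping_eqI)
        (auto simp: lookup_update lookup_add lookup_single when_def in_keys_iff)
    then have "Poly_Mapping.single (Poly_Mapping.update a b f) c
        = Poly_Mapping.single (Poly_Mapping.single a b) 1 * Poly_Mapping.single f c"
      by (simp add: mult_single)
    then show ?case using mult[OF power update(3)] by metis
  qed
  have "Q 0" using const[of 0] by (simp add: pconst_def)
  then show ?thesis using single add by (rule mpoly_sum_induct)
qed

subsection \<open>Evaluation\<close>

lemma peval_superset:
  assumes "finite A" "Poly_Mapping.keys P \<subseteq> A"
  shows "peval P x = (\<Sum>m\<in>A. Poly_Mapping.lookup P m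
     * (\<Prod>i\<in>Poly_Mapping.keys m. x i ^ Poly_Mapping.lookup m i))"
  unfolding peval_def using assms
  by (intro sum.mono_neutral_left) (auto simp: in_keys_iff)

lemma peval_single:
  "peval (Poly_Mapping.single m c) x
    = c * (\<Prod>i\<in>Poly_Mapping.keys m. x i ^ Poly_Mapping.lookup m i)"
  by (subst peval_superset[of "{m}"]) auto

lemma peval_pconst [simp]: "peval (pconst c) x = c"
  by (simp add: pconst_def peval_single)

lemma peval_pvar [simp]: "peval (pvar i) x = x i"
  by (simp add: pvar_def peval_single)

lemma peval_add [simp]: "peval (P + Q) x = peval P x + peval Q x"
proof -
  let ?A = "Poly_Mapping.keys P \<union> Poly_Mapping.keys Q"
  have "Poly_Mapping.keys (P + Q) \<subseteq> ?A" by (rule keys_add)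
  then show ?thesis
    by (simp add: peval_superset[of ?A] lookup_add distrib_right sum.distrib)
qed

lemma peval_zero [simp]: "peval 0 x = 0"
  by (simp add: peval_def)

lemma peval_sum [simp]: "peval (\<Sum>i\<in>A. P i) x = (\<Sum>i\<in>A. peval (P i) x)"
  by (induction A rule: infinite_finite_induct) auto

lemma peval_one [simp]: "peval 1 x = 1"
  using peval_pconst[of 1 x] by (simp add: pconst_def)

lemma monomial_eval_add:
  "(\<Prod>i\<in>Poly_Mapping.keys (m + n). x i ^ Poly_Mapping.lookup (m + n) i)
   = (\<Prod>i\<in>Poly_Mapping.keys m. x i ^ Poly_Mapping.lookup m i)
   * (\<Prod>i\<in>Poly_Mapping.keys n. (x i :: 'k::field) ^ Poly_Mapping.lookup n i)"
proof -
  let ?A = "Poly_Mapping.keys m \<union> Poly_Mapping.keys n"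
  have *: "(\<Prod>i\<in>Poly_Mapping.keys k. x i ^ Poly_Mapping.lookup k i)
      = (\<Prod>i\<in>?A. x i ^ Poly_Mapping.lookup k i)" if "Poly_Mapping.keys k \<subseteq> ?A" for k
    using that by (intro prod.mono_neutral_left) (auto simp: in_keys_iff)
  have "(\<Prod>i\<in>Poly_Mapping.keys (m + n). x i ^ Poly_Mapping.lookup (m + n) i)
      = (\<Prod>i\<in>?A. x i ^ Poly_Mapping.lookup (m + n) i)"
    by (intro * keys_add)
  also have "\<dots> = (\<Prod>i\<in>?A. x i ^ Poly_Mapping.lookup m i) * (\<Prod>i\<in>?A. x i ^ Poly_Mapping.lookup n i)"
    by (simp add: lookup_add power_add prod.distrib)
  finally show ?thesis by (simp add: *)
qed

lemma peval_mult [simp]: "peval (P * Q) x = peval P x * peval Q x"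
proof -
  have "P * Q = (\<Sum>m\<in>Poly_Mapping.keys P. Poly_Mapping.single m (Poly_Mapping.lookup P m))
      * (\<Sum>m\<in>Poly_Mapping.keys Q. Poly_Mapping.single m (Poly_Mapping.lookup Q m))"
    by (rule arg_cong2[where f = "(*)", OF mpoly_eq_sum_single mpoly_eq_sum_single])
  then have "peval (P * Q) x
      = peval (\<Sum>m\<in>Poly_Mapping.keys P. \<Sum>n\<in>Poly_Mapping.keys Q.
          Poly_Mapping.single m (Poly_Mapping.lookup P m) *
          Poly_Mapping.single n (Poly_Mapping.lookup Q n)) x"
    by (simp add: sum_product)
  also have "\<dots> = (\<Sum>m\<in>Poly_Mapping.keys P. \<Sum>n\<in>Poly_Mapping.keys Q.
        (Poly_Mapping.lookup P m * (\<Prod>i\<in>Poly_Mapping.keys m. x i ^ Poly_Mapping.lookup m i))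
      * (Poly_Mapping.lookup Q n * (\<Prod>i\<in>Poly_Mapping.keys n. x i ^ Poly_Mapping.lookup n i)))"
    by (simp add: mult_single peval_single monomial_eval_add algebra_simps)
  also have "\<dots> = peval P x * peval Q x"
    by (simp add: peval_def sum_product)
  finally show ?thesis .
qed

lemma pconst_hom: "pconst 0 = 0" "pconst 1 = 1" "pconst (a + b) = pconst a + pconst b"
   "pconst (a * b) = pconst a * pconst b" "pconst (- a) = - pconst a"
  by (simp_all add: pconst_def single_add mult_single single_uminus)

lemma peval_minus [simp]: "peval (- P) x = - peval P x"
proof -
  have "peval (- P) x + peval P x = 0" unfolding peval_add[symmetric] by simp
  then show ?thesis by (simp add: eq_neg_iff_add_eq_0)
qed

lemma peval_diff [simp]: "peval (P - Q) x = peval P x - peval Q x"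
  by (metis diff_conv_add_uminus peval_add peval_minus)

subsection \<open>Partial derivatives\<close>

lemma lookup_ppartial:
  "Poly_Mapping.lookup (ppartial i P) m
    = of_nat (Suc (Poly_Mapping.lookup m i)) * Poly_Mapping.lookup P (m + Poly_Mapping.single i 1)"
proof -
  let ?e = "Poly_Mapping.single i (1::nat)"
  have eq: "n = m + ?e" if "n - ?e = m" "Poly_Mapping.lookup n i \<noteq> 0" for n
  proof (rule poly_mapping_eqI)
    fix k show "Poly_Mapping.lookup n k = Poly_Mapping.lookup (m + ?e) k"
      unfolding that(1)[symmetric] lookup_add lookup_single lookup_minus when_def
      using that(2) by (cases "i = k") simp_all
  qed
  have "Poly_Mapping.lookup (ppartial i P) m = (\<Sum>n\<in>Poly_Mapping.keys P.
      (of_nat (Poly_Mapping.lookup n i) * Poly_Mapping.lookup P n when n - ?e = m))"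
    by (simp add: ppartial_def lookup_sum lookup_single)
  also have "\<dots> = (\<Sum>n\<in>Poly_Mapping.keys P.
      (of_nat (Poly_Mapping.lookup n i) * Poly_Mapping.lookup P n when n = m + ?e))"
  proof (intro sum.cong refl)
    fix n
    show "(of_nat (Poly_Mapping.lookup n i) * Poly_Mapping.lookup P n when n - ?e = m)
       = (of_nat (Poly_Mapping.lookup n i) * Poly_Mapping.lookup P n when n = m + ?e)"
    proof (cases "Poly_Mapping.lookup n i = 0")
      case False
      then have "n - ?e = m \<longleftrightarrow> n = m + ?e"
        using eq[of n] add_diff_cancel_right'[of m ?e] by blast
      then show ?thesis by simp
    qed simp
  qed
  also have "\<dots> = of_nat (Suc (Poly_Mapping.lookup m i)) * Poly_Mapping.lookup P (m + ?e)"
    by (simp add: when_def lookup_add in_keys_iff del: One_nat_def)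
  finally show ?thesis .
qed

lemma ppartial_add: "ppartial i (P + Q) = ppartial i P + ppartial i Q"
  by (rule poly_mapping_eqI) (simp add: lookup_ppartial lookup_add algebra_simps)

lemma ppartial_zero [simp]: "ppartial i 0 = 0"
  by (simp add: ppartial_def)

lemma single_add_neq_zero: "0 \<noteq> m + Poly_Mapping.single i (Suc 0)"
proof
  assume "0 = m + Poly_Mapping.single i (Suc 0)"
  then have "Poly_Mapping.lookup 0 i = Poly_Mapping.lookup (m + Poly_Mapping.single i (Suc 0)) i"
    by (rule arg_cong)
  then show False by (simp add: lookup_add)
qed

lemma ppartial_pconst [simp]: "ppartial i (pconst c) = 0"
  by (rule poly_mapping_eqI)
     (auto simp: lookup_ppartial pconst_def lookup_single when_def single_add_neq_zero)

lemma ppartial_commute: "ppartial i (ppartial j P) = ppartial j (ppartial i P)"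
  by (rule poly_mapping_eqI)
     (auto simp: lookup_ppartial lookup_add lookup_single when_def algebra_simps)

lemma ppartial_single:
  "ppartial i (Poly_Mapping.single m c)
    = Poly_Mapping.single (m - Poly_Mapping.single i 1) (of_nat (Poly_Mapping.lookup m i) * c)"
  by (cases "c = 0") (simp_all add: ppartial_def)

lemma ppartial_pvar: "ppartial i (pvar j) = (if i = j then 1 else 0)"
  by (auto simp: pvar_def ppartial_single lookup_single)

lemma ppartial_mult:
  fixes P Q :: "('v, 'k::field) mpoly"
  shows "ppartial i (P * Q) = ppartial i P * Q + P * ppartial i Q"
proof -
  let ?e = "Poly_Mapping.single i (1::nat)"
  have shift: "m - ?e + n = m + n - ?e" if "Poly_Mapping.lookup m i \<noteq> 0" for m n :: "'v \<Rightarrow>\<^sub>0 nat"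
    using that by (intro poly_mapping_eqI) (auto simp: lookup_add lookup_minus lookup_single when_def)
  have shift': "n + (m - ?e) = n + m - ?e" if "Poly_Mapping.lookup m i \<noteq> 0" for m n :: "'v \<Rightarrow>\<^sub>0 nat"
    using shift[OF that, of n] by (simp add: add.commute)
  have mono: "ppartial i (Poly_Mapping.single m c * Poly_Mapping.single n d)
    = ppartial i (Poly_Mapping.single m c) * Poly_Mapping.single n d
    + Poly_Mapping.single m c * ppartial i (Poly_Mapping.single n d)"
    for m n and c d :: 'k
  proof -
    have 1: "ppartial i (Poly_Mapping.single m c) * Poly_Mapping.single n d
        = Poly_Mapping.single (m + n - ?e) (of_nat (Poly_Mapping.lookup m i) * (c * d))"
      unfolding ppartial_single mult_single mult.assoc
      by (cases "Poly_Mapping.lookup m i = 0") (simp, subst shift, assumption, rule refl)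
    have 2: "Poly_Mapping.single m c * ppartial i (Poly_Mapping.single n d)
        = Poly_Mapping.single (m + n - ?e) (of_nat (Poly_Mapping.lookup n i) * (c * d))"
      unfolding ppartial_single mult_single mult.left_commute[of c]
      by (cases "Poly_Mapping.lookup n i = 0") (simp, subst shift', assumption, rule refl)
    have 3: "ppartial i (Poly_Mapping.single m c * Poly_Mapping.single n d)
        = Poly_Mapping.single (m + n - ?e)
            (of_nat (Poly_Mapping.lookup m i) * (c * d) + of_nat (Poly_Mapping.lookup n i) * (c * d))"
      unfolding mult_single ppartial_single lookup_add of_nat_add distrib_right by (rule refl)
    show ?thesis unfolding 1 2 3 by (rule single_add)
  qed
  show ?thesis
  proof (induction P rule: mpoly_sum_induct)
    case zero
    show ?case by simp
  next
    case (single m c)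
    show ?case
    proof (induction Q rule: mpoly_sum_induct)
      case (add A B)
      then show ?case by (simp add: ppartial_add distrib_left)
    qed (simp_all only: mono ppartial_zero mult_zero_right add_0)
  next
    case (add A B)
    then show ?case by (simp add: ppartial_add distrib_right)
  qed
qed

lemma ppartial_uminus: "ppartial i (- P) = - ppartial i P"
  by (rule poly_mapping_eqI) (simp add: lookup_ppartial)

text \<open>The chain rule along a polynomial curve computes tangent vectors of parametrized sets over any
  field, with formal derivatives.\<close>

lemma chain_rule_curve:
  fixes P :: "('v::finite, 'k::field) mpoly" and c :: "'v \<Rightarrow> 'k poly"
  obtains p where "\<And>t. poly p t = peval P (\<lambda>i. poly (c i) t)"
    and "\<And>t. poly (pderiv p) t
           = (\<Sum>i\<in>UNIV. peval (ppartial i P) (\<lambda>i. poly (c i) t) * poly (pderiv (c i)) t)"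
proof -
  have "\<exists>p. (\<forall>t. poly p t = peval P (\<lambda>i. poly (c i) t)) \<and> (\<forall>t. poly (pderiv p) t
           = (\<Sum>i\<in>UNIV. peval (ppartial i P) (\<lambda>i. poly (c i) t) * poly (pderiv (c i)) t))"
  proof (induction P rule: mpoly_induct)
    case (const a)
    show ?case by (rule exI[of _ "[:a:]"]) (simp add: pderiv_pCons)
  next
    case (var i)
    have "peval (ppartial j (pvar i)) x * a = (if j = i then a else 0)" for j x and a :: 'k
      by (simp add: ppartial_pvar)
    then show ?case by (intro exI[of _ "c i"]) simp
  next
    case (add A B)
    then obtain a b where "\<forall>t. poly a t = peval A (\<lambda>i. poly (c i) t)"
      "\<forall>t. poly b t = peval B (\<lambda>i. poly (c i) t)"
      "\<forall>t. poly (pderiv a) t = (\<Sum>i\<in>UNIV. peval (ppartial i A) (\<lambda>i. poly (c i) t) * poly (pderiv (c i)) t)"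
      "\<forall>t. poly (pderiv b) t = (\<Sum>i\<in>UNIV. peval (ppartial i B) (\<lambda>i. poly (c i) t) * poly (pderiv (c i)) t)"
      by auto
    then show ?case
      by (intro exI[of _ "a + b"]) (simp add: pderiv_add ppartial_add distrib_right sum.distrib)
  next
    case (mult A B)
    then obtain a b where "\<forall>t. poly a t = peval A (\<lambda>i. poly (c i) t)"
      "\<forall>t. poly b t = peval B (\<lambda>i. poly (c i) t)"
      "\<forall>t. poly (pderiv a) t = (\<Sum>i\<in>UNIV. peval (ppartial i A) (\<lambda>i. poly (c i) t) * poly (pderiv (c i)) t)"
      "\<forall>t. poly (pderiv b) t = (\<Sum>i\<in>UNIV. peval (ppartial i B) (\<lambda>i. poly (c i) t) * poly (pderiv (c i)) t)"
      by auto
    then show ?case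
      by (intro exI[of _ "a * b"])
         (simp add: pderiv_mult ppartial_mult algebra_simps sum.distrib sum_distrib_left)
  qed
  then show thesis using that by blast
qed

subsection \<open>Evaluation at vectors and differentials\<close>

lemma pval_simps [simp]:
  "pval (pconst c) x = c" "pval (pvar i) x = x $ i" "pval 0 x = 0" "pval 1 x = 1"
  "pval (P + Q) x = pval P x + pval Q x" "pval (P * Q) x = pval P x * pval Q x"
  "pval (P - Q) x = pval P x - pval Q x" "pval (- P) x = - pval P x"
  "pval (\<Sum>a\<in>A. R a) x = (\<Sum>a\<in>A. pval (R a) x)"
  by (simp_all add: pval_def)

lemma pdiff_add: "pdiff (P + Q) x = pdiff P x + pdiff Q x"
  by (simp add: pdiff_def vec_eq_iff ppartial_add)

lemma pdiff_zero [simp]: "pdiff 0 x = 0"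
  by (simp add: pdiff_def vec_eq_iff)

lemma pdiff_mult: "pdiff (P * Q) x = pval Q x *s pdiff P x + pval P x *s pdiff Q x"
  by (simp add: pdiff_def vec_eq_iff ppartial_mult algebra_simps)

lemma pdiff_pvar: "pdiff (pvar i) x = axis i 1"
  by (auto simp: pdiff_def vec_eq_iff ppartial_pvar axis_def)

lemma pairing_add_left: "pairing (v + w) t = pairing v t + pairing w t"
  by (simp add: pairing_def distrib_right sum.distrib)
lemma pairing_add_right: "pairing v (s + t) = pairing v s + pairing v t"
  by (simp add: pairing_def distrib_left sum.distrib)
lemma pairing_scale_left [simp]: "pairing (c *s v) t = c * pairing v t"
  by (simp add: pairing_def sum_distrib_left mult.assoc)
lemma pairing_scale_right [simp]: "pairing v (c *s t) = c * pairing v t"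
  by (simp add: pairing_def sum_distrib_left mult.left_commute)
lemma pairing_zero [simp]: "pairing 0 t = 0" "pairing v 0 = 0"
  by (simp_all add: pairing_def)
lemma pairing_axis [simp]: "pairing (axis i c) t = c * t $ i" "pairing t (axis i c) = t $ i * c"
proof -
  have "axis i c $ j * b = (if j = i then c * b else 0)" "b * axis i c $ j = (if j = i then b * c else 0)"
    for j b by (auto simp: axis_def)
  then show "pairing (axis i c) t = c * t $ i" "pairing t (axis i c) = t $ i * c"
    by (simp_all add: pairing_def)
qed
lemma pairing_commute: "pairing v w = pairing w v"
  by (simp add: pairing_def mult.commute)
lemma pairing_sum_left: "pairing (\<Sum>a\<in>A. f a) t = (\<Sum>a\<in>A. pairing (f a) t)"
  by (induction A rule: infinite_finite_induct) (auto simp: pairing_add_left)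
lemma pairing_diff_left: "pairing (v - w) t = pairing v t - pairing w t"
  by (simp add: pairing_def left_diff_distrib sum_subtractf)
lemma chain_rule_pval:
  fixes P :: "('v::finite, 'k::field) mpoly" and c :: "'v \<Rightarrow> 'k poly"
  obtains p where "\<And>t. poly p t = pval P (\<chi> i. poly (c i) t)"
    and "\<And>t. poly (pderiv p) t = pairing (pdiff P (\<chi> i. poly (c i) t)) (\<chi> i. poly (pderiv (c i)) t)"
  by (rule chain_rule_curve[of P c]) (auto simp: pval_def pdiff_def pairing_def)

subsection \<open>Polynomial functions of one and of several variables\<close>

definition upoly :: "('k \<Rightarrow> 'k::field) \<Rightarrow> bool" where
  "upoly f \<longleftrightarrow> (\<exists>p. \<forall>t. f t = poly p t)"

text \<open>A function is polynomial relative to a family \<open>c\<close> of coordinate functions, which makes the notion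
  available on products as well as on vectors.\<close>

definition polyfun :: "('i \<Rightarrow> 'p \<Rightarrow> 'k::field) \<Rightarrow> ('p \<Rightarrow> 'k) \<Rightarrow> bool" where
  "polyfun c f \<longleftrightarrow> (\<exists>P. \<forall>z. f z = peval P (\<lambda>i. c i z))"

lemma upoly_closed:
  "upoly (\<lambda>t. a)" "upoly (\<lambda>t. t)"
  "upoly f \<Longrightarrow> upoly g \<Longrightarrow> upoly (\<lambda>t. f t + g t)"
  "upoly f \<Longrightarrow> upoly g \<Longrightarrow> upoly (\<lambda>t. f t * g t)"
  "upoly f \<Longrightarrow> upoly g \<Longrightarrow> upoly (\<lambda>t. f t - g t)"
  "upoly f \<Longrightarrow> upoly (\<lambda>t. - f t)"
proof -
  show "upoly (\<lambda>t. a)" unfolding upoly_def by (rule exI[of _ "[:a:]"]) simp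
  show "upoly (\<lambda>t. t)" unfolding upoly_def by (rule exI[of _ "[:0,1:]"]) simp
  show "upoly f \<Longrightarrow> upoly g \<Longrightarrow> upoly (\<lambda>t. f t + g t)"
    unfolding upoly_def by (elim exE, rule_tac x = "p + pa" in exI) simp
  show "upoly f \<Longrightarrow> upoly g \<Longrightarrow> upoly (\<lambda>t. f t * g t)"
    unfolding upoly_def by (elim exE, rule_tac x = "p * pa" in exI) simp
  show "upoly f \<Longrightarrow> upoly g \<Longrightarrow> upoly (\<lambda>t. f t - g t)"
    unfolding upoly_def by (elim exE, rule_tac x = "p - pa" in exI) simp
  show "upoly f \<Longrightarrow> upoly (\<lambda>t. - f t)"
    unfolding upoly_def by (elim exE, rule_tac x = "- p" in exI) simp
qed

lemma upoly_sum: "(\<And>a. a \<in> A \<Longrightarrow> upoly (f a)) \<Longrightarrow> upoly (\<lambda>t. \<Sum>a\<in>A. f a t)"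
proof (induction A rule: infinite_finite_induct)
  case (insert a A)
  then have "upoly (f a)" "upoly (\<lambda>z. \<Sum> b\<in>A. f b z)" by blast+
  from upoly_closed(3)[OF this] insert(1,2) show ?case by simp
qed (simp_all add: upoly_closed(1))

lemma polyfun_closed:
  "polyfun c (\<lambda>z. a)" "polyfun c (c i)"
  "polyfun c f \<Longrightarrow> polyfun c g \<Longrightarrow> polyfun c (\<lambda>z. f z + g z)"
  "polyfun c f \<Longrightarrow> polyfun c g \<Longrightarrow> polyfun c (\<lambda>z. f z * g z)"
  "polyfun c f \<Longrightarrow> polyfun c g \<Longrightarrow> polyfun c (\<lambda>z. f z - g z)"
  "polyfun c f \<Longrightarrow> polyfun c (\<lambda>z. - f z)"
proof -
  show "polyfun c (\<lambda>z. a)" unfolding polyfun_def by (rule exI[of _ "pconst a"]) simp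
  show "polyfun c (c i)" unfolding polyfun_def by (rule exI[of _ "pvar i"]) simp
  show "polyfun c f \<Longrightarrow> polyfun c g \<Longrightarrow> polyfun c (\<lambda>z. f z + g z)"
    unfolding polyfun_def by (elim exE, rule_tac x = "P + Pa" in exI) simp
  show "polyfun c f \<Longrightarrow> polyfun c g \<Longrightarrow> polyfun c (\<lambda>z. f z * g z)"
    unfolding polyfun_def by (elim exE, rule_tac x = "P * Pa" in exI) simp
  show "polyfun c f \<Longrightarrow> polyfun c g \<Longrightarrow> polyfun c (\<lambda>z. f z - g z)"
    unfolding polyfun_def by (elim exE, rule_tac x = "P - Pa" in exI) simp
  show "polyfun c f \<Longrightarrow> polyfun c (\<lambda>z. - f z)"
    unfolding polyfun_def by (elim exE, rule_tac x = "- P" in exI) simp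
qed

lemma polyfun_sum:
  "(\<And>a. a \<in> A \<Longrightarrow> polyfun c (f a)) \<Longrightarrow> polyfun c (\<lambda>z. \<Sum>a\<in>A. f a z)"
proof (induction A rule: infinite_finite_induct)
  case (insert a A)
  then have "polyfun c (f a)" "polyfun c (\<lambda>z. \<Sum> b\<in>A. f b z)" by blast+
  from polyfun_closed(3)[OF this] insert(1,2) show ?case by simp
qed (simp_all add: polyfun_closed(1))

lemma polyfun_prod:
  "(\<And>a. a \<in> A \<Longrightarrow> polyfun c (f a)) \<Longrightarrow> polyfun c (\<lambda>z. \<Prod>a\<in>A. f a z)"
proof (induction A rule: infinite_finite_induct)
  case (insert a A)
  then have "polyfun c (f a)" "polyfun c (\<lambda>z. \<Prod> b\<in>A. f b z)" by blast+
  from polyfun_closed(4)[OF this] insert(1,2) show ?case by simp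
qed (simp_all add: polyfun_closed(1))

lemma polyfun_det:
  fixes M :: "'p \<Rightarrow> 'k::field^'n::finite^'n"
  assumes "\<And>i j. polyfun c (\<lambda>z. M z $ i $ j)"
  shows "polyfun c (\<lambda>z. det (M z))"
  unfolding det_def
  by (rule polyfun_sum, rule polyfun_closed(4), rule polyfun_closed(1), rule polyfun_prod, rule assms)

lemma polyfun_compose:
  assumes "\<And>i. polyfun c (d i)" "polyfun d f"
  shows "polyfun c f"
proof -
  have all: "polyfun c (\<lambda>z. peval Q (\<lambda>i. d i z))" for Q
  proof (induction Q rule: mpoly_induct)
    case (const a) show ?case by (simp add: polyfun_closed(1))
  next
    case (var i) show ?case using assms(1)[of i] by simp
  next
    case (add A B) show ?case using polyfun_closed(3)[OF add] by simp
  next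
    case (mult A B) show ?case using polyfun_closed(4)[OF mult] by simp
  qed
  from assms(2)[unfolded polyfun_def] obtain P where P: "\<forall>z. f z = peval P (\<lambda>i. d i z)" ..
  have eq: "f = (\<lambda>z. peval P (\<lambda>i. d i z))" by (rule ext) (rule P[rule_format])
  show ?thesis unfolding eq by (rule all)
qed

lemma upoly_compose:
  assumes "\<And>i. upoly (\<lambda>t. x t i)"
  shows "upoly (\<lambda>t. peval P (x t))"
proof (induction P rule: mpoly_induct)
  case (const a) show ?case by (simp add: upoly_closed(1))
next
  case (var i) show ?case using assms(1)[of i] by simp
next
  case (add A B) show ?case using upoly_closed(3)[OF add] by simp
next
  case (mult A B) show ?case using upoly_closed(4)[OF mult] by simp
qed

lemma upoly_finite_zeros:
  fixes f :: "'k::field \<Rightarrow> 'k"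
  assumes "upoly f" "f a \<noteq> 0"
  shows "finite {t. f t = 0}"
proof -
  obtain p where p: "\<And>t. f t = poly p t" using assms(1) unfolding upoly_def by blast
  have "p \<noteq> 0" using assms(2) p[of a] by auto
  then show ?thesis using poly_roots_finite[of p] by (simp add: p)
qed

abbreviation coord :: "'v::finite \<Rightarrow> 'k::field^'v \<Rightarrow> 'k" where "coord \<equiv> (\<lambda>i x. x $ i)"

lemma polyfun_coord: "polyfun coord f \<longleftrightarrow> (\<exists>P. \<forall>x. f x = pval P x)"
  by (simp add: polyfun_def pval_def)

lemma polyfun_pval: "polyfun coord (pval P)"
  by (auto simp: polyfun_coord)

section \<open>Zariski closures and irreducible sets\<close>

lemma openin_zariski_coords:
  "polyfun c f \<Longrightarrow> openin (zariski_coords c) {z. f z \<noteq> 0}"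
proof -
  assume "polyfun c f"
  from this[unfolded polyfun_def] obtain P where P: "\<forall>z. f z = peval P (\<lambda>i. c i z)" ..
  have "f = (\<lambda>z. peval P (\<lambda>i. c i z))" by (rule ext) (rule P[rule_format])
  then have "{z. f z \<noteq> 0} = {z. peval P (\<lambda>i. c i z) \<noteq> 0}" by (rule ssubst) (rule refl)
  then show ?thesis
    unfolding zariski_coords_def by (intro topology_generated_by_Basis) blast
qed

lemma zariski_coords_basis:
  assumes "openin (zariski_coords c) U" "z \<in> U"
  obtains f where "polyfun c f" "f z \<noteq> 0" "{w. f w \<noteq> 0} \<subseteq> U"
proof -
  have "generate_topology_on {{z. peval P (\<lambda>i. c i z) \<noteq> 0} |P. P \<in> UNIV} U"
    using assms(1) unfolding zariski_coords_def openin_topology_generated_by_iff .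
  then have "\<forall>z\<in>U. \<exists>f. polyfun c f \<and> f z \<noteq> 0 \<and> {w. f w \<noteq> 0} \<subseteq> U"
  proof induction
    case Empty
    show ?case by simp
  next
    case (Int a b)
    show ?case
    proof
      fix z assume "z \<in> a \<inter> b"
      then have "z \<in> a" "z \<in> b" by auto
      from Int(3)[rule_format, OF this(1)] obtain f where
        f: "polyfun c f" "f z \<noteq> 0" "{w. f w \<noteq> 0} \<subseteq> a" by (elim exE conjE)
      from Int(4)[rule_format, OF \<open>z \<in> b\<close>] obtain g where
        g: "polyfun c g" "g z \<noteq> 0" "{w. g w \<noteq> 0} \<subseteq> b" by (elim exE conjE)
      show "\<exists>f. polyfun c f \<and> f z \<noteq> 0 \<and> {w. f w \<noteq> 0} \<subseteq> a \<inter> b"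
      proof (intro exI conjI)
        show "polyfun c (\<lambda>z. f z * g z)" by (rule polyfun_closed(4)[OF f(1) g(1)])
      qed (use f g in auto)
    qed
  next
    case (UN K)
    show ?case
    proof
      fix z assume "z \<in> \<Union>K"
      then obtain k where k: "k \<in> K" "z \<in> k" by blast
      with UN(2)[OF k(1)] obtain f where f: "polyfun c f \<and> f z \<noteq> 0 \<and> {w. f w \<noteq> 0} \<subseteq> k" by blast
      have "k \<subseteq> \<Union>K" using k(1) by blast
      with f have "polyfun c f \<and> f z \<noteq> 0 \<and> {w. f w \<noteq> 0} \<subseteq> \<Union>K" by (meson order_trans)
      then show "\<exists>f. polyfun c f \<and> f z \<noteq> 0 \<and> {w. f w \<noteq> 0} \<subseteq> \<Union>K" by (rule exI[of _ f])
    qed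
  next
    case (Basis s)
    then obtain P where P: "s = {z. peval P (\<lambda>i. c i z) \<noteq> 0}" by blast
    have "polyfun c (\<lambda>z. peval P (\<lambda>i. c i z))" unfolding polyfun_def by blast
    then show ?case unfolding P by (intro ballI exI conjI) (assumption, simp_all)
  qed
  from this[rule_format, OF assms(2)] show thesis using that by (elim exE conjE)
qed

lemma topspace_zariski_coords [simp]: "topspace (zariski_coords c) = UNIV"
  using openin_subset[OF openin_zariski_coords[OF polyfun_closed(1)[of c 1]]] by auto

lemma in_closure_zariski_coords:
  "z \<in> zariski_coords c closure_of S \<longleftrightarrow> (\<forall>f. polyfun c f \<and> (\<forall>y\<in>S. f y = 0) \<longrightarrow> f z = 0)"
proof
  assume L: "z \<in> zariski_coords c closure_of S"
  show "\<forall>f. polyfun c f \<and> (\<forall>y\<in>S. f y = 0) \<longrightarrow> f z = 0"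
  proof (intro allI impI, elim conjE, rule ccontr)
    fix f assume f: "polyfun c f" "\<forall>y\<in>S. f y = 0" "f z \<noteq> 0"
    have "\<exists>y. y \<in> S \<and> y \<in> {z. f z \<noteq> 0}"
      using L[unfolded in_closure_of, THEN conjunct2, rule_format, of "{z. f z \<noteq> 0}"]
        openin_zariski_coords[OF f(1)] f(3) by simp
    then show False using f(2) by auto
  qed
next
  assume R: "\<forall>f. polyfun c f \<and> (\<forall>y\<in>S. f y = 0) \<longrightarrow> f z = 0"
  show "z \<in> zariski_coords c closure_of S"
    unfolding in_closure_of
  proof (intro conjI allI impI)
    fix T assume T: "z \<in> T \<and> openin (zariski_coords c) T"
    obtain f where f: "polyfun c f" "f z \<noteq> 0" "{w. f w \<noteq> 0} \<subseteq> T"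
      by (rule zariski_coords_basis[OF T[THEN conjunct2] T[THEN conjunct1]])
    have "\<not> (\<forall>y\<in>S. f y = 0)" using R[rule_format, of f] f(1,2) by metis
    then obtain y where "y \<in> S" "f y \<noteq> 0" by metis
    then show "\<exists>y. y \<in> S \<and> y \<in> T" using f(3) by (intro exI[of _ y]) auto
  qed simp
qed

subsection \<open>Closed sets and vanishing ideals\<close>

lemma topspace_zariski [simp]: "topspace zariski = UNIV"
  by (simp add: zariski_def)

lemma openin_zariski: "polyfun coord f \<Longrightarrow> openin zariski {x. f x \<noteq> 0}"
  unfolding zariski_def by (rule openin_zariski_coords)

lemma closure_zariski:
  "zariski closure_of S = {x. \<forall>P\<in>vanishing_ideal S. pval P x = 0}"
proof (intro set_eqI iffI CollectI ballI)
  fix x P assume x: "x \<in> zariski closure_of S" and P: "P \<in> vanishing_ideal S"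
  have "polyfun coord (pval P)" by (rule polyfun_pval)
  moreover have "\<forall>y\<in>S. pval P y = 0" using P by (simp add: vanishing_ideal_def)
  ultimately show "pval P x = 0"
    using x[unfolded zariski_def in_closure_zariski_coords, rule_format, of "pval P"] by simp
next
  fix x assume x: "x \<in> {x. \<forall>P\<in>vanishing_ideal S. pval P x = 0}"
  show "x \<in> zariski closure_of S"
    unfolding zariski_def in_closure_zariski_coords
  proof (intro allI impI, elim conjE)
    fix f assume f: "polyfun coord f" "\<forall>y\<in>S. f y = 0"
    from f(1)[unfolded polyfun_coord] obtain P where P: "\<forall>x. f x = pval P x" ..
    have "P \<in> vanishing_ideal S"
      using f(2) by (simp add: vanishing_ideal_def P[rule_format, symmetric])
    then show "f x = 0" using x by (simp add: P[rule_format])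
  qed
qed

lemma vanishing_idealI: "(\<And>x. x \<in> S \<Longrightarrow> pval P x = 0) \<Longrightarrow> P \<in> vanishing_ideal S"
  by (simp add: vanishing_ideal_def)

lemma vanishing_idealD: "P \<in> vanishing_ideal S \<Longrightarrow> x \<in> S \<Longrightarrow> pval P x = 0"
  by (simp add: vanishing_ideal_def)

lemma vanishing_ideal_antimono: "S \<subseteq> T \<Longrightarrow> vanishing_ideal T \<subseteq> vanishing_ideal S"
  by (auto simp: vanishing_ideal_def)

lemma subset_closure_zariski: "S \<subseteq> zariski closure_of S"
  by (rule closure_of_subset) simp

lemma closure_zariski_mono: "S \<subseteq> T \<Longrightarrow> zariski closure_of S \<subseteq> zariski closure_of T"
  by (rule closure_of_mono)

lemma closure_zariski_minimal: "S \<subseteq> F \<Longrightarrow> closedin zariski F \<Longrightarrow> zariski closure_of S \<subseteq> F"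
  by (rule closure_of_minimal)

lemma vanishing_ideal_closure [simp]:
  "vanishing_ideal (zariski closure_of S) = vanishing_ideal S"
  using vanishing_ideal_antimono[OF subset_closure_zariski[of S]]
  by (auto simp: closure_zariski vanishing_ideal_def)

lemma closedin_zariski_zeros:
  assumes "\<And>a. a \<in> A \<Longrightarrow> polyfun coord (f a)"
  shows "closedin zariski {x. \<forall>a\<in>A. f a x = 0}"
proof -
  have "zariski closure_of {x. \<forall>a\<in>A. f a x = 0} \<subseteq> {x. \<forall>a\<in>A. f a x = 0}"
  proof (intro subsetI CollectI ballI)
    fix x a assume x: "x \<in> zariski closure_of {x. \<forall>a\<in>A. f a x = 0}" and a: "a \<in> A"
    show "f a x = 0"
      by (rule x[unfolded zariski_def in_closure_zariski_coords, rule_format, of "f a"])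
         (use assms a in simp)
  qed
  then show ?thesis
    using subset_closure_zariski[of "{x. \<forall>a\<in>A. f a x = 0}"] by (simp add: closure_of_eq[symmetric])
qed

lemma closedin_zariski_zero: "polyfun coord f \<Longrightarrow> closedin zariski {x. f x = 0}"
  using closedin_zariski_zeros[of "{()}" "\<lambda>_. f"] by simp

lemma closedin_zariski_separate:
  assumes "closedin zariski F" "x \<notin> F"
  obtains P where "P \<in> vanishing_ideal F" "pval P x \<noteq> 0"
proof -
  have "zariski closure_of F = F" using assms(1) by (simp add: closure_of_eq)
  then show thesis using assms(2) that by (auto simp: closure_zariski)
qed

lemma vanishing_ideal_closed:
  "0 \<in> vanishing_ideal S"
  "P \<in> vanishing_ideal S \<Longrightarrow> Q \<in> vanishing_ideal S \<Longrightarrow> P + Q \<in> vanishing_ideal S"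
  "P \<in> vanishing_ideal S \<Longrightarrow> Q \<in> vanishing_ideal S \<Longrightarrow> P - Q \<in> vanishing_ideal S"
  "P \<in> vanishing_ideal S \<Longrightarrow> - P \<in> vanishing_ideal S"
  "P \<in> vanishing_ideal S \<Longrightarrow> P * R \<in> vanishing_ideal S"
  "P \<in> vanishing_ideal S \<Longrightarrow> R * P \<in> vanishing_ideal S"
  by (simp_all add: vanishing_ideal_def)

subsection \<open>Irreducible sets\<close>

lemma irreducible_nonzero_product:
  assumes C: "zariski_irreducible C" and "polyfun coord f" "polyfun coord g"
    and "x \<in> C" "f x \<noteq> 0" "y \<in> C" "g y \<noteq> 0"
  obtains z where "z \<in> C" "f z \<noteq> 0" "g z \<noteq> 0"
proof -
  have "\<not> (C \<subseteq> {x. f x = 0} \<union> {x. g x = 0})"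
    using C closedin_zariski_zero[OF assms(2)] closedin_zariski_zero[OF assms(3)] assms(4-7)
    unfolding zariski_irreducible_def by blast
  then show thesis using that by blast
qed

lemma irreducible_iff_prime:
  "zariski_irreducible C \<longleftrightarrow> C \<noteq> {} \<and> (\<forall>P Q. P * Q \<in> vanishing_ideal C \<longrightarrow>
     P \<in> vanishing_ideal C \<or> Q \<in> vanishing_ideal C)"
proof (intro iffI conjI allI impI)
  assume C: "zariski_irreducible C"
  then show "C \<noteq> {}" by (simp add: zariski_irreducible_def)
  fix P Q assume PQ: "P * Q \<in> vanishing_ideal C"
  show "P \<in> vanishing_ideal C \<or> Q \<in> vanishing_ideal C"
  proof (rule ccontr)
    assume "\<not> ?thesis"
    then obtain x y where "x \<in> C" "pval P x \<noteq> 0" "y \<in> C" "pval Q y \<noteq> 0"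
      by (auto simp: vanishing_ideal_def)
    then obtain z where "z \<in> C" "pval P z \<noteq> 0" "pval Q z \<noteq> 0"
      using irreducible_nonzero_product[OF C polyfun_pval polyfun_pval] by blast
    then show False using vanishing_idealD[OF PQ, of z] by simp
  qed
next
  assume C: "C \<noteq> {} \<and> (\<forall>P Q. P * Q \<in> vanishing_ideal C \<longrightarrow>
     P \<in> vanishing_ideal C \<or> Q \<in> vanishing_ideal C)"
  show "zariski_irreducible C"
    unfolding zariski_irreducible_def
  proof (intro conjI allI impI)
    show "C \<noteq> {}" using C by blast
    fix F1 F2 assume F: "closedin zariski F1 \<and> closedin zariski F2 \<and> C \<subseteq> F1 \<union> F2"
    show "C \<subseteq> F1 \<or> C \<subseteq> F2"
    proof (rule ccontr)
      assume "\<not> ?thesis"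
      then obtain x y where x: "x \<in> C" "x \<notin> F1" and y: "y \<in> C" "y \<notin> F2" by blast
      obtain P where P: "P \<in> vanishing_ideal F1" "pval P x \<noteq> 0"
        using closedin_zariski_separate x F by blast
      obtain Q where Q: "Q \<in> vanishing_ideal F2" "pval Q y \<noteq> 0"
        using closedin_zariski_separate y F by blast
      have "P * Q \<in> vanishing_ideal C"
        using F P(1) Q(1) by (auto simp: vanishing_ideal_def)
      then have "P \<in> vanishing_ideal C \<or> Q \<in> vanishing_ideal C" using C by blast
      then show False using vanishing_idealD[OF _ x(1)] vanishing_idealD[OF _ y(1)] P Q by blast
    qed
  qed
qed

lemma irreducible_closure_iff [simp]:
  "zariski_irreducible (zariski closure_of C) \<longleftrightarrow> zariski_irreducible C"
proof -
  have "zariski closure_of C = {} \<longleftrightarrow> C = {}"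
    using subset_closure_zariski[of C] by (metis closure_of_empty subset_empty)
  then show ?thesis by (simp add: irreducible_iff_prime)
qed

lemma irreducible_same_closure:
  "zariski_irreducible C \<Longrightarrow> zariski closure_of D = zariski closure_of C \<Longrightarrow> zariski_irreducible D"
  using irreducible_closure_iff by metis

lemma irreducible_subset_finite_Union:
  assumes C: "zariski_irreducible C"
  shows "finite \<F> \<Longrightarrow> (\<And>F. F \<in> \<F> \<Longrightarrow> closedin zariski F) \<Longrightarrow> C \<subseteq> \<Union>\<F> \<Longrightarrow> \<exists>F\<in>\<F>. C \<subseteq> F"
proof (induction \<F> rule: finite_induct)
  case empty
  then show ?case using C by (simp add: zariski_irreducible_def)
next
  case (insert F \<F>)
  have "closedin zariski (\<Union>\<F>)" using insert by (intro closedin_Union) auto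
  moreover have "closedin zariski F" "C \<subseteq> F \<union> \<Union>\<F>" using insert by auto
  ultimately have "C \<subseteq> F \<or> C \<subseteq> \<Union>\<F>" using C unfolding zariski_irreducible_def by blast
  then show ?case using insert by blast
qed

text \<open>Otherwise the closure of the open part and its complement would cover \<open>C\<close> by two proper closed
  subsets.\<close>

lemma irreducible_open_dense:
  assumes "zariski_irreducible C" "polyfun coord f" "x \<in> C" "f x \<noteq> 0"
  shows "C \<subseteq> zariski closure_of (C \<inter> {x. f x \<noteq> 0})"
proof -
  have "C \<subseteq> {x. f x = 0} \<union> zariski closure_of (C \<inter> {x. f x \<noteq> 0})"
    using subset_closure_zariski[of "C \<inter> {x. f x \<noteq> 0}"] by blast
  then show ?thesis
    using assms(1,3,4) closedin_zariski_zero[OF assms(2)] closedin_closure_of[of zariski]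
    unfolding zariski_irreducible_def by blast
qed

text \<open>Two points on a polynomial curve inside the set cannot be separated by two proper closed
  subsets, because a product of two nonzero polynomials in one variable has only finitely many
  zeros.\<close>

lemma irreducible_if_curves:
  fixes C :: "('k::{field,ring_char_0}^'v::finite) set"
  assumes "C \<noteq> {}"
    and curve: "\<And>a b. a \<in> C \<Longrightarrow> b \<in> C \<Longrightarrow>
      \<exists>w. (\<forall>i. upoly (\<lambda>t. w t $ i)) \<and> w 0 = a \<and> w 1 = b \<and> (\<forall>t. w t \<in> C)"
  shows "zariski_irreducible C"
  unfolding irreducible_iff_prime
proof (intro conjI allI impI, fact)
  fix P Q assume PQ: "P * Q \<in> vanishing_ideal C"
  show "P \<in> vanishing_ideal C \<or> Q \<in> vanishing_ideal C"
  proof (rule ccontr)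
    assume "\<not> ?thesis"
    then obtain a b where a: "a \<in> C" "pval P a \<noteq> 0" and b: "b \<in> C" "pval Q b \<noteq> 0"
      by (auto simp: vanishing_ideal_def)
    obtain w where w: "\<forall>i. upoly (\<lambda>t. w t $ i)" "w 0 = a" "w 1 = b" "\<forall>t. w t \<in> C"
      using curve[OF a(1) b(1)] by blast
    have up: "upoly (\<lambda>t. pval R (w t))" for R
      unfolding pval_def using w(1) by (intro upoly_compose) blast
    have "finite {t. pval P (w t) = 0}" "finite {t. pval Q (w t) = 0}"
      using upoly_finite_zeros[OF up, of P 0] upoly_finite_zeros[OF up, of Q 1] w a b by auto
    then have "finite ({t. pval P (w t) = 0} \<union> {t. pval Q (w t) = 0})" by simp
    moreover have "{t. pval P (w t) = 0} \<union> {t. pval Q (w t) = 0} = UNIV"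
      using vanishing_idealD[OF PQ w(4)[rule_format]] by auto
    ultimately show False using infinite_UNIV_char_0[where 'a = 'k] by simp
  qed
qed

section \<open>Topologies compatible with polynomials\<close>

text \<open>Polynomial equations pass to the closure, and the closure contains the value at \<open>t = 0\<close> of every
  polynomial curve that lies in the set for \<open>t \<noteq> 0\<close>. These are the only properties of limits that
  the proof uses.\<close>

definition poly_topology :: "('i \<Rightarrow> 'p \<Rightarrow> 'k::field) \<Rightarrow> 'p topology \<Rightarrow> bool" where
  "poly_topology c \<tau> \<longleftrightarrow> (\<forall>f. polyfun c f \<longrightarrow> openin \<tau> {z. f z \<noteq> 0}) \<and>
     (\<forall>w S. (\<forall>i. upoly (\<lambda>t. c i (w t))) \<and> (\<forall>t. t \<noteq> 0 \<longrightarrow> w t \<in> S) \<longrightarrow> w 0 \<in> \<tau> closure_of S)"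

lemma poly_topology_open: "poly_topology c \<tau> \<Longrightarrow> polyfun c f \<Longrightarrow> openin \<tau> {z. f z \<noteq> 0}"
  by (simp add: poly_topology_def)

lemma poly_topology_topspace: "poly_topology c \<tau> \<Longrightarrow> topspace \<tau> = UNIV"
  using openin_subset[OF poly_topology_open[OF _ polyfun_closed(1)[of c 1]]] by auto

lemma poly_topology_curve:
  "poly_topology c \<tau> \<Longrightarrow> (\<And>i. upoly (\<lambda>t. c i (w t))) \<Longrightarrow> (\<And>t. t \<noteq> 0 \<Longrightarrow> w t \<in> S)
     \<Longrightarrow> w 0 \<in> \<tau> closure_of S"
  unfolding poly_topology_def by blast

lemma poly_topology_nonzero:
  assumes "poly_topology c \<tau>" "polyfun c f" "z \<in> \<tau> closure_of S" "f z \<noteq> 0"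
  obtains y where "y \<in> S" "f y \<noteq> 0"
proof -
  have "\<exists>y. y \<in> S \<and> y \<in> {z. f z \<noteq> 0}"
    using assms(3)[unfolded in_closure_of, THEN conjunct2, rule_format, of "{z. f z \<noteq> 0}"]
      poly_topology_open[OF assms(1,2)] assms(4) by simp
  then show thesis using that by auto
qed

lemma poly_topology_zero:
  assumes "poly_topology c \<tau>" "polyfun c f" "\<And>y. y \<in> S \<Longrightarrow> f y = 0" "z \<in> \<tau> closure_of S"
  shows "f z = 0"
proof (rule ccontr)
  assume "f z \<noteq> 0"
  then obtain y where "y \<in> S" "f y \<noteq> 0" by (rule poly_topology_nonzero[OF assms(1,2,4)])
  then show False using assms(3) by simp
qed

lemma poly_topology_subset: "poly_topology c \<tau> \<Longrightarrow> S \<subseteq> \<tau> closure_of S"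
  using poly_topology_topspace closure_of_subset[of S \<tau>] by auto

text \<open>A polynomial that vanishes at all points of a curve but one vanishes at that point too.\<close>

lemma poly_topology_zariski:
  fixes c :: "'i \<Rightarrow> 'p \<Rightarrow> 'k::{field,ring_char_0}"
  shows "poly_topology c (zariski_coords c)"
  unfolding poly_topology_def
proof (intro conjI allI impI)
  fix w S assume w: "(\<forall>i. upoly (\<lambda>t. c i (w t))) \<and> (\<forall>t. t \<noteq> 0 \<longrightarrow> w t \<in> S)"
  show "w 0 \<in> zariski_coords c closure_of S"
    unfolding in_closure_zariski_coords
  proof (intro allI impI, rule ccontr)
    fix f assume f: "polyfun c f \<and> (\<forall>y\<in>S. f y = 0)" and "f (w 0) \<noteq> 0"
    from f[THEN conjunct1, unfolded polyfun_def] obtain P where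
      P: "\<forall>z. f z = peval P (\<lambda>i. c i z)" ..
    have "upoly (\<lambda>t. peval P (\<lambda>i. c i (w t)))" using w by (intro upoly_compose) blast
    moreover have "peval P (\<lambda>i. c i (w 0)) \<noteq> 0" using \<open>f (w 0) \<noteq> 0\<close> P[rule_format, of "w 0"] by simp
    ultimately have "finite {t. peval P (\<lambda>i. c i (w t)) = 0}" by (rule upoly_finite_zeros)
    moreover have "UNIV - {0} \<subseteq> {t. peval P (\<lambda>i. c i (w t)) = 0}"
      using f w P[rule_format, symmetric] by auto
    ultimately have "finite (UNIV - {0::'k})" by (rule rev_finite_subset)
    then show False using infinite_UNIV_char_0[where 'a = 'k] by simp
  qed
qed (rule openin_zariski_coords)

definition pair_coords :: "'v + 'v \<Rightarrow> ('k^'v::finite) \<times> ('k^'v) \<Rightarrow> 'k" where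
  "pair_coords = case_sum (\<lambda>i z. fst z $ i) (\<lambda>i z. snd z $ i)"

definition frame_coords :: "'v + 'v \<times> 'v \<Rightarrow> ('k^'v::finite) \<times> ('k^'v^'v) \<Rightarrow> 'k" where
  "frame_coords = case_sum (\<lambda>i z. fst z $ i) (\<lambda>(i, j) z. snd z $ i $ j)"

lemma zariski_pair_eq: "zariski_pair = zariski_coords pair_coords"
  by (simp add: zariski_pair_def pair_coords_def)

lemma zariski_frame_eq: "zariski_frame = zariski_coords frame_coords"
  by (simp add: zariski_frame_def frame_coords_def)

lemma polyfun_pair_coords:
  "polyfun pair_coords (\<lambda>z. fst z $ i)" "polyfun pair_coords (\<lambda>z. snd z $ i)"
  using polyfun_closed(2)[of pair_coords "Inl i"] polyfun_closed(2)[of pair_coords "Inr i"]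
  by (simp_all add: pair_coords_def)

lemma polyfun_frame_coords:
  "polyfun frame_coords (\<lambda>z. fst z $ i)" "polyfun frame_coords (\<lambda>z. snd z $ i $ j)"
  using polyfun_closed(2)[of frame_coords "Inl i"] polyfun_closed(2)[of frame_coords "Inr (i, j)"]
  by (simp_all add: frame_coords_def)

lemma polyfun_fst:
  assumes "polyfun coord f"
  shows "polyfun pair_coords (\<lambda>z. f (fst z))" "polyfun frame_coords (\<lambda>z. f (fst z))"
proof -
  from assms[unfolded polyfun_coord] obtain P where P: "\<forall>x. f x = pval P x" ..
  have *: "(\<lambda>z. f (fst z)) = (\<lambda>z. peval P (\<lambda>i. fst z $ i))"
    by (rule ext) (simp only: P[rule_format] pval_def)
  have "polyfun (\<lambda>i z. fst z $ i) (\<lambda>z. peval P (\<lambda>i. fst z $ i))" unfolding polyfun_def by blast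
  then have "polyfun pair_coords (\<lambda>z. peval P (\<lambda>i. fst z $ i))"
    by (rule polyfun_compose[rotated]) (rule polyfun_pair_coords)
  then show "polyfun pair_coords (\<lambda>z. f (fst z))" unfolding * .
  have "polyfun (\<lambda>i z. fst z $ i) (\<lambda>z. peval P (\<lambda>i. fst z $ i))" unfolding polyfun_def by blast
  then have "polyfun frame_coords (\<lambda>z. peval P (\<lambda>i. fst z $ i))"
    by (rule polyfun_compose[rotated]) (rule polyfun_frame_coords)
  then show "polyfun frame_coords (\<lambda>z. f (fst z))" unfolding * .
qed

lemma continuous_peval:
  fixes c :: "'i \<Rightarrow> 'p::topological_space \<Rightarrow> 'k::real_normed_field"
  assumes "\<And>i. continuous_on UNIV (c i)"
  shows "continuous_on UNIV (\<lambda>z. peval P (\<lambda>i. c i z))"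
proof (induction P rule: mpoly_induct)
  case (var i)
  show ?case using assms[of i] by simp
qed (simp_all add: continuous_on_add continuous_on_mult continuous_on_const)

text \<open>The point at \<open>t = 0\<close> is the limit of the points at \<open>t = 1 / (n + 1)\<close>.\<close>

lemma poly_topology_euclidean:
  fixes c :: "'i \<Rightarrow> 'p::topological_space \<Rightarrow> 'k::real_normed_field"
  assumes cont: "\<And>i. continuous_on UNIV (c i)"
    and curve: "\<And>w :: nat \<Rightarrow> 'p. \<And>l. (\<And>i. (\<lambda>n. c i (w n)) \<longlonglongrightarrow> c i l) \<Longrightarrow> w \<longlonglongrightarrow> l"
  shows "poly_topology c euclidean"
  unfolding poly_topology_def
proof (intro conjI allI impI)
  fix f assume "polyfun c f"
  from this[unfolded polyfun_def] obtain P where P: "\<forall>z. f z = peval P (\<lambda>i. c i z)" ..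
  have *: "f = (\<lambda>z. peval P (\<lambda>i. c i z))" by (rule ext) (rule P[rule_format])
  have "open {z. peval P (\<lambda>i. c i z) \<noteq> 0}"
    by (intro open_Collect_neq continuous_peval cont continuous_on_const)
  then show "openin euclidean {z. f z \<noteq> 0}" unfolding * by simp
next
  fix w S assume "(\<forall>i. upoly (\<lambda>t. c i (w t))) \<and> (\<forall>t. t \<noteq> 0 \<longrightarrow> w t \<in> S)"
  then have w1: "\<And>i. upoly (\<lambda>t. c i (w t))" and w2: "\<And>t. t \<noteq> 0 \<Longrightarrow> w t \<in> S" by simp_all
  define s where "s n = (of_real (1 / real (Suc n)) :: 'k)" for n
  have s: "s \<longlonglongrightarrow> 0" unfolding s_def
    using tendsto_of_real[OF LIMSEQ_Suc[OF lim_1_over_n[where 'a = real]], where 'a = 'k]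
    by (simp only: of_real_0)
  have "(\<lambda>n. c i (w (s n))) \<longlonglongrightarrow> c i (w 0)" for i
  proof -
    from w1[of i, unfolded upoly_def] obtain p where p: "\<forall>t. c i (w t) = poly p t" ..
    have "(\<lambda>n. poly p (s n)) \<longlonglongrightarrow> poly p 0" by (rule isCont_tendsto_compose[OF poly_isCont s])
    then show ?thesis unfolding p[rule_format] .
  qed
  then have lim: "(\<lambda>n. w (s n)) \<longlonglongrightarrow> w 0" by (rule curve[of "\<lambda>n. w (s n)" "w 0"])
  have mem: "w (s n) \<in> closure S" for n
    using subsetD[OF closure_subset w2[of "s n"]] by (simp add: s_def del: of_nat_Suc)
  have "w 0 \<in> closure S"
    by (rule Lim_in_closed_set[OF closed_closure always_eventually sequentially_bot lim])
       (rule allI, rule mem)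
  then show "w 0 \<in> euclidean closure_of S" by simp
qed

lemma tendsto_vec_prodI:
  fixes w :: "nat \<Rightarrow> ('a::topological_space^'v::finite) \<times> 'b::topological_space"
  assumes "\<And>i. (\<lambda>n. fst (w n) $ i) \<longlonglongrightarrow> fst l $ i" "(\<lambda>n. snd (w n)) \<longlonglongrightarrow> snd l"
  shows "w \<longlonglongrightarrow> l"
  using tendsto_Pair[OF vec_tendstoI assms(2), of "\<lambda>n. fst (w n)" "fst l"] assms(1) by simp

lemma poly_topology_instances:
  "poly_topology pair_coords (euclidean :: ((('a::real_normed_field)^'v::finite) \<times> ('a^'v)) topology)"
  "poly_topology frame_coords (euclidean :: (('a^'v) \<times> ('a^'v^'v)) topology)"
  "poly_topology pair_coords (zariski_pair :: ((('b::{field,ring_char_0})^'v::finite) \<times> ('b^'v)) topology)"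
  "poly_topology frame_coords (zariski_frame :: (('b^'v) \<times> ('b^'v^'v)) topology)"
proof -
  show "poly_topology pair_coords (euclidean :: (('a^'v) \<times> ('a^'v)) topology)"
  proof (rule poly_topology_euclidean)
    show "continuous_on UNIV (pair_coords i :: ('a^'v) \<times> ('a^'v) \<Rightarrow> 'a)" for i
      by (cases i) (simp_all add: pair_coords_def continuous_on_component continuous_on_fst
           continuous_on_snd continuous_on_id)
    fix w :: "nat \<Rightarrow> ('a^'v) \<times> ('a^'v)" and l
    assume *: "\<And>i. (\<lambda>n. pair_coords i (w n)) \<longlonglongrightarrow> pair_coords i l"
    show "w \<longlonglongrightarrow> l"
    proof (rule tendsto_vec_prodI)
      show "(\<lambda>n. fst (w n) $ i) \<longlonglongrightarrow> fst l $ i" for i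
        using *[of "Inl i"] by (simp add: pair_coords_def)
      show "(\<lambda>n. snd (w n)) \<longlonglongrightarrow> snd l"
        using *[of "Inr i" for i] by (intro vec_tendstoI) (simp add: pair_coords_def)
    qed
  qed
  show "poly_topology frame_coords (euclidean :: (('a^'v) \<times> ('a^'v^'v)) topology)"
  proof (rule poly_topology_euclidean)
    show "continuous_on UNIV (frame_coords i :: ('a^'v) \<times> ('a^'v^'v) \<Rightarrow> 'a)" for i
      by (cases i) (simp_all add: frame_coords_def continuous_on_component continuous_on_fst
           continuous_on_snd continuous_on_id split_beta)
    fix w :: "nat \<Rightarrow> ('a^'v) \<times> ('a^'v^'v)" and l
    assume *: "\<And>i. (\<lambda>n. frame_coords i (w n)) \<longlonglongrightarrow> frame_coords i l"
    show "w \<longlonglongrightarrow> l"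
    proof (rule tendsto_vec_prodI)
      show "(\<lambda>n. fst (w n) $ i) \<longlonglongrightarrow> fst l $ i" for i
        using *[of "Inl i"] by (simp add: frame_coords_def)
      show "(\<lambda>n. snd (w n)) \<longlonglongrightarrow> snd l"
      proof (rule vec_tendstoI, rule vec_tendstoI)
        fix i j
        show "(\<lambda>n. snd (w n) $ i $ j) \<longlonglongrightarrow> snd l $ i $ j"
          using *[of "Inr (i, j)"] by (simp add: frame_coords_def)
      qed
    qed
  qed
qed (simp_all add: zariski_pair_eq zariski_frame_eq poly_topology_zariski)

section \<open>Linear algebra over an arbitrary field\<close>

definition ann :: "('k::field^'v::finite) set \<Rightarrow> ('k^'v) set" where
  "ann V = {t. \<forall>v\<in>V. pairing v t = 0}"

lemma subspace_ann: "vec.subspace (ann V)"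
  unfolding vec.subspace_def ann_def by (simp add: pairing_add_right)

lemma ann_antimono: "V \<subseteq> W \<Longrightarrow> ann W \<subseteq> ann V"
  by (auto simp: ann_def)

lemma ann_span [simp]: "ann (vec.span V) = ann V"
proof
  show "ann (vec.span V) \<subseteq> ann V" by (rule ann_antimono[OF vec.span_superset])
  show "ann V \<subseteq> ann (vec.span V)"
  proof
    fix t assume t: "t \<in> ann V"
    have "pairing v t = 0" if "v \<in> vec.span V" for v
      using that by (induction rule: vec.span_induct_alt)
        (use t in \<open>simp_all add: ann_def pairing_add_left\<close>)
    then show "t \<in> ann (vec.span V)" by (simp add: ann_def)
  qed
qed

lemma card_Compl: "card (- J) = CARD('v) - card (J :: 'v::finite set)"
  by (simp add: Compl_eq_Diff_UNIV card_Diff_subset)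

lemma annihilates_iff: "annihilates V T \<longleftrightarrow> T \<subseteq> ann V"
  by (auto simp: annihilates_def ann_def)

lemma independent_by_dual:
  assumes "finite A" "c \<noteq> 0"
    and dual: "\<And>a b. a \<in> A \<Longrightarrow> b \<in> A \<Longrightarrow> pairing (v a) (t b) = (if a = b then c else 0)"
  shows "inj_on v A" "vec.independent (v ` A)"
proof -
  show inj: "inj_on v A"
  proof (rule inj_onI, rule ccontr)
    fix a b assume ab: "a \<in> A" "b \<in> A" "v a = v b" "a \<noteq> b"
    show False using dual[OF ab(1,1)] dual[OF ab(2,1)] ab(3,4) assms(2) by simp
  qed
  show "vec.independent (v ` A)"
  proof (rule vec.independent_if_scalars_zero)
    fix f x assume f: "(\<Sum>x\<in>v ` A. f x *s x) = 0" and "x \<in> v ` A"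
    then obtain a where a: "a \<in> A" "x = v a" by blast
    have "0 = pairing (\<Sum>b\<in>A. f (v b) *s v b) (t a)"
      using f by (simp add: sum.reindex[OF inj])
    also have "\<dots> = (\<Sum>b\<in>A. if b = a then f (v b) * c else 0)"
      unfolding pairing_sum_left by (intro sum.cong refl) (simp add: dual a(1))
    also have "\<dots> = f (v a) * c" using assms(1) a(1) by simp
    finally show "f x = 0" using assms(2) a(2) by simp
  qed (simp add: assms(1))
qed

lemma basis_of_UNIV_extending:
  fixes B :: "('k::field^'v::finite) set"
  assumes "vec.independent B"
  obtains B' where "B \<subseteq> B'" "vec.independent B'" "vec.span B' = UNIV" "finite B'" "card B' = CARD('v)"
proof -
  obtain B' where B': "B \<subseteq> B'" "B' \<subseteq> UNIV" "vec.independent B'" "UNIV \<subseteq> vec.span B'"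
    using vec.maximal_independent_subset_extend[OF subset_UNIV assms] by blast
  have "card B' = CARD('v)"
    using vec.basis_card_eq_dim[OF B'(2,4,3)] by (simp add: vec_dim_card card_cart_basis)
  then show thesis using B' vec.finiteI_independent[OF B'(3)] that[of B'] by blast
qed

lemma invertible_if_rows_span:
  fixes D :: "'k::field^'v::finite^'v"
  assumes "vec.span (rows D) = UNIV"
  shows "invertible D"
proof -
  obtain D' where "D' ** D = mat 1"
    using assms matrix_left_invertible_span_rows_gen[of D] by blast
  then show ?thesis using invertible_left_inverse by blast
qed

text \<open>A basis \<open>e\<close> adapted to a subspace, indexed so that the indices in \<open>J\<close> are those of the subspace,
  together with its dual basis \<open>d\<close>.\<close>

lemma adapted_basis:
  fixes V :: "('k::field^'v::finite) set"
  assumes V: "vec.subspace V" and J: "card J = vec.dim V"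
  obtains e d :: "'v \<Rightarrow> 'k^'v" where "\<And>i j. pairing (e i) (d j) = (if i = j then 1 else 0)"
    "\<And>x. x = (\<Sum>i\<in>UNIV. pairing x (d i) *s e i)" "\<And>t. t = (\<Sum>i\<in>UNIV. pairing (e i) t *s d i)"
    "\<And>j. j \<in> J \<Longrightarrow> e j \<in> V" "\<And>x i. x \<in> V \<Longrightarrow> i \<notin> J \<Longrightarrow> pairing x (d i) = 0"
proof -
  obtain B where B: "B \<subseteq> V" "vec.independent B" "V \<subseteq> vec.span B" "card B = vec.dim V"
    using vec.basis_exists by blast
  obtain B' where B': "B \<subseteq> B'" "vec.independent B'" "vec.span B' = UNIV" "finite B'" "card B' = CARD('v)"
    by (rule basis_of_UNIV_extending[OF B(2)])
  have fB: "finite B" using B'(1,4) finite_subset by blast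
  obtain g1 where g1: "bij_betw g1 J B"
    using finite_same_card_bij[OF _ fB, of J] J B(4) by auto
  have "card (- J) = card (B' - B)"
    using B'(1,5) J B(4) fB by (simp add: card_Compl card_Diff_subset)
  then obtain g2 where g2: "bij_betw g2 (- J) (B' - B)"
    using finite_same_card_bij[of "- J" "B' - B"] B'(4) by auto
  define e where "e i = (if i \<in> J then g1 i else g2 i)" for i
  have "bij_betw e J B" using g1 bij_betw_cong[of J e g1 B] by (simp add: e_def)
  moreover have "bij_betw e (- J) (B' - B)" using g2 bij_betw_cong[of "- J" e g2 "B' - B"] by (simp add: e_def)
  ultimately have "bij_betw e (J \<union> - J) (B \<union> (B' - B))" by (rule bij_betw_combine) auto
  then have e: "bij_betw e UNIV B'" using B'(1) by (simp add: Un_absorb1)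
  have eJ: "e ` J = B" using g1 by (auto simp: e_def bij_betw_def)
  define D :: "'k^'v^'v" where "D = (\<chi> i. e i)"
  have "rows D = B'" using e by (auto simp: D_def rows_def row_def vec_lambda_eta bij_betw_def)
  then have "invertible D" using B'(3) by (intro invertible_if_rows_span) simp
  then obtain D' where D': "D ** D' = mat 1" "D' ** D = mat 1" unfolding invertible_def by blast
  define d where "d j = column j D'" for j
  have dual: "pairing (e i) (d j) = (if i = j then 1 else 0)" for i j
  proof -
    have "pairing (e i) (d j) = (D ** D') $ i $ j"
      by (simp add: pairing_def D_def d_def column_def matrix_matrix_mult_def)
    then show ?thesis by (simp add: D'(1) mat_def)
  qed
  have x: "x = (\<Sum>i\<in>UNIV. pairing x (d i) *s e i)" for x
  proof -
    have "(\<Sum>i\<in>UNIV. pairing x (d i) *s e i) $ j = x $ j" for j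
    proof -
      have "(\<Sum>i\<in>UNIV. pairing x (d i) *s e i) $ j = (\<Sum>i\<in>UNIV. \<Sum>k\<in>UNIV. x $ k * (D' $ k $ i * D $ i $ j))"
        by (simp add: pairing_def d_def column_def D_def sum_distrib_right mult.assoc)
      also have "\<dots> = (\<Sum>k\<in>UNIV. \<Sum>i\<in>UNIV. x $ k * (D' $ k $ i * D $ i $ j))" by (rule sum.swap)
      also have "\<dots> = (\<Sum>k\<in>UNIV. x $ k * (D' ** D) $ k $ j)"
        by (simp add: matrix_matrix_mult_def sum_distrib_left)
      also have "\<dots> = (\<Sum>k\<in>UNIV. if k = j then x $ k else 0)"
        by (intro sum.cong refl) (simp add: D'(2) mat_def)
      finally show ?thesis by simp
    qed
    then show ?thesis by (simp add: vec_eq_iff)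
  qed
  have t: "t = (\<Sum>i\<in>UNIV. pairing (e i) t *s d i)" for t
  proof -
    have "(\<Sum>i\<in>UNIV. pairing (e i) t *s d i) $ j = t $ j" for j
    proof -
      have "(\<Sum>i\<in>UNIV. pairing (e i) t *s d i) $ j = (\<Sum>i\<in>UNIV. \<Sum>k\<in>UNIV. D' $ j $ i * D $ i $ k * t $ k)"
        by (simp add: pairing_def d_def column_def D_def sum_distrib_left sum_distrib_right mult_ac)
      also have "\<dots> = (\<Sum>k\<in>UNIV. \<Sum>i\<in>UNIV. D' $ j $ i * D $ i $ k * t $ k)" by (rule sum.swap)
      also have "\<dots> = (\<Sum>k\<in>UNIV. (D' ** D) $ j $ k * t $ k)"
        by (simp add: matrix_matrix_mult_def sum_distrib_right)
      also have "\<dots> = (\<Sum>k\<in>UNIV. if k = j then t $ k else 0)"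
        by (intro sum.cong refl) (simp add: D'(2) mat_def)
      finally show ?thesis by simp
    qed
    then show ?thesis by (simp add: vec_eq_iff)
  qed
  show thesis
  proof (rule that[OF dual x t])
    show "e j \<in> V" if "j \<in> J" for j using that eJ B(1) by blast
    fix x i assume "x \<in> V" "i \<notin> J"
    have "d i \<in> ann B"
      unfolding ann_def
    proof (intro CollectI ballI)
      fix b assume "b \<in> B"
      then obtain j where "j \<in> J" "b = e j" using eJ by blast
      then show "pairing b (d i) = 0" using \<open>i \<notin> J\<close> by (auto simp: dual)
    qed
    then have "d i \<in> ann (vec.span B)" unfolding ann_span .
    then show "pairing x (d i) = 0" using \<open>x \<in> V\<close> B(3) by (auto simp: ann_def)
  qed
qed

lemma dim_le_CARD: "vec.dim (V :: ('k::field^'v::finite) set) \<le> CARD('v)"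
  by (rule dim_subset_UNIV_cart_gen)

lemma obtain_indices:
  fixes V :: "('k::field^'v::finite) set"
  obtains J :: "'v set" where "card J = vec.dim V"
  using obtain_subset_with_card_n[OF dim_le_CARD[of V]] by blast

lemma dim_ann:
  fixes V :: "('k::field^'v::finite) set"
  shows "vec.dim (ann V) = CARD('v) - vec.dim V"
proof -
  obtain J :: "'v set" where "card J = vec.dim (vec.span V)" by (rule obtain_indices)
  then obtain e d :: "'v \<Rightarrow> 'k^'v" where ed: "\<And>i j. pairing (e i) (d j) = (if i = j then 1 else 0)"
    "\<And>x. x = (\<Sum>i\<in>UNIV. pairing x (d i) *s e i)" "\<And>t. t = (\<Sum>i\<in>UNIV. pairing (e i) t *s d i)"
    "\<And>j. j \<in> J \<Longrightarrow> e j \<in> vec.span V" "\<And>x i. x \<in> vec.span V \<Longrightarrow> i \<notin> J \<Longrightarrow> pairing x (d i) = 0"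
    by (rule adapted_basis[OF vec.subspace_span]) blast
  have "pairing (d i) (e j) = (if i = j then 1 else 0)" for i j
    using ed(1)[of j i] by (simp add: pairing_commute)
  from independent_by_dual[of "- J" 1 d e, OF _ _ this]
  have ind: "inj_on d (- J)" "vec.independent (d ` (- J))" by auto
  have "vec.dim (ann (vec.span V)) = card (d ` (- J))"
  proof (rule vec.dim_unique[OF _ _ ind(2) refl])
    show "d ` (- J) \<subseteq> ann (vec.span V)" unfolding ann_def using ed(5) by auto
    show "ann (vec.span V) \<subseteq> vec.span (d ` (- J))"
    proof
      fix t assume t: "t \<in> ann (vec.span V)"
      have "pairing (e i) t *s d i \<in> vec.span (d ` (- J))" for i
      proof (cases "i \<in> J")
        case True
        then have "pairing (e i) t = 0" using t ed(4) unfolding ann_def by blast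
        then show ?thesis by (simp add: vec.span_zero)
      next
        case False
        then show ?thesis by (intro vec.span_scale vec.span_base) simp
      qed
      then have "(\<Sum>i\<in>UNIV. pairing (e i) t *s d i) \<in> vec.span (d ` (- J))"
        by (intro vec.span_sum)
      then show "t \<in> vec.span (d ` (- J))" using ed(3)[of t] by simp
    qed
  qed
  also have "\<dots> = CARD('v) - vec.dim V"
    using \<open>card J = _\<close> by (simp add: card_image[OF ind(1)] card_Compl)
  finally show ?thesis unfolding ann_span .
qed

lemma ann_ann:
  fixes V :: "('k::field^'v::finite) set"
  shows "ann (ann V) = vec.span V"
proof (rule sym, rule vec.subspace_dim_equal[OF vec.subspace_span subspace_ann])
  have "V \<subseteq> ann (ann V)"
  proof
    fix x assume "x \<in> V"
    then have "pairing v x = 0" if "v \<in> ann V" for v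
      using that pairing_commute[of v x] by (simp add: ann_def)
    then show "x \<in> ann (ann V)" by (simp add: ann_def)
  qed
  then show "vec.span V \<subseteq> ann (ann V)" by (rule vec.span_minimal[OF _ subspace_ann])
  show "vec.dim (ann (ann V)) \<le> vec.dim (vec.span V)"
    using dim_le_CARD[of V] by (simp add: dim_ann)
qed

lemma ann_ann_subspace: "vec.subspace V \<Longrightarrow> ann (ann V) = V"
  by (simp add: ann_ann vec.span_eq_iff)

text \<open>A basis of the annihilator of \<open>T\<close> is completed to a basis of the dual space by coordinate functions;
  these are then injective on \<open>T\<close>.\<close>

lemma coordinates_of_subspace:
  fixes T :: "('k::field^'v::finite) set"
  assumes "vec.subspace T"
  obtains J :: "'v set" where "card J = vec.dim T" "\<And>t. t \<in> T \<Longrightarrow> (\<And>j. j \<in> J \<Longrightarrow> t $ j = 0) \<Longrightarrow> t = 0"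
proof -
  obtain B where B: "B \<subseteq> ann T" "vec.independent B" "ann T \<subseteq> vec.span B" "card B = vec.dim (ann T)"
    using vec.basis_exists by blast
  obtain B' where B': "B \<subseteq> B'" "B' \<subseteq> B \<union> cart_basis" "vec.independent B'" "B \<union> cart_basis \<subseteq> vec.span B'"
    using vec.maximal_independent_subset_extend[OF _ B(2), of "B \<union> cart_basis"] by blast
  have fB': "finite B'" by (rule vec.finiteI_independent[OF B'(3)])
  have "vec.span B' = UNIV"
    using vec.span_minimal[OF _ vec.subspace_span, of "cart_basis" B'] B'(4) by (simp add: top.extremum_unique)
  then have "card B' = CARD('v)"
    using vec.basis_card_eq_dim[of B' UNIV] B'(3) by (simp add: vec_dim_card card_cart_basis)
  define J where "J = {j. axis j 1 \<in> B' - B}"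
  have img: "(\<lambda>j. axis j 1) ` J = B' - B"
  proof
    show "(\<lambda>j. axis j 1) ` J \<subseteq> B' - B" by (simp add: J_def image_subset_iff)
    show "B' - B \<subseteq> (\<lambda>j. axis j 1) ` J"
    proof
      fix b assume b: "b \<in> B' - B"
      then obtain j where "b = axis j 1" using B'(2) by (auto simp: cart_basis_def)
      with b show "b \<in> (\<lambda>j. axis j 1) ` J" by (simp add: J_def)
    qed
  qed
  have "inj_on (\<lambda>j. axis j 1 :: 'k^'v) J" by (rule inj_onI) (simp add: axis_eq_axis)
  from card_image[OF this] have "card J = card (B' - B)" by (simp add: img)
  also have "\<dots> = vec.dim T"
    using B'(1) \<open>card B' = _\<close> B(4) dim_le_CARD[of T] fB' finite_subset[OF B'(1) fB']
    by (simp add: card_Diff_subset dim_ann)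
  finally have "card J = vec.dim T" .
  moreover have "t = 0" if t: "t \<in> T" "\<And>j. j \<in> J \<Longrightarrow> t $ j = 0" for t
  proof -
    have "pairing b t = 0" if "b \<in> B'" for b
    proof (cases "b \<in> B")
      case True
      then have "b \<in> ann T" using B(1) by blast
      then show ?thesis using t(1) pairing_commute[of b t] by (simp add: ann_def)
    next
      case False
      then have "b \<in> (\<lambda>j. axis j 1) ` J" using that unfolding img by simp
      then obtain j where "j \<in> J" "b = axis j 1" by (rule imageE) simp
      then show ?thesis using t(2) by simp
    qed
    then have "t \<in> ann B'" by (simp add: ann_def)
    then have "t \<in> ann (vec.span B')" unfolding ann_span .
    then have "pairing (axis i 1) t = 0" for i using \<open>vec.span B' = UNIV\<close> by (simp add: ann_def)
    then show "t = 0" by (simp add: vec_eq_iff)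
  qed
  ultimately show thesis by (rule that)
qed

subsection \<open>Rank and kernel\<close>

lemma rank_eq_dim_span_rows: "rank M = vec.dim (vec.span (rows M))"
  by (simp add: row_rank_def_gen)

lemma row_eq_nth: "row i M = M $ i"
  by (simp add: row_def vec_lambda_eta)

lemma rows_eq_range: "rows M = range (\<lambda>i. M $ i)"
  by (auto simp: rows_def row_eq_nth)

lemma matrix_vector_mult_pairing: "(M *v x) $ i = pairing (M $ i) x"
  by (simp add: matrix_vector_mult_def pairing_def)

lemma kernel_eq_ann: "{x. M *v x = 0} = ann (rows M)"
  by (auto simp: ann_def rows_eq_range vec_eq_iff matrix_vector_mult_pairing)

lemma dim_kernel: "vec.dim {x. (M :: 'k::field^'v::finite^'m::finite) *v x = 0} = CARD('v) - rank M"
  by (simp add: kernel_eq_ann dim_ann row_rank_def_gen)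

lemma rank_le_CARD: "rank (M :: 'k::field^'v::finite^'m::finite) \<le> CARD('v)"
  by (simp add: row_rank_def_gen dim_le_CARD)

lemma rank_eq_kernel: "rank (M :: 'k::field^'v::finite^'m::finite) = CARD('v) - vec.dim {x. M *v x = 0}"
  using rank_le_CARD[of M] by (simp add: dim_kernel)

lemma dim_Un_le:
  fixes S T :: "('k::field^'v::finite) set"
  shows "vec.dim (S \<union> T) \<le> vec.dim S + vec.dim T"
proof -
  obtain B where B: "B \<subseteq> S" "vec.independent B" "S \<subseteq> vec.span B" "card B = vec.dim S"
    using vec.basis_exists by blast
  obtain C where C: "C \<subseteq> T" "vec.independent C" "T \<subseteq> vec.span C" "card C = vec.dim T"
    using vec.basis_exists by blast
  have "finite (B \<union> C)" using B(2) C(2) vec.finiteI_independent by blast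
  moreover have "S \<union> T \<subseteq> vec.span (B \<union> C)"
    using B(3) C(3) vec.span_mono[of B "B \<union> C"] vec.span_mono[of C "B \<union> C"] by blast
  ultimately have "vec.dim (S \<union> T) \<le> card (B \<union> C)" by (intro vec.dim_le_card)
  then show ?thesis using card_Un_le[of B C] B(4) C(4) by linarith
qed

lemma rank_add_le: "rank (A + B) \<le> rank A + rank (B :: 'k::field^'v::finite^'m::finite)"
proof -
  have "rows (A + B) \<subseteq> vec.span (rows A \<union> rows B)"
  proof
    fix x assume "x \<in> rows (A + B)"
    then obtain i where x: "x = A $ i + B $ i" by (auto simp: rows_eq_range)
    show "x \<in> vec.span (rows A \<union> rows B)"
      unfolding x by (intro vec.span_add vec.span_base) (auto simp: rows_eq_range)
  qed
  then have "vec.dim (rows (A + B)) \<le> vec.dim (rows A \<union> rows B)" by (rule vec.dim_mono)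
  then show ?thesis using dim_Un_le[of "rows A" "rows B"] by (simp add: row_rank_def_gen)
qed

lemma rank_invertible: "invertible (M :: 'k::field^'v::finite^'v) \<Longrightarrow> rank M = CARD('v)"
proof -
  assume "invertible M"
  then have "vec.span (rows M) = UNIV"
    using matrix_left_invertible_span_rows_gen[of M] unfolding invertible_def by blast
  then show ?thesis by (simp add: rank_eq_dim_span_rows vec_dim_card card_cart_basis)
qed

text \<open>The rows of \<open>M\<close> outside a maximal independent set are replaced by vectors that complete a basis.\<close>

lemma rank_complement:
  fixes M :: "'k::field^'v::finite^'v"
  obtains E where "rank E + rank M \<le> CARD('v)" "invertible (M + E)"
proof -
  obtain B where B: "B \<subseteq> rows M" "vec.independent B" "rows M \<subseteq> vec.span B" "card B = vec.dim (rows M)"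
    using vec.basis_exists by blast
  obtain B' where B': "B \<subseteq> B'" "vec.independent B'" "vec.span B' = UNIV" "finite B'" "card B' = CARD('v)"
    by (rule basis_of_UNIV_extending[OF B(2)])
  have fB: "finite B" using B'(1,4) finite_subset by blast
  have "\<forall>b\<in>B. \<exists>i. M $ i = b" using B(1) by (auto simp: rows_eq_range)
  then obtain r where r: "\<And>b. b \<in> B \<Longrightarrow> M $ r b = b" by metis
  have inj: "inj_on r B" using r by (metis inj_onI)
  define I where "I = r ` B"
  have cI: "card I = card B" using card_image[OF inj] by (simp add: I_def)
  have "card (- I) = card (B' - B)"
    using B'(1,5) fB by (simp add: card_Compl card_Diff_subset cI)
  then obtain f where f: "bij_betw f (- I) (B' - B)"
    using finite_same_card_bij[of "- I" "B' - B"] B'(4) by auto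
  define E :: "'k^'v^'v" where "E = (\<chi> i. if i \<in> I then 0 else f i - M $ i)"
  have "B' \<subseteq> rows (M + E)"
  proof
    fix b assume b: "b \<in> B'"
    show "b \<in> rows (M + E)"
    proof (cases "b \<in> B")
      case True
      then have "(M + E) $ r b = b" using r by (simp add: E_def I_def)
      then show ?thesis unfolding rows_eq_range by (metis rangeI)
    next
      case False
      then have "b \<in> f ` (- I)" using b bij_betw_imp_surj_on[OF f] by simp
      then obtain i where "i \<in> - I" "f i = b" by (elim imageE) simp
      then have "(M + E) $ i = b" by (simp add: E_def)
      then show ?thesis unfolding rows_eq_range by (metis rangeI)
    qed
  qed
  then have "vec.span (rows (M + E)) = UNIV"
    using vec.span_mono[of B' "rows (M + E)"] B'(3) by (simp add: top.extremum_unique)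
  then have inv: "invertible (M + E)" by (rule invertible_if_rows_span)
  have "rows E \<subseteq> vec.span ((\<lambda>i. E $ i) ` (- I))"
  proof
    fix x assume "x \<in> rows E"
    then obtain i where i: "x = E $ i" by (auto simp: rows_eq_range)
    show "x \<in> vec.span ((\<lambda>i. E $ i) ` (- I))"
    proof (cases "i \<in> I")
      case True
      then have "x = 0" by (simp add: i E_def)
      then show ?thesis by (simp add: vec.span_zero)
    qed (auto simp: i intro: vec.span_base)
  qed
  then have "rank E \<le> card ((\<lambda>i. E $ i) ` (- I))"
    unfolding row_rank_def_gen by (intro vec.dim_le_card) auto
  also have "\<dots> \<le> card (- I)" by (rule card_image_le) simp
  also have "\<dots> = CARD('v) - rank M" by (simp add: card_Compl cI B(4) row_rank_def_gen)
  finally have "rank E + rank M \<le> CARD('v)" using rank_le_CARD[of M] by linarith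
  then show thesis using inv by (rule that)
qed

text \<open>If the ranks of \<open>L\<close> and \<open>E\<close> add up to at most the full rank of \<open>L + E\<close>, the space
  is the direct sum of the two kernels, so \<open>(L + E)\<^sup>-\<^sup>1 E\<close> is the projection to the kernel of \<open>L\<close>.\<close>

lemma complementary_kernel:
  fixes L E :: "'k::field^'v::finite^'v"
  assumes inv: "invertible (L + E)" and rk: "rank L + rank E \<le> CARD('v)"
    and y: "(L + E) *v y = E *v v"
  shows "L *v y = 0"
proof -
  from inv[unfolded invertible_def] obtain R where
    "(L + E) ** R = mat 1 \<and> R ** (L + E) = mat 1" ..
  then have R: "R ** (L + E) = mat 1" ..
  have inj: "x = y" if "(L + E) *v x = (L + E) *v y" for x y
  proof -
    have "R *v ((L + E) *v x) = R *v ((L + E) *v y)" using that by (rule arg_cong)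
    then show ?thesis unfolding matrix_vector_mul_assoc R matrix_vector_mul_lid .
  qed
  have subE: "vec.subspace {x. E *v x = 0}" and subL: "vec.subspace {x. L *v x = 0}"
    unfolding kernel_eq_ann by (rule subspace_ann)+
  obtain J :: "'v set" where J: "card J = vec.dim {x. E *v x = 0}" by (rule obtain_indices)
  obtain e d :: "'v \<Rightarrow> 'k^'v" where ed: "\<And>i j. pairing (e i) (d j) = (if i = j then 1 else 0)"
    "\<And>x. x = (\<Sum>i\<in>UNIV. pairing x (d i) *s e i)" "\<And>t. t = (\<Sum>i\<in>UNIV. pairing (e i) t *s d i)"
    "\<And>j. j \<in> J \<Longrightarrow> e j \<in> {x. E *v x = 0}" "\<And>x i. x \<in> {x. E *v x = 0} \<Longrightarrow> i \<notin> J \<Longrightarrow> pairing x (d i) = 0"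
    by (rule adapted_basis[OF subE J]) blast
  have kerE: "E *v x = 0" if "\<And>i. i \<notin> J \<Longrightarrow> pairing x (d i) = 0" for x
  proof -
    have "pairing x (d i) *s e i \<in> {x. E *v x = 0}" for i
      using that[of i] ed(4)[of i] vec.subspace_0[OF subE]
      by (cases "i \<in> J") (simp_all add: vec.scale)
    then have "(\<Sum>i\<in>UNIV. pairing x (d i) *s e i) \<in> {x. E *v x = 0}"
      by (intro vec.subspace_sum[OF subE])
    then show ?thesis using ed(2)[of x] by simp
  qed
  \<comment> \<open>the coordinates modulo the kernel of \<open>E\<close>; on the kernel of \<open>L\<close> they are injective, hence
    bijective by a count of dimensions\<close>
  define p where "p x = (\<chi> i. if i \<in> J then 0 else pairing x (d i))" for x
  have lin: "Vector_Spaces.linear (*s) (*s) p"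
    by unfold_locales (simp_all add: p_def vec_eq_iff pairing_add_left)
  have "inj_on p {x. L *v x = 0}"
  proof (rule inj_onI)
    fix x z assume xz: "x \<in> {x. L *v x = 0}" "z \<in> {x. L *v x = 0}" "p x = p z"
    have "E *v (x - z) = 0"
    proof (rule kerE)
      fix i assume "i \<notin> J"
      moreover have "p x $ i = p z $ i" using xz(3) by simp
      ultimately show "pairing (x - z) (d i) = 0" by (simp add: p_def pairing_diff_left)
    qed
    moreover have "L *v (x - z) = 0" using xz(1,2) by (simp add: matrix_vector_mult_diff_distrib)
    ultimately have "(L + E) *v x = (L + E) *v z"
      by (simp add: matrix_vector_mult_add_rdistrib matrix_vector_mult_diff_distrib)
    then show "x = z" by (rule inj)
  qed
  then have "vec.dim (p ` {x. L *v x = 0}) = vec.dim {x. L *v x = 0}"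
    using vec.dim_image_eq[OF lin, of "{x. L *v x = 0}"] vec.span_eq_iff subL by metis
  moreover have "vec.dim {x :: 'k^'v. \<forall>i. i \<notin> - J \<longrightarrow> x $ i = 0} = card (- J)"
    by (rule dim_substandard_cart)
  moreover have "card (- J) \<le> vec.dim {x. L *v x = 0}"
    using J rk rank_le_CARD[of E] by (simp add: card_Compl dim_kernel)
  ultimately have "p ` {x. L *v x = 0} = {x. \<forall>i. i \<notin> - J \<longrightarrow> x $ i = 0}"
  proof (intro vec.subspace_dim_equal)
    show "vec.subspace (p ` {x. L *v x = 0})" by (rule vec.linear_subspace_image[OF lin subL])
    show "vec.subspace {x :: 'k^'v. \<forall>i. i \<notin> - J \<longrightarrow> x $ i = 0}" by (simp add: vec.subspace_def)
    show "p ` {x. L *v x = 0} \<subseteq> {x. \<forall>i. i \<notin> - J \<longrightarrow> x $ i = 0}" by (auto simp: p_def)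
  qed simp
  moreover have "p v \<in> {x. \<forall>i. i \<notin> - J \<longrightarrow> x $ i = 0}" by (simp add: p_def)
  ultimately obtain k where k: "L *v k = 0" "p v = p k" by blast
  have "E *v (v - k) = 0"
  proof (rule kerE)
    fix i assume "i \<notin> J"
    moreover have "p v $ i = p k $ i" using k(2) by simp
    ultimately show "pairing (v - k) (d i) = 0" by (simp add: p_def pairing_diff_left)
  qed
  then have "(L + E) *v y = (L + E) *v k"
    using y k(1) by (simp add: matrix_vector_mult_add_rdistrib matrix_vector_mult_diff_distrib)
  then show ?thesis using inj k(1) by blast
qed

section \<open>Adjoining elements to subrings\<close>

definition subring :: "'r::comm_ring_1 set \<Rightarrow> bool" where
  "subring A \<longleftrightarrow> 1 \<in> A \<and> (\<forall>a\<in>A. \<forall>b\<in>A. a + b \<in> A \<and> a * b \<in> A \<and> - a \<in> A)"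

definition poly_over :: "'r::comm_ring_1 set \<Rightarrow> 'r poly \<Rightarrow> bool" where
  "poly_over A p \<longleftrightarrow> (\<forall>n. coeff p n \<in> A)"

definition adjoin :: "'r::comm_ring_1 set \<Rightarrow> 'r \<Rightarrow> 'r set" where
  "adjoin A x = {poly p x | p. poly_over A p}"

lemma subringD:
  assumes "subring A"
  shows "1 \<in> A" "0 \<in> A" "a \<in> A \<Longrightarrow> b \<in> A \<Longrightarrow> a + b \<in> A" "a \<in> A \<Longrightarrow> b \<in> A \<Longrightarrow> a * b \<in> A"
    "a \<in> A \<Longrightarrow> - a \<in> A" "a \<in> A \<Longrightarrow> b \<in> A \<Longrightarrow> a - b \<in> A"
proof -
  have "1 + - 1 \<in> A" using assms unfolding subring_def by blast
  then show "0 \<in> A" by simp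
  show "a \<in> A \<Longrightarrow> b \<in> A \<Longrightarrow> a - b \<in> A"
    using assms unfolding subring_def diff_conv_add_uminus by blast
qed (use assms in \<open>auto simp: subring_def\<close>)

lemma subring_sum: "subring A \<Longrightarrow> (\<And>i. i \<in> I \<Longrightarrow> f i \<in> A) \<Longrightarrow> sum f I \<in> A"
  by (induction I rule: infinite_finite_induct) (auto intro: subringD)

lemma poly_over_closed:
  assumes "subring A"
  shows "poly_over A 0" "a \<in> A \<Longrightarrow> poly_over A (monom a n)"
    "poly_over A p \<Longrightarrow> poly_over A q \<Longrightarrow> poly_over A (p + q)"
    "poly_over A p \<Longrightarrow> poly_over A q \<Longrightarrow> poly_over A (p - q)"
    "poly_over A p \<Longrightarrow> poly_over A q \<Longrightarrow> poly_over A (p * q)"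
    "poly_over A p \<Longrightarrow> poly_over A (- p)"
  using subringD[OF assms]
  by (auto simp: poly_over_def coeff_mult intro: subring_sum[OF assms])

lemma subring_adjoin: "subring A \<Longrightarrow> subring (adjoin A x)"
proof -
  assume A: "subring A"
  note pc = poly_over_closed[OF A]
  have "1 \<in> adjoin A x"
    unfolding adjoin_def using pc(2)[OF subringD(1)[OF A], of 0]
    by (intro CollectI exI[of _ "monom 1 0"]) (simp add: poly_monom)
  moreover have "a + b \<in> adjoin A x \<and> a * b \<in> adjoin A x \<and> - a \<in> adjoin A x"
    if ab: "a \<in> adjoin A x" "b \<in> adjoin A x" for a b
  proof -
    obtain p q where pq: "a = poly p x" "b = poly q x" "poly_over A p" "poly_over A q"
      using ab unfolding adjoin_def by blast
    have "a + b = poly (p + q) x" "a * b = poly (p * q) x" "- a = poly (- p) x" by (simp_all add: pq)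
    then show ?thesis unfolding adjoin_def using pc(3,5,6) pq(3,4) by blast
  qed
  ultimately show ?thesis unfolding subring_def by blast
qed

lemma subset_adjoin: "subring A \<Longrightarrow> A \<subseteq> adjoin A x"
proof
  fix a assume "subring A" "a \<in> A"
  then have "poly_over A (monom a 0)" "a = poly (monom a 0) x"
    by (simp_all add: poly_over_closed poly_monom)
  then show "a \<in> adjoin A x" unfolding adjoin_def by blast
qed

lemma in_adjoin: "subring A \<Longrightarrow> x \<in> adjoin A x"
proof -
  assume "subring A"
  then have "poly_over A (monom 1 1)" "x = poly (monom 1 1) x"
    by (simp_all add: poly_over_closed subringD poly_monom)
  then show ?thesis unfolding adjoin_def by blast
qed

section \<open>The basis theorem\<close>

text \<open>The ascending chain condition for finitely generated ideals of a subring, in the form needed here: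
  in every sequence some term is a linear combination of its predecessors.\<close>

definition noetherian :: "'r::comm_ring_1 set \<Rightarrow> bool" where
  "noetherian A \<longleftrightarrow> subring A \<and>
     (\<forall>a :: nat \<Rightarrow> 'r. range a \<subseteq> A \<longrightarrow> (\<exists>m r. (\<forall>i<m. r i \<in> A) \<and> a m = (\<Sum>i<m. r i * a i)))"

definition seq_ideal :: "'r::comm_ring_1 set \<Rightarrow> (nat \<Rightarrow> 'r) \<Rightarrow> 'r set" where
  "seq_ideal B a = {c. \<exists>m r. (\<forall>i<m. r i \<in> B) \<and> c = (\<Sum>i<m. r i * a i)}"

lemma seq_idealI: "(\<And>i. i < m \<Longrightarrow> r i \<in> B) \<Longrightarrow> (\<Sum>i<m. r i * a i) \<in> seq_ideal B a"
  unfolding seq_ideal_def by (intro CollectI exI[of _ m] exI[of _ r]) simp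

lemma seq_idealE:
  assumes "c \<in> seq_ideal B a"
  obtains m r where "\<forall>i<m. r i \<in> B" "c = (\<Sum>i<m. r i * a i)"
proof -
  from assms[unfolded seq_ideal_def mem_Collect_eq] obtain m where
    "\<exists>r. (\<forall>i<m. r i \<in> B) \<and> c = (\<Sum>i<m. r i * a i)" ..
  then obtain r where "(\<forall>i<m. r i \<in> B) \<and> c = (\<Sum>i<m. r i * a i)" ..
  then show thesis by (intro that[of m r]) simp_all
qed

lemma seq_ideal_diff:
  assumes B: "subring B" and "c \<in> seq_ideal B a" "d \<in> seq_ideal B a"
  shows "c - d \<in> seq_ideal B a"
proof -
  obtain m r where r: "\<forall>i<m. r i \<in> B" "c = (\<Sum>i<m. r i * a i)"
    using assms(2) by (rule seq_idealE)
  obtain n s where s: "\<forall>i<n. s i \<in> B" "d = (\<Sum>i<n. s i * a i)"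
    using assms(3) by (rule seq_idealE)
  define r' where "r' i = (if i < m then r i else 0)" for i
  define s' where "s' i = (if i < n then s i else 0)" for i
  have 1: "(\<Sum>i<m. r i * a i) = (\<Sum>i<max m n. r' i * a i)"
    by (rule sum.mono_neutral_cong_left) (auto simp: r'_def)
  have 2: "(\<Sum>i<n. s i * a i) = (\<Sum>i<max m n. s' i * a i)"
    by (rule sum.mono_neutral_cong_left) (auto simp: s'_def)
  have eq: "c - d = (\<Sum>i<max m n. (r' i - s' i) * a i)"
    by (simp add: r(2) s(2) 1 2 left_diff_distrib sum_subtractf)
  have "r' i \<in> B" "s' i \<in> B" for i using r(1) s(1) subringD(2)[OF B] by (simp_all add: r'_def s'_def)
  then show ?thesis unfolding eq by (intro seq_idealI subringD(6)[OF B])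
qed

lemma seq_ideal_mult:
  assumes B: "subring B" and "c \<in> seq_ideal B a" "b \<in> B"
  shows "b * c \<in> seq_ideal B a"
proof -
  obtain m r where r: "\<forall>i<m. r i \<in> B" "c = (\<Sum>i<m. r i * a i)"
    using assms(2) by (rule seq_idealE)
  have eq: "b * c = (\<Sum>i<m. (b * r i) * a i)" by (simp add: r(2) sum_distrib_left mult.assoc)
  show ?thesis unfolding eq by (intro seq_idealI subringD(4)[OF B] r(1)[rule_format] assms(3))
qed

lemma seq_ideal_sum:
  assumes B: "subring B" and f: "\<And>i. i \<in> I \<Longrightarrow> f i \<in> seq_ideal B a"
  shows "sum f I \<in> seq_ideal B a"
proof -
  have 0: "0 \<in> seq_ideal B a" using seq_idealI[of 0 "\<lambda>_. 0" B a] by simp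
  have neg: "- c \<in> seq_ideal B a" if "c \<in> seq_ideal B a" for c
    using seq_ideal_diff[OF B 0 that] by simp
  have "c + d \<in> seq_ideal B a" if "c \<in> seq_ideal B a" "d \<in> seq_ideal B a" for c d
    using seq_ideal_diff[OF B that(1) neg[OF that(2)]] by simp
  then show ?thesis using f 0 by (induction I rule: infinite_finite_induct) simp_all
qed

lemma seq_ideal_term:
  assumes "subring B"
  shows "a m \<in> seq_ideal B a"
proof -
  have "(\<Sum>i<Suc m. (if i = m then 1 else 0) * a i) \<in> seq_ideal B a"
    using subringD(1,2)[OF assms] by (intro seq_idealI) simp
  then show ?thesis by simp
qed

lemma noetherianD:
  fixes a :: "nat \<Rightarrow> 'r::comm_ring_1"
  assumes "noetherian A" "range a \<subseteq> A"
  obtains m r where "\<forall>i<m. r i \<in> A" "a m = (\<Sum>i<m. r i * a i)"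
proof -
  have "\<exists>m r. (\<forall>i<m. r i \<in> A) \<and> a m = (\<Sum>i<m. r i * a i)"
    using assms(1)[unfolded noetherian_def, THEN conjunct2, rule_format, OF assms(2)] .
  then obtain m where "\<exists>r. (\<forall>i<m. r i \<in> A) \<and> a m = (\<Sum>i<m. r i * a i)" ..
  then obtain r where "(\<forall>i<m. r i \<in> A) \<and> a m = (\<Sum>i<m. r i * a i)" ..
  then show thesis by (intro that[of m r]) simp_all
qed

text \<open>Hilbert's argument: choose successively polynomials of least degree outside the ideal generated
  by the previous ones and apply the chain condition to their leading coefficients.\<close>

lemma noetherian_adjoin:
  assumes A: "noetherian A"
  shows "noetherian (adjoin A x)"
  unfolding noetherian_def
proof (intro conjI allI impI)
  have sA: "subring A" using A by (simp add: noetherian_def)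
  note pc = poly_over_closed[OF sA]
  show "subring (adjoin A x)" by (rule subring_adjoin[OF sA])
  fix a :: "nat \<Rightarrow> 'a" assume a: "range a \<subseteq> adjoin A x"
  show "\<exists>m r. (\<forall>i<m. r i \<in> adjoin A x) \<and> a m = (\<Sum>i<m. r i * a i)"
  proof (rule ccontr)
    assume neg: "\<not> ?thesis"
    \<comment> \<open>Lifted to polynomials, a counterexample yields an ideal \<open>J\<close> that is not finitely generated.\<close>
    define J where "J = {p. poly_over A p \<and> poly p x \<in> seq_ideal (adjoin A x) a}"
    define gen where "gen ps = {p. \<exists>q. (\<forall>i<length ps. poly_over A (q i)) \<and> p = (\<Sum>i<length ps. q i * ps ! i)}"
      for ps :: "'a poly list"
    have sAx: "subring (adjoin A x)" by (rule subring_adjoin[OF sA])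
    have val: "poly q x \<in> adjoin A x" if "poly_over A q" for q
      unfolding adjoin_def using that by blast
    have J_diff: "p - q \<in> J" if "p \<in> J" "q \<in> J" for p q
      using that seq_ideal_diff[OF sAx] pc(4) by (simp add: J_def)
    have J_sum: "(\<Sum>i<m. q i * f i) \<in> J" if "\<And>i. i < m \<Longrightarrow> f i \<in> J" "\<And>i. i < m \<Longrightarrow> poly_over A (q i)"
      for m :: nat and q f
    proof -
      have "poly_over A (\<Sum>i<m. q i * f i)"
        using that by (induction m) (auto simp: J_def intro!: pc)
      moreover have "poly (\<Sum>i<m. q i * f i) x \<in> seq_ideal (adjoin A x) a"
        unfolding poly_sum poly_mult
        by (intro seq_ideal_sum[OF sAx] seq_ideal_mult[OF sAx] val) (use that in \<open>auto simp: J_def\<close>)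
      ultimately show ?thesis by (simp add: J_def)
    qed
    have aJ: "\<exists>p\<in>J. poly p x = a m" for m
    proof -
      have "a m \<in> adjoin A x" using a by blast
      then obtain p where p: "poly_over A p" "a m = poly p x" unfolding adjoin_def by blast
      then have "p \<in> J" using seq_ideal_term[OF sAx, of a m] by (simp add: J_def)
      then show ?thesis using p(2) by auto
    qed
    have ex: "\<exists>p. p \<in> J \<and> p \<notin> gen ps" if ps: "set ps \<subseteq> J" for ps
    proof (rule ccontr)
      assume "\<not> ?thesis"
      then have all: "J \<subseteq> gen ps" by blast
      \<comment> \<open>Finitely many \<open>a i\<close> suffice to express the generators, hence every \<open>a m\<close>.\<close>
      have "\<exists>nr. (\<forall>i<fst nr. snd nr i \<in> adjoin A x) \<and> poly p x = (\<Sum>i<fst nr. snd nr i * a i)"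
        if "p \<in> set ps" for p
      proof -
        have "poly p x \<in> seq_ideal (adjoin A x) a" using that ps by (auto simp: J_def)
        then obtain n r where "\<forall>i<n. r i \<in> adjoin A x" "poly p x = (\<Sum>i<n. r i * a i)"
          by (rule seq_idealE)
        then show ?thesis by (intro exI[of _ "(n, r)"]) simp
      qed
      then have "\<forall>p\<in>set ps. \<exists>nr. (\<forall>i<fst nr. snd nr i \<in> adjoin A x) \<and> poly p x = (\<Sum>i<fst nr. snd nr i * a i)"
        by simp
      from bchoice[OF this] obtain nr where nr: "\<forall>p\<in>set ps. (\<forall>i<fst (nr p). snd (nr p) i \<in> adjoin A x) \<and>
        poly p x = (\<Sum>i<fst (nr p). snd (nr p) i * a i)" ..
      define n where "n p = fst (nr p)" for p
      define r where "r p = snd (nr p)" for p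
      have r: "(\<forall>i<n p. r p i \<in> adjoin A x) \<and> poly p x = (\<Sum>i<n p. r p i * a i)" if "p \<in> set ps" for p
        using nr that by (simp add: n_def r_def)
      define m where "m = (\<Sum>p\<in>set ps. n p)"
      have nm: "n p \<le> m" if "p \<in> set ps" for p
        unfolding m_def using that by (intro member_le_sum) auto
      from aJ[of m] obtain p where p: "p \<in> J" "poly p x = a m" by (elim bexE)
      from all p(1) have "p \<in> gen ps" by blast
      then obtain q where "(\<forall>i<length ps. poly_over A (q i)) \<and> p = (\<Sum>i<length ps. q i * ps ! i)"
        unfolding gen_def mem_Collect_eq ..
      then have q: "\<forall>i<length ps. poly_over A (q i)" "p = (\<Sum>i<length ps. q i * ps ! i)" by simp_all
      define r' where "r' p i = (if i < n p then r p i else 0)" for p i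
      have r': "poly (ps ! j) x = (\<Sum>i<m. r' (ps ! j) i * a i)" if "j < length ps" for j
      proof -
        have "ps ! j \<in> set ps" using that by simp
        then have "poly (ps ! j) x = (\<Sum>i<n (ps ! j). r (ps ! j) i * a i)" using r by simp
        also have "\<dots> = (\<Sum>i<m. r' (ps ! j) i * a i)"
          by (rule sum.mono_neutral_cong_left) (use nm[OF \<open>ps ! j \<in> set ps\<close>] in \<open>auto simp: r'_def\<close>)
        finally show ?thesis .
      qed
      have "a m = (\<Sum>j<length ps. poly (q j) x * poly (ps ! j) x)"
        using p(2) unfolding q(2) by (simp add: poly_sum)
      also have "\<dots> = (\<Sum>j<length ps. \<Sum>i<m. poly (q j) x * r' (ps ! j) i * a i)"
        by (intro sum.cong refl) (simp add: r' sum_distrib_left mult.assoc)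
      also have "\<dots> = (\<Sum>i<m. (\<Sum>j<length ps. poly (q j) x * r' (ps ! j) i) * a i)"
        unfolding sum_distrib_right by (rule sum.swap)
      finally have "a m = (\<Sum>i<m. (\<Sum>j<length ps. poly (q j) x * r' (ps ! j) i) * a i)" .
      moreover have "\<forall>i<m. (\<Sum>j<length ps. poly (q j) x * r' (ps ! j) i) \<in> adjoin A x"
      proof (intro allI impI subring_sum[OF sAx] subringD(4)[OF sAx])
        fix i j assume "j \<in> {..<length ps}"
        then show "poly (q j) x \<in> adjoin A x" using q(1) by (intro val) simp
        show "r' (ps ! j) i \<in> adjoin A x"
          using \<open>j \<in> _\<close> r subringD(2)[OF sAx] by (simp add: r'_def)
      qed
      ultimately have "\<exists>m r. (\<forall>i<m. r i \<in> adjoin A x) \<and> a m = (\<Sum>i<m. r i * a i)"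
        by (intro exI[of _ m] exI[of _ "\<lambda>i. \<Sum>j<length ps. poly (q j) x * r' (ps ! j) i"] conjI)
      then show False using neg by (rule notE[rotated])
    qed
    define next_poly where "next_poly ps = (ARG_MIN degree p. p \<in> J \<and> p \<notin> gen ps)" for ps
    have nxt: "next_poly ps \<in> J" "next_poly ps \<notin> gen ps"
      "\<And>q. q \<in> J \<Longrightarrow> q \<notin> gen ps \<Longrightarrow> degree (next_poly ps) \<le> degree q" if "set ps \<subseteq> J" for ps
    proof -
      from ex[OF that] obtain p where p: "p \<in> J \<and> p \<notin> gen ps" ..
      show "next_poly ps \<in> J" "next_poly ps \<notin> gen ps"
        using arg_min_natI[of "\<lambda>p. p \<in> J \<and> p \<notin> gen ps" p degree, OF p] by (simp_all add: next_poly_def)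
      show "\<And>q. q \<in> J \<Longrightarrow> q \<notin> gen ps \<Longrightarrow> degree (next_poly ps) \<le> degree q"
        using arg_min_nat_le[of "\<lambda>p. p \<in> J \<and> p \<notin> gen ps" _ degree] by (simp add: next_poly_def)
    qed
    define seq where "seq = rec_nat [] (\<lambda>_ ps. ps @ [next_poly ps])"
    have seq: "seq 0 = []" "seq (Suc k) = seq k @ [next_poly (seq k)]" for k by (simp_all add: seq_def)
    have seqJ: "set (seq k) \<subseteq> J \<and> length (seq k) = k" for k
      by (induction k) (auto simp: seq nxt)
    define f where "f k = next_poly (seq k)" for k
    have seq_nth: "seq k ! i = f i" if "i < k" for i k
      using that by (induction k) (auto simp: seq nth_append seqJ f_def less_Suc_eq)
    have fJ: "f k \<in> J" for k unfolding f_def using nxt(1)[of "seq k"] seqJ[of k] by simp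
    have f_not: "f k \<noteq> (\<Sum>i<k. q i * f i)" if "\<forall>i<k. poly_over A (q i)" for k q
    proof
      assume "f k = (\<Sum>i<k. q i * f i)"
      also have "\<dots> = (\<Sum>i<length (seq k). q i * seq k ! i)"
        using seqJ by (intro sum.cong) (auto simp: seq_nth)
      finally have "f k \<in> gen (seq k)"
        unfolding gen_def using that seqJ[of k] by (intro CollectI exI[of _ q]) simp
      then show False unfolding f_def using nxt(2)[of "seq k"] seqJ[of k] by simp
    qed
    have f_min: "degree (f k) \<le> degree q"
      if "q \<in> J" "\<And>r. \<forall>i<k. poly_over A (r i) \<Longrightarrow> q \<noteq> (\<Sum>i<k. r i * f i)" for k q
    proof -
      have "q \<notin> gen (seq k)"
      proof
        assume "q \<in> gen (seq k)"
        then obtain r where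
          "(\<forall>i<length (seq k). poly_over A (r i)) \<and> q = (\<Sum>i<length (seq k). r i * seq k ! i)"
          unfolding gen_def mem_Collect_eq ..
        then have r: "\<forall>i<k. poly_over A (r i)" "q = (\<Sum>i<k. r i * seq k ! i)"
          using seqJ[of k] by simp_all
        have "q = (\<Sum>i<k. r i * f i)" unfolding r(2) by (intro sum.cong) (auto simp: seq_nth)
        then show False using that(2)[OF r(1)] by simp
      qed
      then show ?thesis unfolding f_def using nxt(3)[of "seq k" q] seqJ[of k] that(1) by simp
    qed
    have deg_mono: "degree (f i) \<le> degree (f k)" if "i \<le> k" for i k
    proof (rule f_min[OF fJ])
      fix r assume r: "\<forall>j<i. poly_over A (r j)"
      show "f k \<noteq> (\<Sum>j<i. r j * f j)"
      proof
        assume *: "f k = (\<Sum>j<i. r j * f j)"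
        have "(\<Sum>j<i. r j * f j) = (\<Sum>j<k. (if j < i then r j else 0) * f j)"
          using that by (intro sum.mono_neutral_cong_left) auto
        moreover have "\<forall>j<k. poly_over A (if j < i then r j else 0)" using r pc(1) by simp
        ultimately show False using f_not[of k "\<lambda>j. if j < i then r j else 0"] * by simp
      qed
    qed
    have lcA: "range (\<lambda>k. lead_coeff (f k)) \<subseteq> A"
      using fJ by (auto simp: J_def poly_over_def)
    obtain m r where r: "\<forall>i<m. r i \<in> A" "lead_coeff (f m) = (\<Sum>i<m. r i * lead_coeff (f i))"
      by (rule noetherianD[OF A lcA])
    \<comment> \<open>multipliers that cancel the leading term of \<open>f m\<close>, so that \<open>g\<close> contradicts the choice of \<open>f m\<close>
      as a polynomial of least degree\<close>
    define q where "q i = monom (r i) (degree (f m) - degree (f i))" for i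
    have q: "\<forall>i<m. poly_over A (q i)" using r(1) pc(2) by (simp add: q_def)
    define g where "g = f m - (\<Sum>i<m. q i * f i)"
    have "g \<in> J" unfolding g_def using q fJ J_sum[of m f q] by (intro J_diff) auto
    have g_not: "g \<noteq> (\<Sum>i<m. s i * f i)" if "\<forall>i<m. poly_over A (s i)" for s
    proof
      assume "g = (\<Sum>i<m. s i * f i)"
      then have "f m = (\<Sum>i<m. (s i + q i) * f i)"
        by (simp add: g_def distrib_right sum.distrib algebra_simps)
      moreover have "\<forall>i<m. poly_over A (s i + q i)" using that q pc(3) by simp
      ultimately show False using f_not[of m "\<lambda>i. s i + q i"] by simp
    qed
    have deg: "degree (f m) \<le> degree g" by (rule f_min[OF \<open>g \<in> J\<close> g_not])
    have "degree (q i * f i) \<le> degree (f m)" if "i < m" for i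
    proof -
      have "degree (q i * f i) \<le> degree (q i) + degree (f i)" by (rule degree_mult_le)
      also have "\<dots> \<le> degree (f m) - degree (f i) + degree (f i)"
        by (simp add: q_def degree_monom_le)
      also have "\<dots> = degree (f m)" using deg_mono[of i m] that by simp
      finally show ?thesis .
    qed
    then have "degree (\<Sum>i<m. q i * f i) \<le> degree (f m)" by (intro degree_sum_le) auto
    moreover have "coeff (\<Sum>i<m. q i * f i) (degree (f m)) = lead_coeff (f m)"
    proof -
      have "coeff (q i * f i) (degree (f m)) = r i * lead_coeff (f i)" if "i < m" for i
        using deg_mono[of i m] that by (simp add: q_def coeff_monom_mult)
      then show ?thesis by (simp add: coeff_sum r(2))
    qed
    ultimately have "degree g \<le> degree (f m)" "coeff g (degree (f m)) = 0"
      unfolding g_def by (auto intro: degree_diff_le)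
    then have "coeff g (degree g) = 0" using deg by (metis le_antisym)
    then have "g = 0" by simp
    moreover have "(0 :: 'a poly) = (\<Sum>i<m. 0 * f i)" by simp
    ultimately show False using g_not[of "\<lambda>_. 0"] pc(1) by simp
  qed
qed

lemma noetherian_constants: "noetherian (range pconst :: ('v, 'k::field) mpoly set)"
  unfolding noetherian_def
proof (intro conjI allI impI)
  show "subring (range pconst :: ('v, 'k) mpoly set)"
    unfolding subring_def by (auto simp: pconst_hom simp flip: pconst_hom(2-5))
  fix a :: "nat \<Rightarrow> ('v, 'k) mpoly" assume "range a \<subseteq> range pconst"
  then have "\<exists>c. a i = pconst c" for i by blast
  then obtain c where c: "\<And>i. a i = pconst (c i)" by metis
  show "\<exists>m r. (\<forall>i<m. r i \<in> range pconst) \<and> a m = (\<Sum>i<m. r i * a i)"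
  proof (cases "c 0 = 0")
    case True
    then show ?thesis by (intro exI[of _ 0]) (simp add: c pconst_hom)
  next
    case False
    then have "a 1 = pconst (c 1 / c 0) * a 0" by (simp add: c flip: pconst_hom(4))
    then show ?thesis by (intro exI[of _ 1] exI[of _ "\<lambda>_. pconst (c 1 / c 0)"]) simp
  qed
qed

lemma mpoly_generated:
  fixes A :: "('v, 'k::field) mpoly set"
  assumes "subring A" "range pconst \<subseteq> A" "\<And>i. pvar i \<in> A"
  shows "P \<in> A"
  by (induction P rule: mpoly_induct) (use assms subringD[OF assms(1)] in auto)

lemma adjoin_variables:
  fixes Q :: "('v::finite, 'k::field) mpoly set \<Rightarrow> bool"
  assumes "Q (range pconst)" "\<And>A i. subring A \<Longrightarrow> Q A \<Longrightarrow> Q (adjoin A (pvar i))"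
  shows "Q UNIV"
proof -
  have "\<exists>A. subring A \<and> range pconst \<subseteq> A \<and> (\<forall>i\<in>I. pvar i \<in> A) \<and> Q A" if "finite I" for I :: "'v set"
    using that
  proof (induction I rule: finite_induct)
    case empty
    then show ?case using assms(1) noetherian_constants by (auto simp: noetherian_def)
  next
    case (insert i I)
    then obtain A where A: "subring A" "range pconst \<subseteq> A" "\<forall>i\<in>I. pvar i \<in> A" "Q A" by blast
    then show ?case
      using subring_adjoin[OF A(1)] subset_adjoin[OF A(1)] in_adjoin[OF A(1)] assms(2)[OF A(1,4), of i]
      by (intro exI[of _ "adjoin A (pvar i)"]) blast
  qed
  from this[OF finite[of UNIV]] obtain A where A: "subring A" "range pconst \<subseteq> A" "\<forall>i. pvar i \<in> A" "Q A"
    by auto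
  then have "A = UNIV" using mpoly_generated[of A] by blast
  then show ?thesis using A(4) by simp
qed

theorem noetherian_mpoly: "noetherian (UNIV :: ('v::finite, 'k::field) mpoly set)"
  by (rule adjoin_variables[OF noetherian_constants noetherian_adjoin])

section \<open>Extending derivations modulo a prime ideal\<close>

text \<open>A derivation modulo an ideal is represented by its graph, a subring of the ring of dual numbers:
  closure under the ring operations encodes the Leibniz rule, and the values are determined
  only modulo the ideal.\<close>

datatype 'r dual = Dual (re: 'r) (ep: 'r)

instantiation dual :: (comm_ring_1) comm_ring_1
begin

definition "0 = Dual 0 0"
definition "1 = Dual 1 0"
definition "a + b = Dual (re a + re b) (ep a + ep b)"
definition "a - b = Dual (re a - re b) (ep a - ep b)"
definition "- a = Dual (- re a) (- ep a)"
definition "a * b = Dual (re a * re b) (re a * ep b + ep a * re b)"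

instance
  by standard (simp_all add: zero_dual_def one_dual_def plus_dual_def minus_dual_def uminus_dual_def
      times_dual_def algebra_simps dual.expand)

end

lemma dual_simps [simp]:
  "re (0 :: 'r::comm_ring_1 dual) = 0" "ep (0 :: 'r dual) = 0"
  "re (1 :: 'r dual) = 1" "ep (1 :: 'r dual) = 0"
  "re (a + b) = re a + re (b :: 'r dual)" "ep (a + b) = ep a + ep b"
  "re (a - b) = re a - re b" "ep (a - b) = ep a - ep b"
  "re (- a) = - re a" "ep (- a) = - ep a"
  "re (a * b) = re a * re b" "ep (a * b) = re a * ep b + ep a * re b"
  by (simp_all add: zero_dual_def one_dual_def plus_dual_def minus_dual_def uminus_dual_def times_dual_def)

lemma dual_of_nat [simp]: "re (of_nat n :: 'r::comm_ring_1 dual) = of_nat n" "ep (of_nat n :: 'r dual) = 0"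
  by (induction n) simp_all

lemma dual_eqI: "re a = re b \<Longrightarrow> ep a = ep b \<Longrightarrow> a = b"
  by (rule dual.expand) simp

text \<open>The formal derivative over a ring with zero divisors, such as the ring of dual numbers.\<close>

definition pder :: "'r::comm_ring_1 poly \<Rightarrow> 'r poly" where
  "pder q = Poly (map (\<lambda>n. of_nat (Suc n) * coeff q (Suc n)) [0..<degree q])"

lemma coeff_pder: "coeff (pder q) n = of_nat (Suc n) * coeff q (Suc n)"
  by (cases "n < degree q") (simp_all add: pder_def nth_default_def coeff_eq_0 del: of_nat_Suc)

lemma pder_simps:
  "pder (p + q) = pder p + pder q" "pder (p - q) = pder p - pder q" "pder (- p) = - pder p"
  "pder (smult c p) = smult c (pder p)" "pder (0 :: 'r::comm_ring_1 poly) = 0"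
  by (rule poly_eqI; simp add: coeff_pder algebra_simps del: of_nat_Suc)+

lemma pder_pCons: "pder (pCons a p) = p + pCons 0 (pder p)"
proof (rule poly_eqI)
  fix n show "coeff (pder (pCons a p)) n = coeff (p + pCons 0 (pder p)) n"
    by (cases n) (simp_all add: coeff_pder algebra_simps)
qed

lemma pder_mult: "pder (p * q) = p * pder q + pder p * q"
proof (induction p)
  case (pCons a p)
  show ?case
    by (simp add: pder_simps pder_pCons pCons.IH algebra_simps)
qed (simp add: pder_simps)

lemma pder_1: "pder 1 = 0"
  by (simp add: one_pCons pder_pCons pder_simps)

lemma degree_pder: "degree p > 0 \<Longrightarrow> degree (pder p) < degree p"
proof -
  assume pos: "degree p > 0"
  have "degree (pder p) \<le> degree p - 1"
    by (rule degree_le) (simp add: coeff_pder coeff_eq_0 del: of_nat_Suc)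
  then show ?thesis using pos by simp
qed

lemma dual_eq_iff: "a = b \<longleftrightarrow> re a = re b \<and> ep a = ep b"
  using dual_eqI by auto

definition prime_ideal :: "'r::comm_ring_1 set \<Rightarrow> bool" where
  "prime_ideal \<pp> \<longleftrightarrow> 0 \<in> \<pp> \<and> 1 \<notin> \<pp> \<and> (\<forall>a\<in>\<pp>. \<forall>b\<in>\<pp>. a + b \<in> \<pp>) \<and> (\<forall>a\<in>\<pp>. \<forall>r. r * a \<in> \<pp>) \<and>
     (\<forall>a b. a * b \<in> \<pp> \<longrightarrow> a \<in> \<pp> \<or> b \<in> \<pp>)"

text \<open>The condition under which a subring of dual numbers induces a well-defined derivation from the
  real parts modulo \<open>\<pp>\<close> to the ambient ring modulo \<open>\<pp>\<close>.\<close>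

definition consistent :: "'r::comm_ring_1 set \<Rightarrow> 'r dual set \<Rightarrow> bool" where
  "consistent \<pp> \<Delta> \<longleftrightarrow> (\<forall>z\<in>\<Delta>. re z \<in> \<pp> \<longrightarrow> ep z \<in> \<pp>)"

context
  fixes \<pp> :: "'r::comm_ring_1 set"
  assumes prime: "prime_ideal \<pp>"
begin

lemma ideal_closed:
  "0 \<in> \<pp>" "a \<in> \<pp> \<Longrightarrow> b \<in> \<pp> \<Longrightarrow> a + b \<in> \<pp>" "a \<in> \<pp> \<Longrightarrow> r * a \<in> \<pp>" "a \<in> \<pp> \<Longrightarrow> a * r \<in> \<pp>"
  "a \<in> \<pp> \<Longrightarrow> - a \<in> \<pp>" "a \<in> \<pp> \<Longrightarrow> b \<in> \<pp> \<Longrightarrow> a - b \<in> \<pp>"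
proof -
  show 1: "0 \<in> \<pp>" "a \<in> \<pp> \<Longrightarrow> b \<in> \<pp> \<Longrightarrow> a + b \<in> \<pp>" "a \<in> \<pp> \<Longrightarrow> r * a \<in> \<pp>" for a b r
    using prime unfolding prime_ideal_def by simp_all
  show "a \<in> \<pp> \<Longrightarrow> a * r \<in> \<pp>" using 1(3)[of a r] by (simp add: mult.commute)
  show 2: "a \<in> \<pp> \<Longrightarrow> - a \<in> \<pp>" for a using 1(3)[of a "- 1"] by simp
  show "a \<in> \<pp> \<Longrightarrow> b \<in> \<pp> \<Longrightarrow> a - b \<in> \<pp>" using 1(2)[of a "- b"] 2[of b] by simp
qed

lemma prime_mult: "a * b \<in> \<pp> \<Longrightarrow> a \<notin> \<pp> \<Longrightarrow> b \<in> \<pp>"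
  using prime unfolding prime_ideal_def by blast

lemma poly_in_ideal:
  assumes "\<And>n. re (coeff q n) \<in> \<pp>" "\<And>n. ep (coeff q n) \<in> \<pp>"
  shows "re (poly q z) \<in> \<pp> \<and> ep (poly q z) \<in> \<pp>"
  using assms
proof (induction q)
  case (pCons a q)
  have "re (coeff q n) \<in> \<pp>" "ep (coeff q n) \<in> \<pp>" for n
    using pCons(3)[of "Suc n"] pCons(4)[of "Suc n"] by simp_all
  then have IH: "re (poly q z) \<in> \<pp> \<and> ep (poly q z) \<in> \<pp>" by (rule pCons(2))
  have "re a \<in> \<pp>" "ep a \<in> \<pp>" using pCons(3)[of 0] pCons(4)[of 0] by simp_all
  then show ?case using IH by (simp add: ideal_closed)
qed (simp add: ideal_closed)

text \<open>The value at \<open>q(x)\<close> of the extension that multiplies the given derivation by \<open>u\<close> and sends \<open>x\<close>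
  to \<open>v\<close>.\<close>

definition twist :: "'r \<Rightarrow> 'r \<Rightarrow> 'r \<Rightarrow> 'r dual poly \<Rightarrow> 'r dual" where
  "twist x u v q = Dual (re (poly q (Dual x 0)))
     (u * ep (poly q (Dual x 0)) + v * re (poly (pder q) (Dual x 0)))"

lemma twist_simps:
  "re (twist x u v q) = re (poly q (Dual x 0))"
  "twist x u v (p + q) = twist x u v p + twist x u v q"
  "twist x u v (p - q) = twist x u v p - twist x u v q"
  "twist x u v (- q) = - twist x u v q"
  "twist x u v (p * q) = twist x u v p * twist x u v q"
  "twist x u v [:a:] = Dual (re a) (u * ep a)"
  "twist x u v [:0, 1:] = Dual x v"
  "twist x u v 1 = 1"
  by (simp_all add: dual_eq_iff twist_def pder_simps pder_mult pder_1 algebra_simps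
        pder_pCons)

lemma subring_twist:
  assumes "subring \<Delta>"
  shows "subring (twist x u v ` {q. poly_over \<Delta> q})"
  unfolding subring_def
proof (intro conjI ballI)
  note pc = poly_over_closed[OF assms]
  have "poly_over \<Delta> 1" using pc(2)[OF subringD(1)[OF assms], of 0] by (simp add: monom_0 one_pCons)
  then show "1 \<in> twist x u v ` {q. poly_over \<Delta> q}"
    by (intro image_eqI[of _ _ 1]) (simp_all add: twist_simps)
  fix a b assume "a \<in> twist x u v ` {q. poly_over \<Delta> q}" "b \<in> twist x u v ` {q. poly_over \<Delta> q}"
  then obtain p q where pq: "a = twist x u v p" "b = twist x u v q" "poly_over \<Delta> p" "poly_over \<Delta> q"
    by auto
  show "a + b \<in> twist x u v ` {q. poly_over \<Delta> q}"
    by (rule image_eqI[of _ _ "p + q"]) (simp_all add: pq twist_simps pc)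
  show "a * b \<in> twist x u v ` {q. poly_over \<Delta> q}"
    by (rule image_eqI[of _ _ "p * q"]) (simp_all add: pq twist_simps pc)
  show "- a \<in> twist x u v ` {q. poly_over \<Delta> q}"
    by (rule image_eqI[of _ _ "- p"]) (simp_all add: pq twist_simps pc)
qed

lemma twist_mem:
  assumes "subring \<Delta>"
  shows "w \<in> \<Delta> \<Longrightarrow> Dual (re w) (u * ep w) \<in> twist x u v ` {q. poly_over \<Delta> q}"
    "Dual x v \<in> twist x u v ` {q. poly_over \<Delta> q}"
proof -
  note pc = poly_over_closed[OF assms]
  show "Dual (re w) (u * ep w) \<in> twist x u v ` {q. poly_over \<Delta> q}" if "w \<in> \<Delta>"
    using pc(2)[OF that, of 0]
    by (intro image_eqI[of _ _ "[:w:]"]) (simp_all add: twist_simps monom_0)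
  have "[:0, 1:] = monom (1 :: 'r dual) 1" by (simp add: monom_altdef)
  then have "poly_over \<Delta> [:0, 1:]" using pc(2)[OF subringD(1)[OF assms], of 1] by metis
  then show "Dual x v \<in> twist x u v ` {q. poly_over \<Delta> q}"
    by (intro image_eqI[of _ _ "[:0, 1:]"]) (simp_all add: twist_simps)
qed

lemma twist_in_ideal:
  assumes "\<And>n. re (coeff q n) \<in> \<pp>" "\<And>n. ep (coeff q n) \<in> \<pp>"
  shows "ep (twist x u v q) \<in> \<pp>"
proof -
  have "re (coeff (pder q) n) \<in> \<pp>" "ep (coeff (pder q) n) \<in> \<pp>" for n
    using assms[of "Suc n"] by (simp_all add: coeff_pder ideal_closed del: of_nat_Suc)
  then show ?thesis
    using poly_in_ideal[OF assms, of "Dual x 0"] poly_in_ideal[of "pder q" "Dual x 0"]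
    by (simp add: twist_def ideal_closed)
qed

text \<open>Over an element that is transcendental modulo the ideal every value \<open>v\<close> is possible, because a
  polynomial whose value at \<open>x\<close> lies in the ideal has all its coefficients in the ideal.\<close>

lemma extend_transcendental:
  assumes \<Delta>: "subring \<Delta>" "consistent \<pp> \<Delta>"
    and trans: "\<And>q n. poly_over \<Delta> q \<Longrightarrow> re (poly q (Dual x 0)) \<in> \<pp> \<Longrightarrow> re (coeff q n) \<in> \<pp>"
  shows "\<exists>\<Delta>'. subring \<Delta>' \<and> consistent \<pp> \<Delta>' \<and> \<Delta> \<subseteq> \<Delta>' \<and> Dual x v \<in> \<Delta>'"
proof (intro exI conjI)
  let ?\<Delta>' = "twist x 1 v ` {q. poly_over \<Delta> q}"
  show "subring ?\<Delta>'" by (rule subring_twist[OF \<Delta>(1)])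
  show "consistent \<pp> ?\<Delta>'"
    unfolding consistent_def
  proof (intro ballI impI)
    fix z assume "z \<in> ?\<Delta>'" "re z \<in> \<pp>"
    then obtain q where q: "z = twist x 1 v q" "poly_over \<Delta> q" "re (poly q (Dual x 0)) \<in> \<pp>"
      by (auto simp: twist_simps)
    have "re (coeff q n) \<in> \<pp>" for n by (rule trans[OF q(2,3)])
    moreover from this have "ep (coeff q n) \<in> \<pp>" for n
      using \<Delta>(2) q(2) by (simp add: consistent_def poly_over_def)
    ultimately show "ep z \<in> \<pp>" unfolding q(1) by (rule twist_in_ideal)
  qed
  show "\<Delta> \<subseteq> ?\<Delta>'"
  proof
    fix w assume "w \<in> \<Delta>"
    from twist_mem(1)[OF \<Delta>(1) this, of 1 x v] show "w \<in> ?\<Delta>'" by simp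
  qed
  show "Dual x v \<in> ?\<Delta>'" by (rule twist_mem(2)[OF \<Delta>(1)])
qed

text \<open>Over an algebraic element with minimal equation \<open>f\<close> the value at \<open>x\<close> is forced to be
  \<open>- f\<^sup>\<delta>(x) / f'(x)\<close>, where \<open>f\<^sup>\<delta>\<close> has the derivatives of the coefficients of \<open>f\<close>; the denominator is
  cleared by scaling the derivation. Over a transcendental element the value 0 is chosen.\<close>

lemma extend_derivation:
  assumes \<Delta>: "subring \<Delta>" "consistent \<pp> \<Delta>" and char: "\<And>n. n > 0 \<Longrightarrow> of_nat n \<notin> \<pp>"
  shows "\<exists>u v \<Delta>'. u \<notin> \<pp> \<and> subring \<Delta>' \<and> consistent \<pp> \<Delta>' \<and>
    (\<forall>w\<in>\<Delta>. Dual (re w) (u * ep w) \<in> \<Delta>') \<and> Dual x v \<in> \<Delta>'"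
proof (cases "\<forall>q n. poly_over \<Delta> q \<longrightarrow> re (poly q (Dual x 0)) \<in> \<pp> \<longrightarrow> re (coeff q n) \<in> \<pp>")
  case True
  then have "\<exists>\<Delta>'. subring \<Delta>' \<and> consistent \<pp> \<Delta>' \<and> \<Delta> \<subseteq> \<Delta>' \<and> Dual x 0 \<in> \<Delta>'"
    by (intro extend_transcendental[OF \<Delta>]) simp
  then obtain \<Delta>' where \<Delta>': "subring \<Delta>' \<and> consistent \<pp> \<Delta>' \<and> \<Delta> \<subseteq> \<Delta>' \<and> Dual x 0 \<in> \<Delta>'" ..
  have "1 \<notin> \<pp>" using prime by (simp add: prime_ideal_def)
  moreover have "\<forall>w\<in>\<Delta>. Dual (re w) (1 * ep w) \<in> \<Delta>'" using \<Delta>' by auto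
  ultimately show ?thesis using \<Delta>' by (intro exI[of _ 1] exI[of _ 0] exI[of _ \<Delta>']) simp
next
  case False
  define S where "S q \<longleftrightarrow> poly_over \<Delta> q \<and> re (poly q (Dual x 0)) \<in> \<pp> \<and> (\<exists>n. re (coeff q n) \<notin> \<pp>)" for q
  note pc = poly_over_closed[OF \<Delta>(1)]
  have smult: "poly_over \<Delta> (smult a p)" if "a \<in> \<Delta>" "poly_over \<Delta> p" for a p
    using that subringD(4)[OF \<Delta>(1)] by (simp add: poly_over_def)
  obtain q0 where "S q0" using False by (auto simp: S_def)
  \<comment> \<open>a relation for \<open>x\<close> of least degree that is nontrivial modulo the ideal\<close>
  define f where "f = (ARG_MIN degree q. S q)"
  have f: "S f" "\<And>q. S q \<Longrightarrow> degree f \<le> degree q"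
    using arg_min_natI[of S q0 degree, OF \<open>S q0\<close>] arg_min_nat_le[of S _ degree] by (simp_all add: f_def)
  have fo: "poly_over \<Delta> f" and fx: "re (poly f (Dual x 0)) \<in> \<pp>" using f(1) by (simp_all add: S_def)
  have drop: "degree g < n" if "degree g \<le> n" "coeff g n = 0" "n > 0" for g :: "'r dual poly" and n
    using that by (metis degree_0 le_neq_implies_less leading_coeff_0_iff)
  have lc: "re (lead_coeff f) \<notin> \<pp>"
  proof
    assume lc: "re (lead_coeff f) \<in> \<pp>"
    obtain n where n: "re (coeff f n) \<notin> \<pp>" using f(1) by (auto simp: S_def)
    then have "n \<noteq> degree f" using lc by auto
    have "n \<le> degree f"
      using n ideal_closed(1) le_degree[of f n] by (cases "coeff f n = 0") simp_all
    then have pos: "degree f > 0" using \<open>n \<noteq> degree f\<close> by simp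
    let ?g = "f - monom (lead_coeff f) (degree f)"
    have "degree ?g < degree f"
      by (rule drop[OF _ _ pos]) (simp_all add: degree_diff_le degree_monom_le)
    moreover have "S ?g"
      unfolding S_def
    proof (intro conjI exI[of _ n])
      have "lead_coeff f \<in> \<Delta>" using fo by (simp add: poly_over_def)
      then show "poly_over \<Delta> ?g" using fo by (intro pc)
      show "re (poly ?g (Dual x 0)) \<in> \<pp>"
        using fx lc by (simp add: poly_monom ideal_closed)
      show "re (coeff ?g n) \<notin> \<pp>" using n \<open>n \<noteq> degree f\<close> by simp
    qed
    ultimately show False using f(2)[of ?g] by simp
  qed
  have pos: "degree f > 0"
  proof (rule ccontr)
    assume "\<not> degree f > 0"
    then obtain a where "f = [:a:]" using degree_eq_zeroE[of f] by auto
    then show False using fx lc by simp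
  qed
  \<comment> \<open>By minimality of the degree \<open>f'(x)\<close> does not lie in the ideal; this uses characteristic zero.\<close>
  define u where "u = re (poly (pder f) (Dual x 0))"
  define v where "v = - ep (poly f (Dual x 0))"
  have u: "u \<notin> \<pp>"
  proof
    assume "u \<in> \<pp>"
    have "S (pder f)"
      unfolding S_def
    proof (intro conjI exI[of _ "degree f - 1"])
      have "of_nat n \<in> \<Delta>" for n by (induction n) (simp_all add: subringD[OF \<Delta>(1)])
      then show "poly_over \<Delta> (pder f)"
        using fo subringD(4)[OF \<Delta>(1)] by (simp add: poly_over_def coeff_pder del: of_nat_Suc)
      show "re (poly (pder f) (Dual x 0)) \<in> \<pp>" using \<open>u \<in> \<pp>\<close> by (simp add: u_def)
      show "re (coeff (pder f) (degree f - 1)) \<notin> \<pp>"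
        using pos lc prime_mult[OF _ char[OF pos], of "re (lead_coeff f)"]
        by (auto simp: coeff_pder simp del: of_nat_Suc)
    qed
    moreover have "degree (pder f) < degree f"
      using degree_pder[of f] pos by simp
    ultimately show False using f(2)[of "pder f"] by simp
  qed
  have tf: "ep (twist x u v f) = 0" by (simp add: twist_def u_def v_def mult.commute)
  \<comment> \<open>Pseudo-division by \<open>f\<close> reduces every relation to a trivial one.\<close>
  have key: "ep (twist x u v q) \<in> \<pp>" if "poly_over \<Delta> q" "re (poly q (Dual x 0)) \<in> \<pp>" for q
    using that
  proof (induction "degree q" arbitrary: q rule: less_induct)
    case less
    show ?case
    proof (cases "\<forall>n. re (coeff q n) \<in> \<pp>")
      case True
      moreover have "ep (coeff q n) \<in> \<pp>" for n
        using \<Delta>(2) less(2) True by (simp add: consistent_def poly_over_def)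
      ultimately show ?thesis by (intro twist_in_ideal) simp_all
    next
      case False
      then have "S q" using less(2,3) by (simp add: S_def)
      then have deg: "degree f \<le> degree q" by (rule f(2))
      let ?c = "lead_coeff f" and ?m = "monom (lead_coeff q) (degree q - degree f)"
      let ?g = "[:?c:] * q - ?m * f"
      have cd: "?c \<in> \<Delta>" "lead_coeff q \<in> \<Delta>" using fo less(2) by (simp_all add: poly_over_def)
      have go: "poly_over \<Delta> ?g"
        using smult[OF cd(1) less(2)] pc(5)[OF pc(2)[OF cd(2)] fo] pc(4) by simp
      have gx: "re (poly ?g (Dual x 0)) \<in> \<pp>" using less(3) fx by (simp add: ideal_closed)
      have "degree ?g < degree q"
      proof (rule drop)
        have "degree (?m * f) \<le> degree ?m + degree f" by (rule degree_mult_le)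
        also have "\<dots> \<le> degree q - degree f + degree f" by (simp add: degree_monom_le)
        finally have "degree (?m * f) \<le> degree q" using deg by simp
        then show "degree ?g \<le> degree q"
          by (intro degree_diff_le) (simp_all add: degree_smult_le)
        show "coeff ?g (degree q) = 0" using deg by (simp add: coeff_monom_mult)
        show "degree q > 0" using pos deg by simp
      qed
      then have "ep (twist x u v ?g) \<in> \<pp>" using go gx by (rule less(1))
      moreover have "ep (twist x u v ?g) = re ?c * ep (twist x u v q)
          + u * ep ?c * re (poly q (Dual x 0)) - ep (twist x u v ?m) * re (poly f (Dual x 0))"
        unfolding twist_simps(3,5) using tf by (simp add: twist_simps(1,6))
      ultimately have X: "re ?c * ep (twist x u v q)
          + u * ep ?c * re (poly q (Dual x 0)) - ep (twist x u v ?m) * re (poly f (Dual x 0)) \<in> \<pp>" by simp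
      have A: "u * ep ?c * re (poly q (Dual x 0)) \<in> \<pp>" by (rule ideal_closed(3)[OF less(3)])
      have B: "ep (twist x u v ?m) * re (poly f (Dual x 0)) \<in> \<pp>" by (rule ideal_closed(3)[OF fx])
      have "a \<in> \<pp>" if "a + b - c \<in> \<pp>" "b \<in> \<pp>" "c \<in> \<pp>" for a b c
        using ideal_closed(6)[OF ideal_closed(2)[OF that(1,3)] that(2)] by simp
      from this[OF X A B] have "re ?c * ep (twist x u v q) \<in> \<pp>" .
      then show ?thesis using lc by (rule prime_mult)
    qed
  qed
  let ?\<Delta>' = "twist x u v ` {q. poly_over \<Delta> q}"
  have "consistent \<pp> ?\<Delta>'"
    unfolding consistent_def using key by (auto simp: twist_simps)
  then show ?thesis
    using u subring_twist[OF \<Delta>(1)] twist_mem[OF \<Delta>(1)]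
    by (intro exI[of _ u] exI[of _ v] exI[of _ ?\<Delta>']) simp
qed

end

text \<open>Adjoining the finitely many variables one after the other extends the derivation to the whole
  polynomial ring, up to a common denominator \<open>u\<close>; there it is a vector field, and consistency
  says that the field preserves the ideal.\<close>

lemma derivation_to_vector_field:
  fixes \<pp> :: "('v::finite, 'k::field) mpoly set"
  assumes prime: "prime_ideal \<pp>" and char: "\<And>n. n > 0 \<Longrightarrow> of_nat n \<notin> \<pp>"
    and \<Delta>: "subring \<Delta>" "consistent \<pp> \<Delta>" and const: "\<And>c. Dual (pconst c) 0 \<in> \<Delta>"
  obtains u V where "u \<notin> \<pp>" "\<And>P. P \<in> \<pp> \<Longrightarrow> (\<Sum>i\<in>UNIV. V i * ppartial i P) \<in> \<pp>"
    "\<And>w. w \<in> \<Delta> \<Longrightarrow> u * ep w - (\<Sum>i\<in>UNIV. V i * ppartial i (re w)) \<in> \<pp>"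
proof -
  define good where "good I u \<Delta>' \<longleftrightarrow> u \<notin> \<pp> \<and> subring \<Delta>' \<and> consistent \<pp> \<Delta>' \<and>
      (\<forall>w\<in>\<Delta>. Dual (re w) (u * ep w) \<in> \<Delta>') \<and> (\<forall>i\<in>I. \<exists>v. Dual (pvar i) v \<in> \<Delta>')" for I u \<Delta>'
  have "\<exists>u \<Delta>'. good I u \<Delta>'" if "finite I" for I :: "'v set"
    using that
  proof (induction I rule: finite_induct)
    case empty
    have "good {} 1 \<Delta>" using \<Delta> prime by (simp add: good_def prime_ideal_def)
    then show ?case by (intro exI)
  next
    case (insert i I)
    then obtain u \<Delta>1 where 1: "good I u \<Delta>1" by (elim exE)
    have "\<exists>u' v \<Delta>2. u' \<notin> \<pp> \<and> subring \<Delta>2 \<and> consistent \<pp> \<Delta>2 \<and>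
        (\<forall>w\<in>\<Delta>1. Dual (re w) (u' * ep w) \<in> \<Delta>2) \<and> Dual (pvar i) v \<in> \<Delta>2"
      using 1 by (intro extend_derivation[OF prime _ _ char]) (simp_all add: good_def)
    then obtain u' v \<Delta>2 where 2: "u' \<notin> \<pp>" "subring \<Delta>2" "consistent \<pp> \<Delta>2"
        "\<And>w. w \<in> \<Delta>1 \<Longrightarrow> Dual (re w) (u' * ep w) \<in> \<Delta>2" "Dual (pvar i) v \<in> \<Delta>2" by (elim exE conjE) simp
    have "good (insert i I) (u' * u) \<Delta>2"
      unfolding good_def
    proof (intro conjI ballI)
      show "u' * u \<notin> \<pp>" using prime_mult[OF prime, of u' u] 2(1) 1 by (auto simp: good_def)
      show "Dual (re w) (u' * u * ep w) \<in> \<Delta>2" if "w \<in> \<Delta>" for w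
        using 2(4)[of "Dual (re w) (u * ep w)"] 1 that by (simp add: good_def mult.assoc)
      show "\<exists>v. Dual (pvar j) v \<in> \<Delta>2" if "j \<in> insert i I" for j
      proof (cases "j = i")
        case False
        then have "\<exists>v. Dual (pvar j) v \<in> \<Delta>1" using 1 that by (simp add: good_def)
        then obtain v where "Dual (pvar j) v \<in> \<Delta>1" ..
        from 2(4)[OF this] show ?thesis by (intro exI) simp
      qed (use 2(5) in auto)
    qed (rule 2(2), rule 2(3))
    then show ?case by (intro exI)
  qed
  from this[OF finite[of UNIV]] obtain u \<Delta>' where g: "good UNIV u \<Delta>'" by (elim exE)
  have "\<forall>i. \<exists>v. Dual (pvar i) v \<in> \<Delta>'" using g by (simp add: good_def)
  from choice[OF this] obtain V where V: "\<forall>i. Dual (pvar i) (V i) \<in> \<Delta>'" ..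
  have sub: "subring \<Delta>'" and con: "consistent \<pp> \<Delta>'" using g by (simp_all add: good_def)
  let ?d = "\<lambda>P. \<Sum>i\<in>UNIV. V i * ppartial i P"
  have all: "Dual P (?d P) \<in> \<Delta>'" for P
  proof (induction P rule: mpoly_induct)
    case (const c)
    have "\<forall>w\<in>\<Delta>. Dual (re w) (u * ep w) \<in> \<Delta>'" using g by (simp add: good_def)
    from bspec[OF this assms(5)[of c]] show ?case by simp
  next
    case (var i)
    have "V j * ppartial j (pvar i) = (if j = i then V j else 0)" for j by (simp add: ppartial_pvar)
    then show ?case using V by simp
  next
    case (add A B)
    from subringD(3)[OF sub this] show ?case
      by (simp add: plus_dual_def ppartial_add distrib_left sum.distrib)
  next
    case (mult A B)
    from subringD(4)[OF sub this] show ?case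
      by (simp add: times_dual_def ppartial_mult distrib_left sum.distrib sum_distrib_left sum_distrib_right
          mult_ac add.commute)
  qed
  show thesis
  proof (rule that[of u V])
    show "u \<notin> \<pp>" using g by (simp add: good_def)
    show "?d P \<in> \<pp>" if "P \<in> \<pp>" for P
      using con[unfolded consistent_def, rule_format, OF all[of P]] that by simp
    show "u * ep w - ?d (re w) \<in> \<pp>" if "w \<in> \<Delta>" for w
    proof -
      have "Dual (re w) (u * ep w) \<in> \<Delta>'" using g that by (simp add: good_def)
      from subringD(6)[OF sub this all[of "re w"]] have "Dual 0 (u * ep w - ?d (re w)) \<in> \<Delta>'"
        by (simp add: minus_dual_def)
      from con[unfolded consistent_def, rule_format, OF this] show ?thesis
        using prime by (simp add: prime_ideal_def)
    qed
  qed
qed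

section \<open>Decomposition into irreducible closed sets\<close>

lemma closed_sets_wf:
  "wf {(F', F :: ('k::field^'v::finite) set). closedin zariski F' \<and> closedin zariski F \<and> F' \<subset> F}"
  unfolding wf_iff_no_infinite_down_chain
proof (intro notI, elim exE)
  fix f assume "\<forall>i. (f (Suc i), f i) \<in>
    {(F', F :: ('k^'v) set). closedin zariski F' \<and> closedin zariski F \<and> F' \<subset> F}"
  then have f: "closedin zariski (f i)" "f (Suc i) \<subset> f i" for i by auto
  have "\<exists>Px. fst Px \<in> vanishing_ideal (f (Suc i)) \<and> snd Px \<in> f i \<and> pval (fst Px) (snd Px) \<noteq> 0" for i
  proof -
    obtain x where x: "x \<in> f i" "x \<notin> f (Suc i)" using f(2)[of i] by auto
    obtain P where "P \<in> vanishing_ideal (f (Suc i))" "pval P x \<noteq> 0"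
      by (rule closedin_zariski_separate[OF f(1) x(2)])
    with x(1) show ?thesis by (intro exI[of _ "(P, x)"]) simp
  qed
  then have "\<forall>i. \<exists>Px. fst Px \<in> vanishing_ideal (f (Suc i)) \<and> snd Px \<in> f i \<and> pval (fst Px) (snd Px) \<noteq> 0"
    by simp
  from choice[OF this] obtain Px where Px: "\<forall>i. fst (Px i) \<in> vanishing_ideal (f (Suc i)) \<and>
     snd (Px i) \<in> f i \<and> pval (fst (Px i)) (snd (Px i)) \<noteq> 0" ..
  have anti: "f j \<subseteq> f i" if "i \<le> j" for i j
    by (rule lift_Suc_antimono_le[OF _ that]) (use f(2) in auto)
  have "range (\<lambda>i. fst (Px i)) \<subseteq> UNIV" by simp
  \<comment> \<open>\<open>P\<^sub>m\<close> is a combination of earlier \<open>P\<^sub>i\<close>, which vanish at the point where \<open>P\<^sub>m\<close> does not.\<close>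
  from noetherianD[OF noetherian_mpoly this] obtain m r where
    r: "fst (Px m) = (\<Sum>i<m. r i * fst (Px i))" by metis
  have "pval (fst (Px i)) (snd (Px m)) = 0" if "i < m" for i
  proof -
    have "snd (Px m) \<in> f (Suc i)" using Px anti[of "Suc i" m] that by (simp add: subset_iff)
    then show ?thesis using Px by (intro vanishing_idealD[of _ "f (Suc i)"]) simp_all
  qed
  then have "pval (fst (Px m)) (snd (Px m)) = 0" unfolding r by simp
  then show False using Px by simp
qed

lemma irreducible_decomposition:
  fixes F :: "('k::field^'v::finite) set"
  assumes "closedin zariski F"
  shows "\<exists>\<F>. finite \<F> \<and> F = \<Union>\<F> \<and> (\<forall>C\<in>\<F>. closedin zariski C \<and> zariski_irreducible C)"
  using assms
proof (induction F rule: wf_induct_rule[OF closed_sets_wf])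
  case (1 F)
  show ?case
  proof (cases "zariski_irreducible F \<or> F = {}")
    case True
    then show ?thesis
    proof
      assume "zariski_irreducible F"
      then show ?thesis using 1(2) by (intro exI[of _ "{F}"]) simp
    qed (intro exI[of _ "{}"], simp)
  next
    case False
    then obtain F1 F2 where F: "closedin zariski F1" "closedin zariski F2" "F \<subseteq> F1 \<union> F2"
      "\<not> F \<subseteq> F1" "\<not> F \<subseteq> F2" unfolding zariski_irreducible_def by blast
    have "closedin zariski (F \<inter> F1)" "closedin zariski (F \<inter> F2)" "F \<inter> F1 \<subset> F" "F \<inter> F2 \<subset> F"
      using 1(2) F by (auto intro: closedin_Int)
    then have "\<exists>\<F>. finite \<F> \<and> F \<inter> F1 = \<Union>\<F> \<and> (\<forall>C\<in>\<F>. closedin zariski C \<and> zariski_irreducible C)"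
      "\<exists>\<F>. finite \<F> \<and> F \<inter> F2 = \<Union>\<F> \<and> (\<forall>C\<in>\<F>. closedin zariski C \<and> zariski_irreducible C)"
      using 1(1)[of "F \<inter> F1"] 1(1)[of "F \<inter> F2"] 1(2) by simp_all
    then obtain \<F>1 \<F>2 where
      "finite \<F>1 \<and> F \<inter> F1 = \<Union>\<F>1 \<and> (\<forall>C\<in>\<F>1. closedin zariski C \<and> zariski_irreducible C)"
      "finite \<F>2 \<and> F \<inter> F2 = \<Union>\<F>2 \<and> (\<forall>C\<in>\<F>2. closedin zariski C \<and> zariski_irreducible C)"
      by (elim exE)
    moreover have "F = (F \<inter> F1) \<union> (F \<inter> F2)" using F(3) by blast
    ultimately show ?thesis by (intro exI[of _ "\<F>1 \<union> \<F>2"]) auto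
  qed
qed

section \<open>Tangent spaces of irreducible sets\<close>

lemma zariski_tangent_eq_ann: "zariski_tangent S x = ann ((\<lambda>P. pdiff P x) ` vanishing_ideal S)"
  by (auto simp: zariski_tangent_def ann_def)

lemma subspace_tangent: "vec.subspace (zariski_tangent S x)"
  unfolding zariski_tangent_eq_ann by (rule subspace_ann)

lemma tangent_mono: "vanishing_ideal T \<subseteq> vanishing_ideal S \<Longrightarrow> zariski_tangent S x \<subseteq> zariski_tangent T x"
  by (auto simp: zariski_tangent_def)

lemma prime_ideal_vanishing:
  assumes "zariski_irreducible C"
  shows "prime_ideal (vanishing_ideal C)"
proof -
  obtain x where "x \<in> C" using assms by (auto simp: zariski_irreducible_def)
  then have "1 \<notin> vanishing_ideal C" using vanishing_idealD[of 1 C x] by auto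
  then show ?thesis
    using assms unfolding prime_ideal_def irreducible_iff_prime by (simp add: vanishing_ideal_closed)
qed

lemma pval_of_nat [simp]: "pval (of_nat n) x = of_nat n"
  by (induction n) simp_all

definition coordinate_projection :: "'v set \<Rightarrow> 'k::field^'v::finite \<Rightarrow> 'k^'v" where
  "coordinate_projection J t = (\<chi> i. if i \<in> J then t $ i else 0)"

lemma linear_coordinate_projection: "Vector_Spaces.linear (*s) (*s) (coordinate_projection J)"
  by unfold_locales (simp_all add: coordinate_projection_def vec_eq_iff)

lemma dim_image_coordinate_projection:
  fixes T :: "('k::field^'v::finite) set"
  assumes T: "vec.subspace T" and inj: "\<And>t. t \<in> T \<Longrightarrow> (\<And>j. j \<in> J \<Longrightarrow> t $ j = 0) \<Longrightarrow> t = 0"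
  shows "vec.dim (coordinate_projection J ` T) = vec.dim T"
proof -
  have "inj_on (coordinate_projection J) (vec.span T)"
    unfolding vec.span_eq_iff[THEN iffD2, OF T]
  proof (rule inj_onI)
    fix s t assume st: "s \<in> T" "t \<in> T" "coordinate_projection J s = coordinate_projection J t"
    have "s - t = 0"
    proof (rule inj)
      show "s - t \<in> T" using T st(1,2) by (rule vec.subspace_diff)
      fix j assume "j \<in> J"
      moreover have "coordinate_projection J s $ j = coordinate_projection J t $ j" using st(3) by simp
      ultimately show "(s - t) $ j = 0" by (simp add: coordinate_projection_def)
    qed
    then show "s = t" by simp
  qed
  then show ?thesis by (rule vec.dim_image_eq[OF linear_coordinate_projection])
qed

lemma dim_le_coordinates:
  fixes T :: "('k::field^'v::finite) set"
  assumes "vec.subspace T" "\<And>t. t \<in> T \<Longrightarrow> (\<And>j. j \<in> J \<Longrightarrow> t $ j = 0) \<Longrightarrow> t = 0"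
  shows "vec.dim T \<le> card J"
proof -
  have "coordinate_projection J ` T \<subseteq> {x. \<forall>i. i \<notin> J \<longrightarrow> x $ i = 0}"
    by (auto simp: coordinate_projection_def)
  then have "vec.dim (coordinate_projection J ` T) \<le> vec.dim {x :: 'k^'v. \<forall>i. i \<notin> J \<longrightarrow> x $ i = 0}"
    by (rule vec.dim_subset)
  then show ?thesis using dim_image_coordinate_projection[OF assms] by (simp add: dim_substandard_cart)
qed

lemma coordinates_surjective:
  fixes T :: "('k::field^'v::finite) set"
  assumes "vec.subspace T" "\<And>t. t \<in> T \<Longrightarrow> (\<And>j. j \<in> J \<Longrightarrow> t $ j = 0) \<Longrightarrow> t = 0" "vec.dim T = card J"
  obtains t where "t \<in> T" "\<And>j. j \<in> J \<Longrightarrow> t $ j = s j"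
proof -
  have "coordinate_projection J ` T = {x. \<forall>i. i \<notin> J \<longrightarrow> x $ i = 0}"
  proof (rule vec.subspace_dim_equal)
    show "vec.subspace (coordinate_projection J ` T)"
      by (rule vec.linear_subspace_image[OF linear_coordinate_projection assms(1)])
    show "vec.subspace {x :: 'k^'v. \<forall>i. i \<notin> J \<longrightarrow> x $ i = 0}" by (simp add: vec.subspace_def)
    show "coordinate_projection J ` T \<subseteq> {x. \<forall>i. i \<notin> J \<longrightarrow> x $ i = 0}"
      by (auto simp: coordinate_projection_def)
  qed (simp add: dim_image_coordinate_projection[OF assms(1,2)] dim_substandard_cart assms(3))
  moreover have "(\<chi> i. if i \<in> J then s i else 0) \<in> {x. \<forall>i. i \<notin> J \<longrightarrow> x $ i = 0}" by simp
  ultimately obtain t where t: "t \<in> T" "(\<chi> i. if i \<in> J then s i else 0) = coordinate_projection J t"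
    by (metis (no_types, lifting) imageE)
  have "t $ j = s j" if "j \<in> J" for j
    using arg_cong[OF t(2), of "\<lambda>x. x $ j"] that by (simp add: coordinate_projection_def)
  with t(1) show thesis by (rule that)
qed

text \<open>Coordinates that are injective on the tangent space at one point remain so on a neighbourhood:
  some maximal minor of the equations does not vanish there.\<close>

lemma tangent_coordinates_nearby:
  fixes S :: "('k::field^'v::finite) set"
  assumes inj: "\<And>t. t \<in> zariski_tangent S y0 \<Longrightarrow> (\<And>j. j \<in> J \<Longrightarrow> t $ j = 0) \<Longrightarrow> t = 0"
  obtains H where "pval H y0 \<noteq> 0" "\<And>y t. pval H y \<noteq> 0 \<Longrightarrow> t \<in> zariski_tangent S y \<Longrightarrow>
    (\<And>j. j \<in> J \<Longrightarrow> t $ j = 0) \<Longrightarrow> t = 0"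
proof -
  define W where "W = (\<lambda>P. pdiff P y0) ` vanishing_ideal S \<union> (\<lambda>j. axis j 1) ` J"
  have "ann W = {0}"
  proof (intro equalityI subsetI)
    fix t assume t: "t \<in> ann W"
    have "t \<in> zariski_tangent S y0" using t by (auto simp: zariski_tangent_eq_ann ann_def W_def)
    moreover have "t $ j = 0" if "j \<in> J" for j
    proof -
      have "axis j 1 \<in> W" using that by (simp add: W_def)
      then have "pairing (axis j 1) t = 0" using t unfolding ann_def by blast
      then show ?thesis by simp
    qed
    ultimately show "t \<in> {0}" using inj by simp
  qed (simp add: ann_def)
  then have span: "vec.span W = UNIV" using ann_ann[of W] by (simp add: ann_def)
  obtain B where B: "B \<subseteq> W" "vec.independent B" "W \<subseteq> vec.span B" "card B = vec.dim W"
    by (rule vec.basis_exists)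
  have spanB: "vec.span B = UNIV"
    using vec.span_minimal[OF B(3) vec.subspace_span] span by (simp add: top.extremum_unique)
  have "card B = CARD('v)"
    using vec.basis_card_eq_dim[of B UNIV] B(2) spanB by (simp add: vec_dim_card card_cart_basis)
  then obtain e where e: "bij_betw e (UNIV :: 'v set) B"
    using finite_same_card_bij[of "UNIV :: 'v set" B] vec.finiteI_independent[OF B(2)] by auto
  \<comment> \<open>The covectors of a basis at \<open>y0\<close> are extended to polynomial families \<open>r\<close> of covectors, so that
    their independence is the nonvanishing of a polynomial determinant.\<close>
  define ok where "ok r \<longleftrightarrow> (\<forall>k. polyfun coord (\<lambda>y. r y $ k)) \<and>
      (\<forall>y t. t \<in> zariski_tangent S y \<longrightarrow> (\<forall>j\<in>J. t $ j = 0) \<longrightarrow> pairing (r y) t = 0)" for r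
  have "\<exists>r. ok r \<and> r y0 = w" if w: "w \<in> W" for w
  proof (cases "w \<in> (\<lambda>P. pdiff P y0) ` vanishing_ideal S")
    case True
    then obtain P where P: "P \<in> vanishing_ideal S" "w = pdiff P y0" by auto
    have "polyfun coord (\<lambda>y. pdiff P y $ k)" for k
      unfolding pdiff_def by (simp add: polyfun_pval)
    then have "ok (pdiff P)" using P(1) by (simp add: ok_def zariski_tangent_def)
    with P(2) show ?thesis by (intro exI[of _ "pdiff P"]) simp
  next
    case False
    then obtain j where j: "j \<in> J" "w = axis j 1" using w by (auto simp: W_def)
    have "ok (\<lambda>_. w)" using j by (simp add: ok_def polyfun_closed(1))
    then show ?thesis by (intro exI[of _ "\<lambda>_. w"]) simp
  qed
  moreover have "e i \<in> W" for i using e B(1) by (auto simp: bij_betw_def)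
  ultimately have "\<forall>i. \<exists>r. ok r \<and> r y0 = e i" by simp
  from choice[OF this] obtain r where r: "\<forall>i. ok (r i) \<and> r i y0 = e i" ..
  define M where "M y = (\<chi> i. r i y)" for y
  have Mnth: "M y $ i = r i y" for y i by (simp add: M_def)
  have "polyfun coord (\<lambda>y. det (M y))"
    by (rule polyfun_det) (use r in \<open>simp add: Mnth ok_def\<close>)
  from this[unfolded polyfun_coord] obtain H where H: "\<forall>y. det (M y) = pval H y" ..
  show thesis
  proof (rule that[of H])
    have "rows (M y0) = B" using e r by (simp add: rows_eq_range Mnth bij_betw_def)
    then have "invertible (M y0)" using spanB by (intro invertible_if_rows_span) simp
    then show "pval H y0 \<noteq> 0" using invertible_det_nz[of "M y0"] H by simp
    fix y t assume y: "pval H y \<noteq> 0" and t: "t \<in> zariski_tangent S y" "\<And>j. j \<in> J \<Longrightarrow> t $ j = 0"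
    have "invertible (M y)" using y H invertible_det_nz[of "M y"] by simp
    from this[unfolded invertible_def] obtain R where "M y ** R = mat 1 \<and> R ** M y = mat 1" ..
    then have R: "R ** M y = mat 1" ..
    have "M y *v t = 0"
      using r t by (simp add: vec_eq_iff matrix_vector_mult_pairing Mnth ok_def)
    then have "R *v (M y *v t) = R *v 0" by (rule arg_cong)
    then show "t = 0" by (simp add: matrix_vector_mul_assoc R)
  qed
qed

text \<open>In characteristic zero these are the polynomials in the variables with index in \<open>J\<close>; vanishing
  partial derivatives are the form in which this is used.\<close>

definition polys_in :: "'v set \<Rightarrow> ('v, 'k::field) mpoly set" where
  "polys_in J = {F. \<forall>k. k \<notin> J \<longrightarrow> ppartial k F = 0}"

lemma subring_polys_in: "subring (polys_in J :: ('v, 'k::field) mpoly set)"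
proof -
  have "ppartial k (1 :: ('v, 'k) mpoly) = 0" for k using ppartial_pconst[of k 1] by (simp add: pconst_hom)
  then show ?thesis
    by (auto simp: subring_def polys_in_def ppartial_add ppartial_mult ppartial_uminus)
qed

lemma ppartial_in_polys_in: "F \<in> polys_in J \<Longrightarrow> ppartial i F \<in> polys_in J"
proof -
  assume F: "F \<in> polys_in J"
  have "ppartial k (ppartial i F) = 0" if "k \<notin> J" for k
    using F that ppartial_commute[of k i F] by (simp add: polys_in_def)
  then show ?thesis by (simp add: polys_in_def)
qed

lemma constant_if_ppartials_zero:
  fixes F :: "('v, 'k::field_char_0) mpoly"
  assumes "\<And>i. ppartial i F = 0"
  shows "F = pconst (Poly_Mapping.lookup F 0)"
proof (rule poly_mapping_eqI)
  fix m show "Poly_Mapping.lookup F m = Poly_Mapping.lookup (pconst (Poly_Mapping.lookup F 0)) m"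
  proof (cases "m = 0")
    case False
    then obtain i where i: "Poly_Mapping.lookup m i \<noteq> 0" by (metis lookup_zero poly_mapping_eqI)
    have m: "(m - Poly_Mapping.single i 1) + Poly_Mapping.single i 1 = m"
      using i by (intro poly_mapping_eqI) (auto simp: lookup_add lookup_minus lookup_single when_def)
    have "Poly_Mapping.lookup (ppartial i F) (m - Poly_Mapping.single i 1) = 0" using assms by simp
    then have "Poly_Mapping.lookup F m = 0" unfolding lookup_ppartial m by (simp del: of_nat_Suc)
    then show ?thesis using False by (simp add: pconst_def lookup_single when_def)
  qed (simp add: pconst_def)
qed

text \<open>If the coordinates in \<open>J\<close> parametrize the tangent spaces, the partial derivatives of an algebraic
  relation between them are again relations, of smaller degree; so there is none.\<close>

lemma algebraically_independent_coordinates: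
  fixes Z :: "('k::field_char_0^'v::finite) set"
  assumes Z: "zariski_irreducible Z" and D: "D \<subseteq> Z" "Z \<subseteq> zariski closure_of D"
    and dim: "\<And>z. z \<in> D \<Longrightarrow> vec.dim (zariski_tangent Z z) = d"
  obtains J where "card J = d" "polys_in J \<inter> vanishing_ideal Z \<subseteq> {0}"
proof -
  have ZD: "vanishing_ideal D = vanishing_ideal Z"
    using vanishing_ideal_antimono[OF D(1)] vanishing_ideal_antimono[OF D(2)] by simp
  have "D \<noteq> {}" using Z D(2) by (auto simp: zariski_irreducible_def)
  then obtain z0 where z0: "z0 \<in> D" by blast
  obtain J where J: "card J = vec.dim (zariski_tangent Z z0)"
    "\<And>t. t \<in> zariski_tangent Z z0 \<Longrightarrow> (\<And>j. j \<in> J \<Longrightarrow> t $ j = 0) \<Longrightarrow> t = 0"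
    using coordinates_of_subspace[OF subspace_tangent] by blast
  obtain H where H: "pval H z0 \<noteq> 0" "\<And>y t. pval H y \<noteq> 0 \<Longrightarrow> t \<in> zariski_tangent Z y \<Longrightarrow>
    (\<And>j. j \<in> J \<Longrightarrow> t $ j = 0) \<Longrightarrow> t = 0"
    using tangent_coordinates_nearby[OF J(2)] by blast
  have H_notin: "H \<notin> vanishing_ideal Z" using H(1) z0 D(1) vanishing_idealD by blast
  have step: "ppartial j F \<in> vanishing_ideal Z" if F: "F \<in> polys_in J" "F \<in> vanishing_ideal Z" for F j
  proof (cases "j \<in> J")
    case False
    then show ?thesis using F(1) by (simp add: polys_in_def vanishing_ideal_closed)
  next
    case True
    have "ppartial j F * H \<in> vanishing_ideal D"
    proof (rule vanishing_idealI)
      fix z assume z: "z \<in> D"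
      show "pval (ppartial j F * H) z = 0"
      proof (cases "pval H z = 0")
        case False
        have dz: "vec.dim (zariski_tangent Z z) = card J" using dim[OF z] dim[OF z0] J(1) by simp
        \<comment> \<open>pairing with this tangent vector extracts the partial derivative\<close>
        obtain t where t: "t \<in> zariski_tangent Z z" "\<And>i. i \<in> J \<Longrightarrow> t $ i = (if i = j then 1 else 0)"
          using coordinates_surjective[OF subspace_tangent H(2)[OF False] dz,
              where s = "\<lambda>i. if i = j then 1 else 0"] by blast
        have "0 = pairing (pdiff F z) t" using t(1) F(2) by (simp add: zariski_tangent_def)
        also have "\<dots> = (\<Sum>i\<in>UNIV. if i = j then pval (ppartial j F) z else 0)"
          unfolding pairing_def
        proof (intro sum.cong refl)
          fix i
          show "pdiff F z $ i * t $ i = (if i = j then pval (ppartial j F) z else 0)"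
            using t(2)[of i] F(1) True by (cases "i \<in> J") (auto simp: pdiff_def polys_in_def)
        qed
        finally show ?thesis by simp
      qed simp
    qed
    then have "ppartial j F * H \<in> vanishing_ideal Z" unfolding ZD .
    then show ?thesis using H_notin Z unfolding irreducible_iff_prime by blast
  qed
  have "F = 0" if "F \<in> polys_in J" "F \<in> vanishing_ideal Z"
    "\<forall>m\<in>Poly_Mapping.keys F. (\<Sum>i\<in>UNIV. Poly_Mapping.lookup m i) < n" for F n
    using that
  proof (induction n arbitrary: F)
    case 0
    then have "Poly_Mapping.keys F = {}" by auto
    then show ?case by simp
  next
    case (Suc n)
    have "ppartial i F = 0" for i
    proof (rule Suc.IH)
      show "ppartial i F \<in> polys_in J" by (rule ppartial_in_polys_in[OF Suc.prems(1)])
      show "ppartial i F \<in> vanishing_ideal Z" by (rule step[OF Suc.prems(1,2)])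
      show "\<forall>m\<in>Poly_Mapping.keys (ppartial i F). (\<Sum>i\<in>UNIV. Poly_Mapping.lookup m i) < n"
      proof
        fix m assume "m \<in> Poly_Mapping.keys (ppartial i F)"
        then have "m + Poly_Mapping.single i 1 \<in> Poly_Mapping.keys F"
          by (auto simp: in_keys_iff lookup_ppartial)
        with Suc.prems(3) have "(\<Sum>k\<in>UNIV. Poly_Mapping.lookup (m + Poly_Mapping.single i 1) k) < Suc n"
          by (rule bspec)
        then show "(\<Sum>i\<in>UNIV. Poly_Mapping.lookup m i) < n"
          by (simp add: lookup_add sum.distrib lookup_single when_def)
      qed
    qed
    then have c: "F = pconst (Poly_Mapping.lookup F 0)" by (rule constant_if_ppartials_zero)
    have "pval F z0 = 0" using vanishing_idealD[OF Suc.prems(2)] z0 D(1) by blast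
    then have "Poly_Mapping.lookup F 0 = 0" using arg_cong[OF c, of "\<lambda>P. pval P z0"] by simp
    then show "F = 0" by (subst c) (simp add: pconst_hom)
  qed
  moreover have "\<exists>n. \<forall>m\<in>Poly_Mapping.keys F. (\<Sum>i\<in>UNIV. Poly_Mapping.lookup m i) < n" for F :: "('v, 'k) mpoly"
  proof -
    have "finite ((\<lambda>m. \<Sum>i\<in>UNIV. Poly_Mapping.lookup m i) ` Poly_Mapping.keys F)" by simp
    then show ?thesis using finite_nat_set_iff_bounded by auto
  qed
  ultimately have "polys_in J \<inter> vanishing_ideal Z \<subseteq> {0}" by blast
  moreover have "card J = d" using J(1) dim[OF z0] by simp
  ultimately show thesis by (intro that)
qed

text \<open>An equation \<open>g\<close> of \<open>Z\<close> that does not vanish on the larger set \<open>C\<close> is algebraically independent of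
  the coordinates in \<open>J\<close> along \<open>C\<close>. The partial derivatives with respect to these independent
  functions extend to vector fields along \<open>C\<close>. The index \<open>None\<close> stands for \<open>g\<close>.\<close>

lemma vector_fields_dual_to_independent_functions:
  fixes C :: "('k::field_char_0^'v::finite) set"
  assumes C: "zariski_irreducible C"
    and J: "polys_in J \<inter> vanishing_ideal Z \<subseteq> {0}" and ZC: "vanishing_ideal C \<subseteq> vanishing_ideal Z"
    and g: "g \<in> vanishing_ideal Z" "g \<notin> vanishing_ideal C"
    and k: "k \<in> Some ` J \<union> {None}"
  obtains u V where "u \<notin> vanishing_ideal C"
    "\<And>y. y \<in> C \<Longrightarrow> (\<chi> i. pval (V i) y) \<in> zariski_tangent C y"
    "\<And>y j. y \<in> C \<Longrightarrow> j \<in> J \<Longrightarrow> pval (V j) y = (if k = Some j then pval u y else 0)"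
    "\<And>y. y \<in> C \<Longrightarrow> pairing (pdiff g y) (\<chi> i. pval (V i) y) = (if k = None then pval u y else 0)"
proof -
  let ?p = "vanishing_ideal C"
  note prime = prime_ideal_vanishing[OF C]
  obtain x where "x \<in> C" using C by (auto simp: zariski_irreducible_def)
  then have char: "of_nat n \<notin> ?p" if "n > 0" for n
    using that vanishing_idealD[of "of_nat n" C x] by auto
  \<comment> \<open>the derivation to be extended, on polynomials in the coordinates of \<open>J\<close>\<close>
  define \<delta> where "\<delta> a = (case k of Some i \<Rightarrow> ppartial i a | None \<Rightarrow> 0)" for a :: "('v, 'k) mpoly"
  have \<delta>: "\<delta> (a + b) = \<delta> a + \<delta> b" "\<delta> (a * b) = a * \<delta> b + \<delta> a * b" "\<delta> (- a) = - \<delta> a"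
     "\<delta> (pconst c) = 0" "\<delta> 0 = 0" for a b c
    by (auto simp: \<delta>_def ppartial_add ppartial_mult ppartial_uminus split: option.splits)
  define \<Delta> where "\<Delta> = (\<lambda>a. Dual a (\<delta> a)) ` polys_in J"
  note sJ = subringD[OF subring_polys_in[of J]]
  have sub: "subring \<Delta>"
    unfolding subring_def
  proof (intro conjI ballI)
    show "1 \<in> \<Delta>" unfolding \<Delta>_def
      using \<delta>(4)[of 1] sJ(1) by (intro image_eqI[of _ _ 1]) (simp_all add: pconst_hom one_dual_def)
    fix w z assume "w \<in> \<Delta>" "z \<in> \<Delta>"
    then obtain a b where ab: "w = Dual a (\<delta> a)" "z = Dual b (\<delta> b)" "a \<in> polys_in J" "b \<in> polys_in J"
      by (auto simp: \<Delta>_def)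
    show "w + z \<in> \<Delta>" unfolding \<Delta>_def using ab sJ
      by (intro image_eqI[of _ _ "a + b"]) (simp_all add: plus_dual_def \<delta>)
    show "w * z \<in> \<Delta>" unfolding \<Delta>_def using ab sJ
      by (intro image_eqI[of _ _ "a * b"]) (simp_all add: times_dual_def \<delta>)
    show "- w \<in> \<Delta>" unfolding \<Delta>_def using ab sJ
      by (intro image_eqI[of _ _ "- a"]) (simp_all add: uminus_dual_def \<delta>)
  qed
  have zero: "a = 0" if "a \<in> polys_in J" "a \<in> vanishing_ideal Z" for a using J that by blast
  have con: "consistent ?p \<Delta>"
    unfolding consistent_def
  proof (intro ballI impI)
    fix w assume "w \<in> \<Delta>" "re w \<in> ?p"
    then obtain a where a: "w = Dual a (\<delta> a)" "a \<in> polys_in J" "a \<in> ?p" by (auto simp: \<Delta>_def)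
    then have "a = 0" using ZC by (intro zero) auto
    then show "ep w \<in> ?p" by (simp add: a(1) \<delta>(5) vanishing_ideal_closed(1))
  qed
  \<comment> \<open>On \<open>Z\<close>, where \<open>g\<close> vanishes, a relation reduces to its constant coefficient, which is
    therefore zero; then the relation can be divided by \<open>g\<close>.\<close>
  have trans: "re (coeff q n) = 0" if "poly_over \<Delta> q" "re (poly q (Dual g 0)) \<in> ?p" for q n
    using that
  proof (induction q arbitrary: n)
    case (pCons a q)
    have a: "a \<in> \<Delta>" using pCons.prems(1)[unfolded poly_over_def, rule_format, of 0] by simp
    have q: "poly_over \<Delta> q"
      unfolding poly_over_def
    proof
      fix n show "coeff q n \<in> \<Delta>"
        using pCons.prems(1)[unfolded poly_over_def, rule_format, of "Suc n"] by simp
    qed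
    have val: "re a + g * re (poly q (Dual g 0)) \<in> ?p" using pCons.prems(2) by simp
    then have "re a + g * re (poly q (Dual g 0)) \<in> vanishing_ideal Z" using ZC by blast
    from vanishing_ideal_closed(3)[OF this vanishing_ideal_closed(5)[OF g(1), of "re (poly q (Dual g 0))"]]
    have "re a \<in> vanishing_ideal Z" by simp
    moreover have "re a \<in> polys_in J" using a by (auto simp: \<Delta>_def)
    ultimately have a0: "re a = 0" by (intro zero)
    with val have "g * re (poly q (Dual g 0)) \<in> ?p" by simp
    then have "re (poly q (Dual g 0)) \<in> ?p" using prime_mult[OF prime] g(2) by blast
    then show ?case using pCons.IH[OF q] a0 by (cases n) simp_all
  qed simp
  have "\<exists>\<Delta>'. subring \<Delta>' \<and> consistent ?p \<Delta>' \<and> \<Delta> \<subseteq> \<Delta>' \<and> Dual g (if k = None then 1 else 0) \<in> \<Delta>'"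
    by (rule extend_transcendental[OF prime sub con]) (simp add: trans vanishing_ideal_closed(1))
  then obtain \<Delta>' where \<Delta>': "subring \<Delta>'" "consistent ?p \<Delta>'" "\<Delta> \<subseteq> \<Delta>'" "Dual g (if k = None then 1 else 0) \<in> \<Delta>'"
    by blast
  have const: "Dual (pconst c) 0 \<in> \<Delta>'" for c
  proof (rule subsetD[OF \<Delta>'(3)])
    show "Dual (pconst c) 0 \<in> \<Delta>"
      unfolding \<Delta>_def by (intro image_eqI[of _ _ "pconst c"]) (simp_all add: \<delta> polys_in_def)
  qed
  obtain u V where uV: "u \<notin> ?p" "\<And>P. P \<in> ?p \<Longrightarrow> (\<Sum>i\<in>UNIV. V i * ppartial i P) \<in> ?p"
    "\<And>w. w \<in> \<Delta>' \<Longrightarrow> u * ep w - (\<Sum>i\<in>UNIV. V i * ppartial i (re w)) \<in> ?p"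
    using derivation_to_vector_field[OF prime char \<Delta>'(1,2) const] by blast
  have pair: "pairing (pdiff P y) (\<chi> i. pval (V i) y) = pval (\<Sum>i\<in>UNIV. V i * ppartial i P) y" for P y
    by (simp add: pairing_def pdiff_def mult.commute)
  show thesis
  proof (rule that[of u V])
    show "(\<chi> i. pval (V i) y) \<in> zariski_tangent C y" if "y \<in> C" for y
      unfolding zariski_tangent_def mem_Collect_eq pair
      using vanishing_idealD[OF uV(2) that] by blast
    show "pval (V j) y = (if k = Some j then pval u y else 0)" if y: "y \<in> C" and j: "j \<in> J" for y j
    proof -
      have "pvar j \<in> polys_in J" using j by (auto simp: polys_in_def ppartial_pvar)
      then have "Dual (pvar j) (\<delta> (pvar j)) \<in> \<Delta>'" using \<Delta>'(3) by (auto simp: \<Delta>_def)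
      from vanishing_idealD[OF uV(3)[OF this] y]
      have "pval u y * pval (\<delta> (pvar j)) y = pairing (pdiff (pvar j) y) (\<chi> i. pval (V i) y)"
        unfolding pair by simp
      then show ?thesis by (auto simp: pdiff_pvar \<delta>_def ppartial_pvar split: option.splits)
    qed
    show "pairing (pdiff g y) (\<chi> i. pval (V i) y) = (if k = None then pval u y else 0)" if y: "y \<in> C" for y
      using vanishing_idealD[OF uV(3)[OF \<Delta>'(4)] y] unfolding pair by (auto split: if_splits)
  qed (rule uV(1))
qed

lemma irreducible_finite_product:
  assumes C: "zariski_irreducible C" and "finite K" "\<And>k. k \<in> K \<Longrightarrow> u k \<notin> vanishing_ideal C"
  shows "(\<Prod>k\<in>K. u k) \<notin> vanishing_ideal C"
  using assms(2,3)
proof (induction K rule: finite_induct)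
  case empty
  show ?case using prime_ideal_vanishing[OF C] by (simp add: prime_ideal_def)
next
  case (insert k K)
  then show ?case using C unfolding irreducible_iff_prime by auto
qed

lemma pval_prod [simp]: "pval (\<Prod>k\<in>K. u k) y = (\<Prod>k\<in>K. pval (u k) y)"
  by (induction K rule: infinite_finite_induct) simp_all

text \<open>At a general point \<open>y\<close> of \<open>C\<close> the vector fields dual to \<open>d + 1\<close> independent functions span \<open>d + 1\<close>
  tangent directions. The dimension of the tangent space is upper semicontinuous, so it is at
  least as large at the special point \<open>y0\<close>.\<close>

theorem tangent_dimension_of_larger_irreducible_set:
  fixes Z C :: "('k::field_char_0^'v::finite) set"
  assumes Z: "zariski_irreducible Z" "closedin zariski Z" and C: "zariski_irreducible C"
    and ZC: "Z \<subseteq> C" "Z \<noteq> C"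
    and D: "D \<subseteq> Z" "Z \<subseteq> zariski closure_of D"
    and dim: "\<And>z. z \<in> D \<Longrightarrow> vec.dim (zariski_tangent Z z) = d"
    and y0: "y0 \<in> C"
  shows "d < vec.dim (zariski_tangent C y0)"
proof (rule ccontr)
  assume "\<not> d < vec.dim (zariski_tangent C y0)"
  then have le: "vec.dim (zariski_tangent C y0) \<le> d" by simp
  obtain J where J: "card J = d" "polys_in J \<inter> vanishing_ideal Z \<subseteq> {0}"
    using algebraically_independent_coordinates[OF Z(1) D dim] by blast
  obtain x where x: "x \<in> C" "x \<notin> Z" using ZC by blast
  obtain g where g: "g \<in> vanishing_ideal Z" "pval g x \<noteq> 0" by (rule closedin_zariski_separate[OF Z(2) x(2)])
  have g': "g \<notin> vanishing_ideal C" using g(2) x(1) vanishing_idealD by blast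
  define K where "K = Some ` J \<union> {None}"
  have cK: "card K = d + 1" using J(1) by (simp add: K_def card_image)
  define good where "good k uV \<longleftrightarrow> fst uV \<notin> vanishing_ideal C \<and>
    (\<forall>y\<in>C. (\<chi> i. pval (snd uV i) y) \<in> zariski_tangent C y \<and>
       (\<forall>j\<in>J. pval (snd uV j) y = (if k = Some j then pval (fst uV) y else 0)) \<and>
       pairing (pdiff g y) (\<chi> i. pval (snd uV i) y) = (if k = None then pval (fst uV) y else 0))" for k uV
  have "\<forall>k\<in>K. \<exists>uV. good k uV"
  proof
    fix k assume "k \<in> K"
    then have "k \<in> Some ` J \<union> {None}" by (simp add: K_def)
    show "\<exists>uV. good k uV"
    proof (rule vector_fields_dual_to_independent_functions[OF C J(2) vanishing_ideal_antimono[OF ZC(1)] g(1) g'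
          \<open>k \<in> Some ` J \<union> {None}\<close>])
      fix u V assume "u \<notin> vanishing_ideal C"
        "\<And>y. y \<in> C \<Longrightarrow> (\<chi> i. pval (V i) y) \<in> zariski_tangent C y"
        "\<And>y j. y \<in> C \<Longrightarrow> j \<in> J \<Longrightarrow> pval (V j) y = (if k = Some j then pval u y else 0)"
        "\<And>y. y \<in> C \<Longrightarrow> pairing (pdiff g y) (\<chi> i. pval (V i) y) = (if k = None then pval u y else 0)"
      then show ?thesis unfolding good_def by (intro exI[of _ "(u, V)"], cases k) simp_all
    qed
  qed
  from bchoice[OF this] obtain uV where uV: "\<forall>k\<in>K. good k (uV k)" ..
  obtain J' where J': "card J' = vec.dim (zariski_tangent C y0)"
    "\<And>t. t \<in> zariski_tangent C y0 \<Longrightarrow> (\<And>j. j \<in> J' \<Longrightarrow> t $ j = 0) \<Longrightarrow> t = 0"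
    using coordinates_of_subspace[OF subspace_tangent] by blast
  obtain H where H: "pval H y0 \<noteq> 0" "\<And>y t. pval H y \<noteq> 0 \<Longrightarrow> t \<in> zariski_tangent C y \<Longrightarrow>
    (\<And>j. j \<in> J' \<Longrightarrow> t $ j = 0) \<Longrightarrow> t = 0"
    using tangent_coordinates_nearby[OF J'(2)] by blast
  have "H \<notin> vanishing_ideal C" using H(1) y0 vanishing_idealD by blast
  moreover have "(\<Prod>k\<in>K. fst (uV k)) \<notin> vanishing_ideal C"
    using uV by (intro irreducible_finite_product[OF C]) (auto simp: K_def good_def)
  ultimately have "H * (\<Prod>k\<in>K. fst (uV k)) \<notin> vanishing_ideal C"
    using C unfolding irreducible_iff_prime by blast
  then obtain y where y: "y \<in> C" "pval H y \<noteq> 0" "\<And>k. k \<in> K \<Longrightarrow> pval (fst (uV k)) y \<noteq> 0"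
    by (auto simp: vanishing_ideal_def K_def)
  define t where "t k = (1 / pval (fst (uV k)) y) *s (\<chi> i. pval (snd (uV k) i) y)" for k
  define c where "c k = (case k of Some j \<Rightarrow> axis j 1 | None \<Rightarrow> pdiff g y)" for k
  have dual: "pairing (t k) (c l) = (if k = l then 1 else 0)" if "k \<in> K" "l \<in> K" for k l
  proof -
    have "good k (uV k)" using uV that(1) by blast
    then show ?thesis
      using y(1) y(3)[OF that(1)] that(2)
      by (cases k; cases l) (auto simp: good_def t_def c_def K_def pairing_commute[of _ "pdiff g y"])
  qed
  have "finite K" by (simp add: K_def)
  from independent_by_dual[OF this one_neq_zero dual]
  have ind: "inj_on t K" "vec.independent (t ` K)" by auto
  have "t ` K \<subseteq> zariski_tangent C y"
  proof (intro image_subsetI)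
    fix k assume "k \<in> K"
    then have "(\<chi> i. pval (snd (uV k) i) y) \<in> zariski_tangent C y" using uV y(1) by (simp add: good_def)
    then show "t k \<in> zariski_tangent C y" unfolding t_def by (rule vec.subspace_scale[OF subspace_tangent])
  qed
  from vec.independent_card_le_dim[OF this ind(2)]
  have "d + 1 \<le> vec.dim (zariski_tangent C y)" by (simp add: card_image[OF ind(1)] cK)
  also have "\<dots> \<le> card J'" by (rule dim_le_coordinates[OF subspace_tangent H(2)[OF y(2)]])
  finally show False using J'(1) le by simp
qed

section \<open>Limits of families of planes\<close>

lemma polyfun_pair_compose:
  assumes F: "polyfun pair_coords F" and a: "\<And>k. polyfun c (\<lambda>z. a z $ k)" and b: "\<And>k. polyfun c (\<lambda>z. b z $ k)"
  shows "polyfun c (\<lambda>z. F (a z, b z))"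
proof -
  from F[unfolded polyfun_def] obtain P where P: "\<forall>z. F z = peval P (\<lambda>i. pair_coords i z)" ..
  have eq: "(\<lambda>z. F (a z, b z)) = (\<lambda>z. peval P (\<lambda>i. pair_coords i (a z, b z)))"
    by (rule ext) (rule P[rule_format])
  have "polyfun (\<lambda>i z. pair_coords i (a z, b z)) (\<lambda>z. peval P (\<lambda>i. pair_coords i (a z, b z)))"
    unfolding polyfun_def by (intro exI allI) (rule refl)
  moreover have "polyfun c (\<lambda>z. pair_coords i (a z, b z))" for i
    by (cases i) (simp_all add: pair_coords_def a b)
  ultimately show ?thesis unfolding eq by (rule polyfun_compose[rotated])
qed

lemma matrix_with_row_span:
  fixes W :: "('k::field^'v::finite) set"
  assumes "vec.subspace W"
  obtains M :: "'k^'v^'v" where "vec.span (rows M) = W"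
proof -
  obtain B where B: "B \<subseteq> W" "vec.independent B" "W \<subseteq> vec.span B" "card B = vec.dim W"
    by (rule vec.basis_exists)
  obtain J :: "'v set" where J: "card J = vec.dim W" by (rule obtain_indices)
  obtain e where e: "bij_betw e J B"
    using finite_same_card_bij[OF _ vec.finiteI_independent[OF B(2)], of J] J B(4) by auto
  define M :: "'k^'v^'v" where "M = (\<chi> i. if i \<in> J then e i else 0)"
  have "B \<subseteq> rows M"
  proof
    fix b assume "b \<in> B"
    then have "b \<in> e ` J" using bij_betw_imp_surj_on[OF e] by simp
    then obtain j where "j \<in> J" "b = e j" by (elim imageE)
    then have "b = M $ j" by (simp add: M_def)
    then show "b \<in> rows M" unfolding rows_eq_range by (rule range_eqI)
  qed
  moreover have "rows M \<subseteq> W"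
  proof
    fix w assume "w \<in> rows M"
    then obtain i where "w = M $ i" by (auto simp: rows_eq_range)
    then show "w \<in> W"
      using B(1) bij_betw_imp_surj_on[OF e] vec.subspace_0[OF assms] by (auto simp: M_def)
  qed
  ultimately have "vec.span (rows M) = W"
    using B(3) vec.span_mono[of B "rows M"] vec.span_minimal[OF _ assms, of "rows M"] by blast
  then show thesis by (rule that)
qed

abbreviation frames_over ::
  "(('k^'v) \<times> ('k^'v) set) set \<Rightarrow> nat \<Rightarrow> (('k::field^'v::finite) \<times> ('k^'v^'v)) set" where
  "frames_over \<Z> r \<equiv> {(y, L). (y, vec.span (rows L)) \<in> \<Z> \<and> rank L = r}"

lemma plane_closureE:
  fixes x :: "'k::field^'v::finite"
  assumes "(x, W) \<in> plane_closure \<gamma> \<Z>"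
  obtains M :: "'k^'v^'v" where "W = vec.span (rows M)"
    "(x, M) \<in> \<gamma> closure_of frames_over \<Z> (rank M)"
  using assms unfolding plane_closure_def by blast

lemma plane_closure_superset:
  fixes x :: "'k::field^'v::finite"
  assumes \<gamma>: "poly_topology frame_coords \<gamma>" and "(x, W) \<in> \<Z>" "vec.subspace W"
  shows "(x, W) \<in> plane_closure \<gamma> \<Z>"
proof -
  obtain M :: "'k^'v^'v" where M: "vec.span (rows M) = W" by (rule matrix_with_row_span[OF assms(3)])
  have "(x, M) \<in> frames_over \<Z> (rank M)" using assms(2) M by simp
  then have "(x, M) \<in> \<gamma> closure_of frames_over \<Z> (rank M)"
    using poly_topology_subset[OF \<gamma>] by (rule rev_subsetD)
  then show ?thesis unfolding plane_closure_def M[symmetric] by blast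
qed

text \<open>Polynomial equations between a point and the vectors of its plane pass to limits, because they
  can be tested on the rows of the matrices that represent the planes.\<close>

lemma limit_plane_subset:
  fixes x :: "'k::field^'v::finite"
  assumes \<gamma>: "poly_topology frame_coords \<gamma>" and xW: "(x, W) \<in> plane_closure \<gamma> \<Z>"
    and F: "\<And>a. a \<in> I \<Longrightarrow> polyfun pair_coords (F a)"
    and van: "\<And>a y U v. a \<in> I \<Longrightarrow> (y, U) \<in> \<Z> \<Longrightarrow> v \<in> U \<Longrightarrow> F a (y, v) = 0"
    and G: "vec.subspace G" "\<And>v. (\<And>a. a \<in> I \<Longrightarrow> F a (x, v) = 0) \<Longrightarrow> v \<in> G"
  shows "W \<subseteq> G"
proof -
  obtain M :: "'k^'v^'v" where M: "W = vec.span (rows M)"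
    "(x, M) \<in> \<gamma> closure_of frames_over \<Z> (rank M)"
    using xW by (rule plane_closureE)
  have "M $ i \<in> G" for i
  proof (rule G(2))
    fix a assume a: "a \<in> I"
    have pf: "polyfun frame_coords (\<lambda>z. F a (fst z, snd z $ i))"
      by (rule polyfun_pair_compose[OF F[OF a]]) (rule polyfun_frame_coords)+
    have "F a (fst (x, M), snd (x, M) $ i) = 0"
    proof (rule poly_topology_zero[OF \<gamma> pf _ M(2)])
      fix z assume "z \<in> frames_over \<Z> (rank M)"
      then have "(fst z, vec.span (rows (snd z))) \<in> \<Z>" by auto
      moreover have "snd z $ i \<in> vec.span (rows (snd z))"
        by (intro vec.span_base) (simp add: rows_eq_range)
      ultimately show "F a (fst z, snd z $ i) = 0" by (rule van[OF a])
    qed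
    then show "F a (x, M $ i) = 0" by simp
  qed
  then have "rows M \<subseteq> G" by (auto simp: rows_eq_range)
  then show ?thesis unfolding M(1) by (rule vec.span_minimal[OF _ G(1)])
qed

lemma polyfun_pairing_pdiff: "polyfun pair_coords (\<lambda>z. pairing (pdiff P (fst z)) (snd z))"
  unfolding pairing_def pdiff_def
  by (intro polyfun_sum polyfun_closed(4)) (simp_all add: polyfun_fst polyfun_pval polyfun_pair_coords)

lemma gauss_limit_subset:
  fixes x :: "'k::field^'v::finite"
  assumes \<gamma>: "poly_topology frame_coords \<gamma>" and xW: "(x, W) \<in> plane_closure \<gamma> (gauss_graph S)"
  shows "W \<subseteq> zariski_tangent S x"
proof (rule limit_plane_subset[OF \<gamma> xW, where I = "vanishing_ideal S"
      and F = "\<lambda>P z. pairing (pdiff P (fst z)) (snd z)"])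
  show "polyfun pair_coords (\<lambda>z. pairing (pdiff P (fst z)) (snd z))" for P
    by (rule polyfun_pairing_pdiff)
  show "vec.subspace (zariski_tangent S x)" by (rule subspace_tangent)
qed (auto simp: gauss_graph_def zariski_tangent_def)

text \<open>Limits are taken among planes of the same dimension, and the points at which they are taken can
  be chosen outside the zero set of a polynomial that does not vanish at \<open>x\<close>.\<close>

lemma gauss_limit_nearby:
  fixes x :: "'k::field^'v::finite"
  assumes \<gamma>: "poly_topology frame_coords \<gamma>" and xW: "(x, W) \<in> plane_closure \<gamma> (gauss_graph S)"
    and P: "pval P x \<noteq> 0"
  obtains y where "nonsingular_point S y" "pval P y \<noteq> 0" "vec.dim (zariski_tangent S y) = vec.dim W"
proof -
  obtain M :: "'k^'v^'v" where M: "W = vec.span (rows M)"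
    "(x, M) \<in> \<gamma> closure_of frames_over (gauss_graph S) (rank M)"
    using xW by (rule plane_closureE)
  have "polyfun frame_coords (\<lambda>z. pval P (fst z))" by (rule polyfun_fst(2)[OF polyfun_pval])
  from poly_topology_nonzero[OF \<gamma> this M(2)] P
  obtain z where "z \<in> frames_over (gauss_graph S) (rank M)" "pval P (fst z) \<noteq> 0" by auto
  then obtain y and L :: "'k^'v^'v" where y: "nonsingular_point S y" "vec.span (rows L) = zariski_tangent S y"
    "rank L = rank M" "pval P y \<noteq> 0" by (auto simp: gauss_graph_def)
  have "vec.dim (zariski_tangent S y) = vec.dim W"
    using y(3) unfolding M(1) y(2)[symmetric] by (simp add: row_rank_def_gen)
  with y(1,4) show thesis by (intro that)
qed

lemma tangent_atI:
  "(x, W) \<in> plane_closure \<gamma> (gauss_graph S) \<Longrightarrow> \<exists>!W. (x, W) \<in> plane_closure \<gamma> (gauss_graph S) \<Longrightarrow>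
     tangent_at \<gamma> S x = W"
  unfolding tangent_at_def by (rule the1_equality)

text \<open>A limit of tangent planes is contained in the tangent space and, the dimension being constant,
  equal to it.\<close>

lemma gauss_regular_if_smooth:
  fixes S :: "('k::field^'v::finite) set"
  assumes \<gamma>: "poly_topology frame_coords \<gamma>" and "open_in_closure S"
    and ns: "\<And>x. x \<in> S \<Longrightarrow> nonsingular_point S x"
    and dim: "\<And>x. x \<in> S \<Longrightarrow> vec.dim (zariski_tangent S x) = d"
  shows "gauss_regular \<gamma> S" "\<And>x. x \<in> S \<Longrightarrow> tangent_at \<gamma> S x = zariski_tangent S x"
proof -
  have mem: "(x, zariski_tangent S x) \<in> plane_closure \<gamma> (gauss_graph S)" if "x \<in> S" for x
    by (rule plane_closure_superset[OF \<gamma> _ subspace_tangent]) (use ns[OF that] in \<open>auto simp: gauss_graph_def\<close>)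
  have uniq: "W = zariski_tangent S x" if xS: "x \<in> S" and xW: "(x, W) \<in> plane_closure \<gamma> (gauss_graph S)" for x W
  proof (rule vec.subspace_dim_equal)
    obtain y where y: "nonsingular_point S y" "vec.dim (zariski_tangent S y) = vec.dim W"
      using gauss_limit_nearby[OF \<gamma> xW, of 1] by auto
    then have "y \<in> S" by (simp add: nonsingular_point_def)
    then show "vec.dim (zariski_tangent S x) \<le> vec.dim W" using dim xS y(2) by simp
    obtain M :: "'k^'v^'v" where "W = vec.span (rows M)" using xW by (rule plane_closureE)
    then show "vec.subspace W" by simp
    show "vec.subspace (zariski_tangent S x)" by (rule subspace_tangent)
    show "W \<subseteq> zariski_tangent S x" by (rule gauss_limit_subset[OF \<gamma> xW])
  qed
  have ex1: "\<exists>!W. (x, W) \<in> plane_closure \<gamma> (gauss_graph S)" if "x \<in> S" for x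
    using mem[OF that] uniq[OF that] by (rule ex1I)
  show "gauss_regular \<gamma> S" unfolding gauss_regular_def using assms(2) ex1 by simp
  show "tangent_at \<gamma> S x = zariski_tangent S x" if "x \<in> S" for x
    using mem[OF that] ex1[OF that] by (rule tangent_atI)
qed

text \<open>The dual statement: equations satisfied by the annihilators of the planes pass to the
  annihilator of the limit. Near \<open>M\<close>, the kernels of the matrices \<open>L\<close> of the same rank are
  parametrized by Cramer's rule for the projection \<open>(L + E)\<^sup>-\<^sup>1 E\<close>.\<close>

lemma limit_kernel:
  fixes M :: "'k::field^'v::finite^'v"
  assumes \<gamma>: "poly_topology frame_coords \<gamma>"
    and xM: "(x, M) \<in> \<gamma> closure_of frames_over \<Z> (rank M)"
    and F: "polyfun pair_coords F" "\<And>y c v. F (y, c *s v) = c * F (y, v)"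
    and van: "\<And>y U v. (y, U) \<in> \<Z> \<Longrightarrow> v \<in> ann U \<Longrightarrow> F (y, v) = 0"
    and v: "M *v v = 0"
  shows "F (x, v) = 0"
proof -
  obtain E where E: "rank E + rank M \<le> CARD('v)" "invertible (M + E)" by (rule rank_complement)
  define K where "K L = (\<chi> k. det (\<chi> i j. if j = k then (E *v v) $ i else (L + E) $ i $ j))" for L
  have K: "K L = det (L + E) *s y" if "(L + E) *v y = E *v v" for L y
    unfolding K_def that[symmetric] using cramer_lemma[of _ "L + E" y] by (simp add: vec_eq_iff mult.commute)
  have entries: "polyfun frame_coords (\<lambda>z. (snd z + E) $ i $ j)" for i j
    by (simp add: polyfun_closed polyfun_frame_coords)
  have "polyfun frame_coords (\<lambda>z. K (snd z) $ k)" for k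
    unfolding K_def vec_lambda_beta
  proof (rule polyfun_det)
    fix i j
    show "polyfun frame_coords (\<lambda>z. (\<chi> i j. if j = k then (E *v v) $ i else (snd z + E) $ i $ j) $ i $ j)"
      using entries[of i j] by (cases "j = k") (simp_all add: polyfun_closed(1) del: vector_add_component)
  qed
  then have "polyfun frame_coords (\<lambda>z. F (fst z, K (snd z)))"
    by (intro polyfun_pair_compose[OF F(1)] polyfun_frame_coords)
  moreover have "polyfun frame_coords (\<lambda>z. det (snd z + E))" by (rule polyfun_det) (rule entries)
  ultimately have pf: "polyfun frame_coords (\<lambda>z. F (fst z, K (snd z)) * det (snd z + E))"
    by (rule polyfun_closed(4))
  have "F (fst (x, M), K (snd (x, M))) * det (snd (x, M) + E) = 0"
  proof (rule poly_topology_zero[OF \<gamma> pf _ xM])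
    fix z assume "z \<in> frames_over \<Z> (rank M)"
    then obtain y and L :: "'k^'v^'v" where z: "z = (y, L)" "(y, vec.span (rows L)) \<in> \<Z>" "rank L = rank M" by auto
    show "F (fst z, K (snd z)) * det (snd z + E) = 0"
    proof (cases "det (L + E) = 0")
      case False
      then have inv: "invertible (L + E)" by (simp add: invertible_det_nz)
      from this[unfolded invertible_def] obtain R where "(L + E) ** R = mat 1 \<and> R ** (L + E) = mat 1" ..
      then have "((L + E) ** R) *v (E *v v) = E *v v" by (simp only: matrix_vector_mul_lid)
      then have R: "(L + E) *v (R *v (E *v v)) = E *v v" by (simp only: matrix_vector_mul_assoc[symmetric])
      have "L *v (R *v (E *v v)) = 0"
        by (rule complementary_kernel[OF inv _ R]) (use E(1) z(3) in simp)
      then have "R *v (E *v v) \<in> ann (vec.span (rows L))"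
        using kernel_eq_ann[of L] by auto
      from van[OF z(2) this] show ?thesis by (simp add: z(1) K[OF R] F(2))
    qed (simp add: z(1))
  qed
  moreover have "(M + E) *v v = E *v v" using v by (simp add: matrix_vector_mult_add_rdistrib)
  ultimately show ?thesis using E(2) by (simp add: K F(2) invertible_det_nz)
qed

text \<open>After a rescaling, the differentials along a straight segment starting at \<open>x\<close> depend affinely on
  the parameter and have the nonzero limit \<open>v\<close>. Then \<open>v\<close> is a limit of multiples of differentials, and
  its line is a limit of lines.\<close>

definition df_limit :: "('v::finite, 'k::field) mpoly \<Rightarrow> 'k^'v \<Rightarrow> 'k^'v \<Rightarrow> bool" where
  "df_limit f x v \<longleftrightarrow> v \<noteq> 0 \<and> (\<exists>x1 v1. \<forall>s. s \<noteq> 0 \<longrightarrow> pdiff f (x + s *s x1) \<noteq> 0 \<and>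
     vec.span {v + s *s v1} = vec.span {pdiff f (x + s *s x1)})"

lemma upoly_affine: "upoly (\<lambda>s. (x + s *s y) $ i)"
  by (simp add: upoly_closed)

lemma df_limit_closure:
  assumes \<beta>: "poly_topology pair_coords \<beta>" and "df_limit f x v"
  shows "(x, v) \<in> \<beta> closure_of df_bundle f"
proof -
  obtain x1 v1 where *: "\<And>s. s \<noteq> 0 \<Longrightarrow> pdiff f (x + s *s x1) \<noteq> 0 \<and>
     vec.span {v + s *s v1} = vec.span {pdiff f (x + s *s x1)}"
    using assms(2) unfolding df_limit_def by auto
  have "(x + 0 *s x1, v + 0 *s v1) \<in> \<beta> closure_of df_bundle f"
  proof (rule poly_topology_curve[OF \<beta>])
    show "upoly (\<lambda>s. pair_coords i (x + s *s x1, v + s *s v1))" for i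
      by (cases i) (simp_all add: pair_coords_def upoly_closed)
    fix s :: 'b assume "s \<noteq> 0"
    from *[OF this] have "v + s *s v1 \<in> vec.span {pdiff f (x + s *s x1)}"
      using vec.span_base[of "v + s *s v1" "{v + s *s v1}"] by simp
    then show "(x + s *s x1, v + s *s v1) \<in> df_bundle f" using *[OF \<open>s \<noteq> 0\<close>] by (simp add: df_bundle_def)
  qed
  then show ?thesis by simp
qed

text \<open>A matrix of rank one that represents the line spanned by \<open>v\<close>.\<close>

definition one_row :: "'v::finite \<Rightarrow> 'k::field^'v \<Rightarrow> 'k^'v^'v" where
  "one_row i v = (\<chi> k. if k = i then v else 0)"

lemma span_rows_one_row: "vec.span (rows (one_row i v)) = vec.span {v}"
proof -
  have "one_row i v $ k \<in> {0, v}" for k by (simp add: one_row_def)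
  moreover have "one_row i v $ i = v" by (simp add: one_row_def)
  ultimately have "rows (one_row i v) \<subseteq> {0, v}" "v \<in> rows (one_row i v)"
    by (auto simp: rows_eq_range intro: range_eqI[of _ _ i])
  then have "rows (one_row i v) \<subseteq> vec.span {v}" "{v} \<subseteq> vec.span (rows (one_row i v))"
    using vec.span_base[of v "{v}"] vec.span_zero vec.span_base by auto
  then show ?thesis by (simp add: vec.span_eq)
qed

lemma df_limit_plane:
  assumes \<gamma>: "poly_topology frame_coords \<gamma>" and lim: "df_limit f x v"
  shows "(x, vec.span {v}) \<in> plane_closure \<gamma> (df_lines f)"
proof -
  obtain x1 v1 where *: "\<And>s. s \<noteq> 0 \<Longrightarrow> pdiff f (x + s *s x1) \<noteq> 0 \<and>
     vec.span {v + s *s v1} = vec.span {pdiff f (x + s *s x1)}"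
    using lim unfolding df_limit_def by auto
  have v: "v \<noteq> 0" using lim by (simp add: df_limit_def)
  obtain i :: 'a where True by blast
  have rank: "rank (one_row i w) = 1" if "w \<noteq> 0" for w :: "'b^'a"
    using that by (simp add: rank_eq_dim_span_rows span_rows_one_row)
  have "(x + 0 *s x1, one_row i (v + 0 *s v1)) \<in>
    \<gamma> closure_of frames_over (df_lines f) (rank (one_row i v))"
  proof (rule poly_topology_curve[OF \<gamma>])
    show "upoly (\<lambda>s. frame_coords k (x + s *s x1, one_row i (v + s *s v1)))" for k
    proof (cases k)
      case (Inr b)
      then show ?thesis
        by (cases "fst b = i") (simp_all add: frame_coords_def upoly_closed one_row_def split_beta)
    qed (simp add: frame_coords_def upoly_closed)
    fix s :: 'b assume "s \<noteq> 0"
    note s = *[OF this]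
    have "v + s *s v1 \<noteq> 0"
    proof
      assume "v + s *s v1 = 0"
      then have "pdiff f (x + s *s x1) \<in> {0}"
        using s vec.span_base[of "pdiff f (x + s *s x1)" "{pdiff f (x + s *s x1)}"] by simp
      then show False using s by simp
    qed
    then show "(x + s *s x1, one_row i (v + s *s v1)) \<in>
      frames_over (df_lines f) (rank (one_row i v))"
      using s rank v by (auto simp: df_lines_def span_rows_one_row)
  qed
  then show ?thesis
    unfolding plane_closure_def using span_rows_one_row[of i v] by auto
qed

section \<open>Universality from the Thom condition\<close>

lemma constructible_components_irreducible:
  assumes "zariski_irreducible B"
  shows "constructible_components B = {B}"
proof -
  have "irreducible_components (zariski closure_of B) = {zariski closure_of B}"
    using assms unfolding irreducible_components_def by auto
  then show ?thesis
    using subset_closure_zariski[of B] by (auto simp: constructible_components_def)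
qed

text \<open>If the Thom condition confines the tangent spaces of every admissible stratum to the
  tangent spaces of \<open>B\<close>, then a stratum \<open>R\<close> that is dense in \<open>B\<close> cannot be larger than \<open>B\<close>:
  its nonsingular points near a general point of \<open>B\<close> would have tangent spaces of too large a
  dimension.\<close>

lemma universal_component:
  fixes B :: "('k::field_char_0^'v::finite) set"
  assumes \<gamma>: "poly_topology frame_coords \<gamma>"
    and B: "zariski_irreducible B" "open_in_closure B" "B \<subseteq> Sing f"
    and dim: "\<And>x. x \<in> B \<Longrightarrow> vec.dim (zariski_tangent B x) = d"
    and thom: "\<And>x U. x \<in> B \<Longrightarrow> (\<And>V. (x, V) \<in> plane_closure \<gamma> (df_lines f) \<Longrightarrow> annihilates V U)
       \<Longrightarrow> U \<subseteq> zariski_tangent B x"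
    and TWG: "TWG_stratification \<gamma> f \<S>'"
  shows "\<exists>S'\<in>(\<Union>Q\<in>\<S>'. constructible_components Q).
     open_dense_in (B \<inter> S') B \<and> open_dense_in (B \<inter> S') S'"
proof -
  let ?Z = "zariski closure_of B"
  have fin: "finite \<S>'" and cover: "Sing f = \<Union>\<S>'"
    using TWG by (auto simp: TWG_stratification_def partition_on_def)
  \<comment> \<open>By irreducibility one of the finitely many strata \<open>R\<close> is dense in \<open>B\<close>.\<close>
  have "\<exists>F\<in>(\<lambda>R. zariski closure_of (R \<inter> B)) ` \<S>'. B \<subseteq> F"
  proof (rule irreducible_subset_finite_Union[OF B(1)])
    show "B \<subseteq> \<Union> ((\<lambda>R. zariski closure_of (R \<inter> B)) ` \<S>')"
    proof
      fix x assume x: "x \<in> B"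
      then obtain R where "R \<in> \<S>'" "x \<in> R" using B(3) cover by blast
      then show "x \<in> \<Union> ((\<lambda>R. zariski closure_of (R \<inter> B)) ` \<S>')"
        using x subset_closure_zariski[of "R \<inter> B"] by auto
    qed
  qed (use fin in auto)
  then obtain R where R: "R \<in> \<S>'" "B \<subseteq> zariski closure_of (R \<inter> B)" by auto
  have RB: "zariski closure_of (R \<inter> B) = ?Z"
    using closure_zariski_minimal[OF R(2)] closure_zariski_mono[of "R \<inter> B" B] by simp
  have irrRB: "zariski_irreducible (R \<inter> B)" by (rule irreducible_same_closure[OF B(1) RB])
  have regR: "gauss_regular \<gamma> R" and thomR: "thom_condition \<gamma> f R"
    using TWG R(1) by (auto simp: TWG_stratification_def)
  have ZR: "?Z \<subseteq> zariski closure_of R" using closure_zariski_mono[of "R \<inter> B" R] RB by simp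
  \<comment> \<open>The closure of \<open>B\<close> is a component of the closure of \<open>R\<close>, so \<open>R \<inter> ?Z\<close> is the required component.\<close>
  have comp: "?Z \<in> irreducible_components (zariski closure_of R)"
    unfolding irreducible_components_def
  proof (intro CollectI conjI allI impI ZR, simp add: B(1), elim conjE, rule ccontr)
    fix D assume D: "D \<subseteq> zariski closure_of R" "zariski_irreducible D" "?Z \<subseteq> D" "D \<noteq> ?Z"
    have "\<exists>\<F>. finite \<F> \<and> zariski closure_of R = \<Union>\<F> \<and> (\<forall>C\<in>\<F>. closedin zariski C \<and> zariski_irreducible C)"
      by (rule irreducible_decomposition) simp
    then obtain \<F> where \<F>: "finite \<F>" "zariski closure_of R = \<Union>\<F>"
      "\<And>C. C \<in> \<F> \<Longrightarrow> closedin zariski C \<and> zariski_irreducible C" by auto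
    obtain Ck where Ck: "Ck \<in> \<F>" "D \<subseteq> Ck"
      using irreducible_subset_finite_Union[OF D(2) \<F>(1)] \<F>(2,3) D(1) by auto
    \<comment> \<open>\<open>x\<close> is chosen off the components that do not contain \<open>?Z\<close>, and \<open>P\<close> cuts out a neighbourhood
      that avoids them.\<close>
    let ?F = "\<Union>{C\<in>\<F>. \<not> ?Z \<subseteq> C}"
    have clF: "closedin zariski ?F" using \<F>(1,3) by (intro closedin_Union) auto
    have "\<not> R \<inter> B \<subseteq> ?F"
    proof
      assume "R \<inter> B \<subseteq> ?F"
      then obtain C where C: "C \<in> \<F>" "\<not> ?Z \<subseteq> C" "R \<inter> B \<subseteq> C"
        using irreducible_subset_finite_Union[OF irrRB, of "{C\<in>\<F>. \<not> ?Z \<subseteq> C}"] \<F>(1,3) by auto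
      then show False using closure_zariski_minimal[OF C(3)] \<F>(3) RB by simp
    qed
    then obtain x where x: "x \<in> R" "x \<in> B" "x \<notin> ?F" by blast
    obtain P where P: "P \<in> vanishing_ideal ?F" "pval P x \<noteq> 0"
      by (rule closedin_zariski_separate[OF clF x(3)])
    have ex1: "\<exists>!W. (x, W) \<in> plane_closure \<gamma> (gauss_graph R)"
      using regR x(1) by (simp add: gauss_regular_def)
    then obtain W where W: "(x, W) \<in> plane_closure \<gamma> (gauss_graph R)" by (rule ex1E)
    have tW: "tangent_at \<gamma> R x = W" by (rule tangent_atI[OF W ex1])
    have "W \<subseteq> zariski_tangent B x"
    proof (rule thom[OF x(2)])
      fix V assume "(x, V) \<in> plane_closure \<gamma> (df_lines f)"
      then show "annihilates V W"
        using thomR[unfolded thom_condition_def, rule_format, OF x(1)] tW by simp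
    qed
    then have dW: "vec.dim W \<le> d" using vec.dim_subset dim[OF x(2)] by metis
    obtain y where y: "nonsingular_point R y" "pval P y \<noteq> 0" "vec.dim (zariski_tangent R y) = vec.dim W"
      by (rule gauss_limit_nearby[OF \<gamma> W P(2)])
    have "y \<in> R" using y(1) by (simp add: nonsingular_point_def)
    then obtain C0 where C0: "C0 \<in> \<F>" "y \<in> C0" using \<F>(2) subset_closure_zariski[of R] by blast
    have "y \<notin> ?F" using y(2) vanishing_idealD[OF P(1)] by blast
    then have ZC0: "?Z \<subseteq> C0" using C0 by blast
    \<comment> \<open>If \<open>y\<close> lies on \<open>?Z\<close> itself, it lies on the larger component that contains \<open>D\<close>.\<close>
    obtain C where C: "C \<in> \<F>" "y \<in> C" "?Z \<subseteq> C" "?Z \<noteq> C"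
    proof (cases "C0 = ?Z")
      case True
      then show ?thesis using that[of Ck] Ck D(3,4) C0(2) by blast
    next
      case False
      then show ?thesis using that[of C0] C0 ZC0 by blast
    qed
    have "d < vec.dim (zariski_tangent C y)"
    proof (rule tangent_dimension_of_larger_irreducible_set)
      show "zariski_irreducible ?Z" "closedin zariski ?Z" using B(1) by simp_all
      show "zariski_irreducible C" using \<F>(3) C(1) by blast
      show "?Z \<subseteq> C" "?Z \<noteq> C" by fact+
      show "B \<subseteq> ?Z" by (rule subset_closure_zariski)
      show "?Z \<subseteq> zariski closure_of B" by simp
      show "vec.dim (zariski_tangent ?Z z) = d" if "z \<in> B" for z
        using dim[OF that] by (simp add: zariski_tangent_def)
      show "y \<in> C" by fact
    qed
    also have "\<dots> \<le> vec.dim (zariski_tangent R y)"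
    proof (intro vec.dim_subset tangent_mono)
      have "C \<subseteq> zariski closure_of R" using C(1) \<F>(2) by blast
      from vanishing_ideal_antimono[OF this] show "vanishing_ideal R \<subseteq> vanishing_ideal C" by simp
    qed
    finally show False using y(3) dW by simp
  qed
  have BZ: "B \<subseteq> ?Z" by (rule subset_closure_zariski)
  have openB: "\<exists>U. openin zariski U \<and> B = U \<inter> ?Z"
    using B(2) unfolding open_in_closure_def openin_subtopology by blast
  have openR: "\<exists>U. openin zariski U \<and> R = U \<inter> zariski closure_of R"
    using regR unfolding gauss_regular_def open_in_closure_def openin_subtopology by blast
  have eq: "B \<inter> (R \<inter> ?Z) = R \<inter> B" using BZ by blast
  have "open_dense_in (R \<inter> B) B"
    unfolding open_dense_in_def
  proof
    obtain U where U: "openin zariski U" "R = U \<inter> zariski closure_of R" using openR by blast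
    have "R \<inter> B = U \<inter> B" using U(2) BZ ZR by blast
    then show "openin (subtopology zariski B) (R \<inter> B)" unfolding openin_subtopology using U(1) by blast
    show "B \<subseteq> zariski closure_of (R \<inter> B)" by (rule R(2))
  qed
  moreover have "open_dense_in (R \<inter> B) (R \<inter> ?Z)"
    unfolding open_dense_in_def
  proof
    obtain U where U: "openin zariski U" "B = U \<inter> ?Z" using openB by blast
    have "R \<inter> B = U \<inter> (R \<inter> ?Z)" using U(2) by blast
    then show "openin (subtopology zariski (R \<inter> ?Z)) (R \<inter> B)" unfolding openin_subtopology using U(1) by blast
    show "R \<inter> ?Z \<subseteq> zariski closure_of (R \<inter> B)" unfolding RB by blast
  qed
  moreover have "R \<inter> ?Z \<in> constructible_components R"
    using comp unfolding constructible_components_def by blast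
  ultimately show ?thesis using R(1) eq by (intro bexI[of _ "R \<inter> ?Z"]) auto
qed

section \<open>Symmetric matrices\<close>

definition diag :: "('n::finite \<Rightarrow> 'k::field) \<Rightarrow> 'k^'n^'n" where
  "diag d = (\<chi> i j. if i = j then d i else 0)"

abbreviation proj :: "'n::finite set \<Rightarrow> 'k::field^'n^'n" where
  "proj I \<equiv> diag (\<lambda>i. if i \<in> I then 1 else 0)"

lemma diag_mult [simp]:
  "(diag d ** M) $ i $ j = d i * M $ i $ j" "(M ** diag d) $ i $ j = M $ i $ j * d j"
  "(diag d *v x) $ i = d i * x $ i"
proof -
  have "(if i = k then d i else 0) * b = (if k = i then d i * b else 0)"
    "b * (if k = j then d k else 0) = (if k = j then b * d j else 0)" for k b by auto
  then show "(diag d ** M) $ i $ j = d i * M $ i $ j" "(M ** diag d) $ i $ j = M $ i $ j * d j"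
    "(diag d *v x) $ i = d i * x $ i"
    by (simp_all add: diag_def matrix_matrix_mult_def matrix_vector_mult_def)
qed

lemma transpose_diag [simp]: "transpose (diag d) = diag d"
  by (auto simp: transpose_def diag_def vec_eq_iff)

lemma symmetric_nth: "transpose S = S \<Longrightarrow> S $ i $ j = S $ j $ i"
proof -
  assume t: "transpose S = S"
  have "S $ i $ j = transpose S $ j $ i" by (simp add: transpose_def)
  then show ?thesis unfolding t .
qed

lemma symmetricI: "(\<And>i j. S $ i $ j = S $ j $ i) \<Longrightarrow> transpose S = S"
  by (simp add: transpose_def vec_eq_iff)

lemma transpose_add: "transpose (A + B) = transpose A + transpose B"
  by (simp add: transpose_def vec_eq_iff)

lemma matrix_add_rdistrib:
  fixes A B :: "'k::semiring_1^'n::finite^'m::finite"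
  shows "(A + B) ** C = A ** C + B ** C"
  by (simp add: matrix_matrix_mult_def vec_eq_iff distrib_right sum.distrib)

lemma congruence_nth:
  fixes g S :: "'k::field^'n::finite^'n"
  shows "(g ** S ** transpose g) $ i $ j = pairing (g $ i) (S *v (g $ j))"
proof -
  have "(g ** S ** transpose g) $ i $ j = (\<Sum>k\<in>UNIV. \<Sum>l\<in>UNIV. g $ i $ l * (S $ l $ k * g $ j $ k))"
    by (simp add: matrix_matrix_mult_def transpose_def sum_distrib_right mult.assoc)
  also have "\<dots> = (\<Sum>l\<in>UNIV. \<Sum>k\<in>UNIV. g $ i $ l * (S $ l $ k * g $ j $ k))" by (rule sum.swap)
  also have "\<dots> = pairing (g $ i) (S *v (g $ j))"
    by (simp add: pairing_def matrix_vector_mult_def sum_distrib_left)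
  finally show ?thesis .
qed

lemma symmetric_congruence:
  fixes g S :: "'k::field^'n::finite^'n"
  shows "transpose S = S \<Longrightarrow> transpose (g ** S ** transpose g) = g ** S ** transpose g"
  by (simp add: matrix_transpose_mul matrix_mul_assoc)

lemma pairing_matrix_symmetric: "transpose S = S \<Longrightarrow> pairing u (S *v w) = pairing w (S *v u)"
proof -
  assume S: "transpose S = S"
  have "pairing u (S *v w) = (\<Sum>i\<in>UNIV. \<Sum>j\<in>UNIV. u $ i * (S $ i $ j * w $ j))"
    by (simp add: pairing_def matrix_vector_mult_def sum_distrib_left)
  also have "\<dots> = (\<Sum>j\<in>UNIV. \<Sum>i\<in>UNIV. u $ i * (S $ i $ j * w $ j))" by (rule sum.swap)
  also have "\<dots> = (\<Sum>j\<in>UNIV. \<Sum>i\<in>UNIV. w $ j * (S $ j $ i * u $ i))"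
  proof (intro sum.cong refl)
    fix i j show "u $ i * (S $ i $ j * w $ j) = w $ j * (S $ j $ i * u $ i)"
      using symmetric_nth[OF S, of i j] by simp
  qed
  also have "\<dots> = pairing w (S *v u)"
    by (simp add: pairing_def matrix_vector_mult_def sum_distrib_left)
  finally show ?thesis .
qed

lemma rank_diag_le:
  fixes d :: "'n::finite \<Rightarrow> 'k::field"
  assumes "\<And>i. i \<notin> I \<Longrightarrow> d i = 0"
  shows "rank (diag d) \<le> card I"
proof -
  have "vec.dim (rows (diag d)) \<le> vec.dim {x :: 'k^'n. \<forall>i. i \<notin> I \<longrightarrow> x $ i = 0}"
    by (rule vec.dim_subset) (auto simp: rows_eq_range diag_def assms)
  then show ?thesis by (simp add: row_rank_def_gen dim_substandard_cart)
qed

lemma rank_proj: "rank (proj I :: 'k::field^'n::finite^'n) = card I"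
proof (rule antisym)
  show "rank (proj I :: 'k^'n^'n) \<le> card I" by (rule rank_diag_le) simp
  have "proj I + proj (- I) = (mat 1 :: 'k^'n^'n)" by (auto simp: diag_def mat_def vec_eq_iff)
  moreover have "invertible (mat 1 :: 'k^'n^'n)"
    unfolding invertible_def by (intro exI[of _ "mat 1"]) simp
  ultimately have "CARD('n) = rank (proj I + proj (- I) :: 'k^'n^'n)" by (simp add: rank_invertible)
  also have "\<dots> \<le> rank (proj I :: 'k^'n^'n) + rank (proj (- I) :: 'k^'n^'n)" by (rule rank_add_le)
  also have "rank (proj (- I) :: 'k^'n^'n) \<le> card (- I)" by (rule rank_diag_le) simp
  finally show "card I \<le> rank (proj I :: 'k^'n^'n)"
    using card_mono[of UNIV I] by (simp add: card_Compl)
qed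

lemma rank_congruence_le:
  fixes h C :: "'k::field^'n::finite^'n"
  assumes C: "\<And>i j. j \<notin> I \<Longrightarrow> C $ i $ j = 0"
  shows "rank (h ** C ** transpose h) \<le> card I"
proof -
  have "rows (h ** C ** transpose h) \<subseteq> vec.span ((\<lambda>i. column i h) ` I)"
  proof
    fix r assume "r \<in> rows (h ** C ** transpose h)"
    then obtain k where r: "r = (h ** C ** transpose h) $ k" by (auto simp: rows_eq_range)
    have "(h ** C) $ k $ i = 0" if "i \<notin> I" for i using C[OF that] by (simp add: matrix_matrix_mult_def)
    then have "r = (\<Sum>i\<in>UNIV. if i \<in> I then (h ** C) $ k $ i *s column i h else 0)"
      unfolding r by (subst matrix_matrix_mult_def)
        (auto simp: vec_eq_iff transpose_def column_def intro!: sum.cong)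
    also have "\<dots> \<in> vec.span ((\<lambda>i. column i h) ` I)"
      by (intro vec.span_sum) (auto intro: vec.span_scale vec.span_base vec.span_zero)
    finally show "r \<in> vec.span ((\<lambda>i. column i h) ` I)" .
  qed
  then have "rank (h ** C ** transpose h) \<le> card ((\<lambda>i. column i h) ` I)"
    unfolding row_rank_def_gen by (intro vec.dim_le_card) auto
  also have "\<dots> \<le> card I" by (rule card_image_le) simp
  finally show ?thesis .
qed

lemma linear_matrix: "Vector_Spaces.linear (*s) (*s) ((*v) (M :: 'k::field^'n::finite^'m::finite))"
  by (rule matrix_vector_mul_linear_gen)

lemma rank_congruence:
  fixes g h S :: "'k::field^'n::finite^'n"
  assumes gh: "g ** h = mat 1" "h ** g = mat 1"
  shows "rank (g ** S ** transpose g) = rank S"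
proof -
  have T: "transpose g ** transpose h = mat 1" "transpose h ** transpose g = mat 1"
    using gh by (simp_all flip: matrix_transpose_mul)
  have inj: "inj ((*v) (transpose h))"
  proof (rule injI)
    fix x y assume "transpose h *v x = transpose h *v y"
    then have "transpose g *v (transpose h *v x) = transpose g *v (transpose h *v y)" by (rule arg_cong)
    then show "x = y" unfolding matrix_vector_mul_assoc T matrix_vector_mul_lid .
  qed
  have "{x. (g ** S ** transpose g) *v x = 0} = (*v) (transpose h) ` {x. S *v x = 0}"
  proof (intro equalityI subsetI)
    fix x assume x: "x \<in> {x. (g ** S ** transpose g) *v x = 0}"
    then have "h *v ((g ** S ** transpose g) *v x) = h *v 0" by simp
    then have "S *v (transpose g *v x) = 0"
      by (simp only: matrix_vector_mul_assoc matrix_mul_assoc gh matrix_mul_lid matrix_vector_mult_0_right)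
    moreover have "x = transpose h *v (transpose g *v x)"
      by (simp only: matrix_vector_mul_assoc T matrix_vector_mul_lid)
    ultimately show "x \<in> (*v) (transpose h) ` {x. S *v x = 0}" by blast
  next
    fix x assume "x \<in> (*v) (transpose h) ` {x. S *v x = 0}"
    then obtain y where y: "S *v y = 0" "x = transpose h *v y" by blast
    have "(g ** S ** transpose g) *v x = g *v (S *v ((transpose g ** transpose h) *v y))"
      unfolding y(2) by (simp only: matrix_vector_mul_assoc matrix_mul_assoc)
    then show "x \<in> {x. (g ** S ** transpose g) *v x = 0}"
      by (simp only: T matrix_vector_mul_lid y(1) matrix_vector_mult_0_right mem_Collect_eq)
  qed
  then have "vec.dim {x. (g ** S ** transpose g) *v x = 0} = vec.dim {x. S *v x = 0}"
    using vec.dim_image_eq[OF linear_matrix, of "transpose h" "{x. S *v x = 0}"] inj_on_subset[OF inj subset_UNIV]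
    by simp
  then show ?thesis by (simp add: rank_eq_kernel)
qed

text \<open>In a basis \<open>g\<close> whose vectors with index outside \<open>I\<close> span the kernel, the form has a matrix \<open>C\<close>
  that is supported in the \<open>I\<close>-block and invertible there, with inverse \<open>R\<close>.\<close>

lemma symmetric_normal_form:
  fixes a :: "'k::field^'n::finite^'n" and I :: "'n set"
  assumes a: "transpose a = a" and I: "card I = rank a"
  obtains g h C R :: "'k^'n^'n" where "g ** h = mat 1" "h ** g = mat 1" "C = g ** a ** transpose g"
    "a = h ** C ** transpose h" "transpose C = C" "\<And>i j. i \<notin> I \<Longrightarrow> C $ i $ j = 0"
    "\<And>i j. j \<notin> I \<Longrightarrow> C $ i $ j = 0" "invertible (C + proj (- I))" "R ** C = proj I"
    "\<And>k. k \<notin> I \<Longrightarrow> a *v (g $ k) = 0"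
    "\<And>u i. a *v u = 0 \<Longrightarrow> i \<in> I \<Longrightarrow> (transpose h *v u) $ i = 0"
proof -
  have sub: "vec.subspace {x. a *v x = 0}" unfolding kernel_eq_ann by (rule subspace_ann)
  have J: "card (- I) = vec.dim {x. a *v x = 0}" by (simp add: card_Compl dim_kernel I)
  obtain e d :: "'n \<Rightarrow> 'k^'n" where ed: "\<And>i j. pairing (e i) (d j) = (if i = j then 1 else 0)"
    "\<And>x. x = (\<Sum>i\<in>UNIV. pairing x (d i) *s e i)" "\<And>t. t = (\<Sum>i\<in>UNIV. pairing (e i) t *s d i)"
    "\<And>j. j \<in> - I \<Longrightarrow> e j \<in> {x. a *v x = 0}" "\<And>x i. x \<in> {x. a *v x = 0} \<Longrightarrow> i \<notin> - I \<Longrightarrow> pairing x (d i) = 0"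
    by (rule adapted_basis[OF sub J]) blast
  define g :: "'k^'n^'n" where "g = (\<chi> i. e i)"
  define h :: "'k^'n^'n" where "h = (\<chi> i j. d j $ i)"
  define C where "C = g ** a ** transpose g"
  have gh: "g ** h = mat 1"
    using ed(1) by (simp add: vec_eq_iff g_def h_def matrix_matrix_mult_def mat_def pairing_def)
  have hg: "h ** g = mat 1" using gh by (simp add: matrix_left_right_inverse)
  have T: "transpose g ** transpose h = mat 1" "transpose h ** transpose g = mat 1"
    using gh hg by (simp_all flip: matrix_transpose_mul)
  have aC: "a = h ** C ** transpose h"
  proof -
    have "h ** C ** transpose h = (h ** g) ** a ** (transpose g ** transpose h)"
      by (simp only: C_def matrix_mul_assoc)
    then show ?thesis by (simp only: hg T matrix_mul_lid matrix_mul_rid)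
  qed
  have symC: "transpose C = C" unfolding C_def by (rule symmetric_congruence[OF a])
  have ker: "a *v (g $ k) = 0" if "k \<notin> I" for k using ed(4)[of k] that by (simp add: g_def)
  have C2: "C $ i $ j = 0" if "j \<notin> I" for i j
    unfolding C_def congruence_nth ker[OF that] by simp
  have C1: "C $ i $ j = 0" if "i \<notin> I" for i j
    using C2[OF that, of j] symmetric_nth[OF symC, of i j] by simp
  have hu: "(transpose h *v u) $ i = 0" if u: "a *v u = 0" "i \<in> I" for u i
  proof -
    have "(transpose h *v u) $ i = pairing u (d i)"
      by (simp add: matrix_vector_mult_def transpose_def h_def pairing_def mult.commute
          del: transpose_matrix_vector)
    then show ?thesis using ed(5)[of u i] u by simp
  qed
  have "x = 0" if x: "(C + proj (- I)) *v x = 0" for x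
  proof -
    have comp: "(C *v x) $ k + (if k \<in> - I then 1 else 0) * x $ k = 0" for k
      using x by (simp add: vec_eq_iff matrix_vector_mult_add_rdistrib)
    have xJ: "x $ k = 0" if "k \<notin> I" for k
      using comp[of k] that C1[OF that] by (simp add: matrix_vector_mult_def)
    have "(C *v x) $ k = 0" for k using comp[of k] xJ[of k] by (cases "k \<in> I") simp_all
    then have "C *v x = 0" by (simp add: vec_eq_iff)
    then have "h *v (C *v x) = h *v 0" by (rule arg_cong)
    then have "a *v (transpose g *v x) = 0"
      by (simp only: C_def matrix_vector_mul_assoc matrix_mul_assoc hg matrix_mul_lid matrix_vector_mult_0_right)
    then have "(transpose h *v (transpose g *v x)) $ i = 0" if "i \<in> I" for i using that by (rule hu)
    then have "x $ i = 0" if "i \<in> I" for i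
      using that by (simp only: matrix_vector_mul_assoc T matrix_vector_mul_lid)
    then show ?thesis using xJ by (auto simp: vec_eq_iff)
  qed
  then have "\<exists>B. B ** (C + proj (- I)) = mat 1" unfolding matrix_left_invertible_ker by blast
  then obtain R where R: "R ** (C + proj (- I)) = mat 1" ..
  have "invertible (C + proj (- I))" using R invertible_left_inverse by blast
  moreover have "R ** C = proj I"
  proof -
    have "(C + proj (- I)) ** proj I = C"
    proof -
      have "((C + proj (- I)) ** proj I) $ i $ j = C $ i $ j" for i j
        using C2[of j i] by (cases "j \<in> I") (simp_all, simp add: diag_def)
      then show ?thesis by (simp add: vec_eq_iff)
    qed
    then have "R ** C = (R ** (C + proj (- I))) ** proj I" by (simp only: flip: matrix_mul_assoc)
    then show ?thesis by (simp only: R matrix_mul_lid)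
  qed
  ultimately show thesis using that[OF gh hg C_def aC symC C1 C2 _ _ ker hu] by blast
qed

text \<open>The matrices \<open>Z a + a Z\<^sup>T\<close> are the tangent vectors of the orbit of \<open>a\<close> under congruence. In normal
  form a matrix vanishing on the kernel has no entries in the complementary block, and the
  remaining entries can be distributed over the two summands.\<close>

lemma orbit_tangent:
  fixes a F :: "'k::field_char_0^'n::finite^'n"
  assumes a: "transpose a = a" and F: "transpose F = F"
    and ker: "\<And>u. a *v u = 0 \<Longrightarrow> pairing u (F *v u) = 0"
  obtains Z :: "'k^'n^'n" where "F = Z ** a + a ** transpose Z"
proof -
  obtain I :: "'n set" where I: "card I = rank a"
    using obtain_subset_with_card_n[OF rank_le_CARD[of a]] by blast
  obtain g h C R :: "'k^'n^'n" where nf: "g ** h = mat 1" "h ** g = mat 1" "C = g ** a ** transpose g"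
    "a = h ** C ** transpose h" "transpose C = C" "\<And>i j. i \<notin> I \<Longrightarrow> C $ i $ j = 0"
    "\<And>i j. j \<notin> I \<Longrightarrow> C $ i $ j = 0" "R ** C = proj I" "\<And>k. k \<notin> I \<Longrightarrow> a *v (g $ k) = 0"
    by (rule symmetric_normal_form[OF a I]) blast
  have T: "transpose g ** transpose h = mat 1" "transpose h ** transpose g = mat 1"
    using nf(1,2) by (simp_all flip: matrix_transpose_mul)
  define S where "S = g ** F ** transpose g"
  have symS: "transpose S = S" unfolding S_def by (rule symmetric_congruence[OF F])
  have S0: "S $ k $ l = 0" if "k \<notin> I" "l \<notin> I" for k l
  proof -
    let ?u = "g $ k" and ?w = "g $ l"
    have "a *v (?u + ?w) = 0" using nf(9) that by (simp add: matrix_vector_right_distrib)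
    then have "pairing (?u + ?w) (F *v (?u + ?w)) = 0" by (rule ker)
    moreover have "pairing ?u (F *v ?u) = 0" "pairing ?w (F *v ?w) = 0" using ker nf(9) that by simp_all
    ultimately have "2 * pairing ?u (F *v ?w) = 0"
      using pairing_matrix_symmetric[OF F, of ?w ?u]
      by (simp add: matrix_vector_right_distrib pairing_add_left pairing_add_right)
    then show ?thesis unfolding S_def congruence_nth by simp
  qed
  \<comment> \<open>The \<open>I\<close>-block contributes to both summands, the mixed blocks to one of them each.\<close>
  define H :: "'k^'n^'n" where "H = diag (\<lambda>i. if i \<in> I then 1 / 2 else 1)"
  define Z' where "Z' = H ** S ** R"
  have ZC: "Z' ** C = H ** S ** proj I" unfolding Z'_def by (simp only: nf(8) flip: matrix_mul_assoc)
  have "C ** transpose Z' = transpose (Z' ** C)" by (simp add: matrix_transpose_mul nf(5))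
  also have "\<dots> = proj I ** S ** H"
    unfolding ZC by (simp add: matrix_transpose_mul symS H_def matrix_mul_assoc)
  finally have CZ: "C ** transpose Z' = proj I ** S ** H" .
  have SZ: "Z' ** C + C ** transpose Z' = S"
  proof -
    have "(Z' ** C + C ** transpose Z') $ i $ j = S $ i $ j" for i j
      unfolding ZC CZ H_def using S0[of i j] by (cases "i \<in> I"; cases "j \<in> I") (simp_all add: field_simps)
    then show ?thesis by (simp add: vec_eq_iff)
  qed
  have "F = (h ** g) ** F ** (transpose g ** transpose h)" by (simp only: nf(2) T matrix_mul_lid matrix_mul_rid)
  also have "\<dots> = h ** S ** transpose h" by (simp only: S_def matrix_mul_assoc)
  also have "\<dots> = h ** Z' ** C ** transpose h + h ** C ** transpose Z' ** transpose h"
    unfolding SZ[symmetric] by (simp only: matrix_add_ldistrib matrix_add_rdistrib matrix_mul_assoc)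
  also have "h ** Z' ** C ** transpose h = (h ** Z' ** g) ** a"
  proof -
    have "(h ** Z' ** g) ** a = h ** Z' ** (g ** h) ** C ** transpose h"
      by (subst nf(4)) (simp only: matrix_mul_assoc)
    then show ?thesis by (simp only: nf(1) matrix_mul_rid)
  qed
  also have "h ** C ** transpose Z' ** transpose h = a ** transpose (h ** Z' ** g)"
  proof -
    have "a ** transpose (h ** Z' ** g) = h ** C ** (transpose h ** transpose g) ** transpose Z' ** transpose h"
      by (subst nf(4)) (simp only: matrix_transpose_mul matrix_mul_assoc)
    then show ?thesis by (simp only: T matrix_mul_rid)
  qed
  finally show thesis by (rule that)
qed

section \<open>The generic quadratic form in matrix notation\<close>

text \<open>Off the diagonal the coefficients of a covector are not halved, in contrast to \<open>form_matrix\<close>, so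
  that the pairing becomes the trace form; see \<open>pairing_quad\<close>.\<close>

definition dual_matrix ::
  "'k::field^('n::{finite,linorder} quad_var) \<Rightarrow> (('k, 'n) vec, 'n) vec" where
  "dual_matrix v = (\<chi> i j. v $ var_A (min i j) (max i j))"

definition x_part :: "'k::field^('n::{finite,linorder} quad_var) \<Rightarrow> ('k, 'n) vec" where
  "x_part v = (\<chi> i. v $ var_X i)"

definition from_form ::
  "(('k::field, 'n::{finite,linorder}) vec, 'n) vec \<Rightarrow> ('k, 'n) vec \<Rightarrow> 'k^('n quad_var)" where
  "from_form S w = (\<chi> k. case k of Inl p \<Rightarrow> (case Rep_upper_pair p of (i, j) \<Rightarrow>
      if i = j then S $ i $ i else 2 * S $ i $ j) | Inr i \<Rightarrow> w $ i)"

definition from_dual ::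
  "(('k::field, 'n::{finite,linorder}) vec, 'n) vec \<Rightarrow> ('k, 'n) vec \<Rightarrow> 'k^('n quad_var)" where
  "from_dual V w = (\<chi> k. case k of Inl p \<Rightarrow> (case Rep_upper_pair p of (i, j) \<Rightarrow> V $ i $ j) | Inr i \<Rightarrow> w $ i)"

lemma Rep_Abs_upper_pair: "i \<le> j \<Longrightarrow> Rep_upper_pair (Abs_upper_pair (i, j)) = (i, j)"
  by (rule Abs_upper_pair_inverse) simp

lemma quad_var_cases:
  obtains i j where "k = var_A i j" "i \<le> j" | i where "k = var_X i"
proof (cases k)
  case (Inl p)
  obtain i j where ij: "Rep_upper_pair p = (i, j)" by force
  then have "i \<le> j" using Rep_upper_pair[of p] by simp
  moreover have "k = var_A i j" using Inl ij Rep_upper_pair_inverse[of p] by (simp add: var_A_def)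
  ultimately show thesis using that(1) by blast
next
  case (Inr i)
  then show thesis using that(2)[of i] by (simp add: var_X_def)
qed

lemma var_simps [simp]:
  "var_A i j \<noteq> var_X k" "var_X k \<noteq> var_A i j" "var_X i = var_X j \<longleftrightarrow> i = j"
  "i \<le> j \<Longrightarrow> k \<le> l \<Longrightarrow> var_A i j = var_A k l \<longleftrightarrow> i = k \<and> j = l"
  by (auto simp: var_A_def var_X_def Abs_upper_pair_inject)

lemma from_form_nth [simp]:
  "i \<le> j \<Longrightarrow> from_form S w $ var_A i j = (if i = j then S $ i $ i else 2 * S $ i $ j)"
  "from_form S w $ var_X i = w $ i"
  by (simp_all add: from_form_def var_A_def var_X_def Rep_Abs_upper_pair)

lemma from_dual_nth [simp]:
  "i \<le> j \<Longrightarrow> from_dual S w $ var_A i j = S $ i $ j" "from_dual S w $ var_X i = w $ i"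
  by (simp_all add: from_dual_def var_A_def var_X_def Rep_Abs_upper_pair)

lemma symmetric_form_matrix [simp]: "transpose (form_matrix x) = form_matrix x"
  by (rule symmetricI) (auto simp: form_matrix_def min.commute max.commute)

lemma symmetric_dual_matrix [simp]: "transpose (dual_matrix x) = dual_matrix x"
  by (rule symmetricI) (auto simp: dual_matrix_def min.commute max.commute)

lemma form_matrix_from_form [simp]:
  fixes S :: "(('k::field_char_0, 'n::{finite,linorder}) vec, 'n) vec"
  shows "transpose S = S \<Longrightarrow> form_matrix (from_form S w) = S"
  using symmetric_nth[of S]
  by (auto simp: vec_eq_iff form_matrix_def min_def max_def)

lemma x_part_from [simp]: "x_part (from_form S w) = w" "x_part (from_dual S w) = w"
  by (simp_all add: vec_eq_iff x_part_def)

lemma dual_matrix_from_dual [simp]: "transpose S = S \<Longrightarrow> dual_matrix (from_dual S w) = S"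
  using symmetric_nth[of S] by (auto simp: vec_eq_iff dual_matrix_def min_def max_def)

lemma quad_vec_eqI_form:
  fixes x y :: "'k::field_char_0^('n::{finite,linorder} quad_var)"
  assumes "form_matrix x = form_matrix y" "x_part x = x_part y"
  shows "x = y"
proof -
  have "x $ k = y $ k" for k
  proof (cases k rule: quad_var_cases)
    case (1 i j)
    then show ?thesis using arg_cong[OF assms(1), of "\<lambda>M. M $ i $ j"]
      by (cases "i = j") (auto simp: form_matrix_def min_def max_def)
  next
    case (2 i)
    then show ?thesis using arg_cong[OF assms(2), of "\<lambda>M. M $ i"] by (simp add: x_part_def)
  qed
  then show ?thesis by (simp add: vec_eq_iff)
qed

lemma quad_vec_eqI_dual:
  fixes x y :: "'k::field^('n::{finite,linorder} quad_var)"
  assumes "dual_matrix x = dual_matrix y" "x_part x = x_part y"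
  shows "x = y"
proof -
  have "x $ k = y $ k" for k
  proof (cases k rule: quad_var_cases)
    case (1 i j)
    then show ?thesis using arg_cong[OF assms(1), of "\<lambda>M. M $ i $ j"] by (simp add: dual_matrix_def)
  next
    case (2 i)
    then show ?thesis using arg_cong[OF assms(2), of "\<lambda>M. M $ i"] by (simp add: x_part_def)
  qed
  then show ?thesis by (simp add: vec_eq_iff)
qed

lemma quad_linear [simp]:
  "form_matrix (x + y) $ i $ j = form_matrix x $ i $ j + form_matrix y $ i $ j"
  "form_matrix (c *s x) $ i $ j = c * form_matrix x $ i $ j"
  "form_matrix 0 = 0"
  "dual_matrix (x + y) $ i $ j = dual_matrix x $ i $ j + dual_matrix y $ i $ j"
  "dual_matrix (c *s x) $ i $ j = c * dual_matrix x $ i $ j"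
  "dual_matrix 0 = 0"
  "x_part (x + y) = x_part x + x_part y" "x_part (c *s x) = c *s x_part x" "x_part 0 = 0"
  by (auto simp: form_matrix_def dual_matrix_def x_part_def vec_eq_iff add_divide_distrib)

lemma sum_quad_var:
  fixes f :: "'n::{finite,linorder} quad_var \<Rightarrow> 'a::comm_monoid_add"
  shows "(\<Sum>k\<in>UNIV. f k) = (\<Sum>(i, j)\<in>{(i, j). i \<le> j}. f (var_A i j)) + (\<Sum>i\<in>UNIV. f (var_X i))"
proof -
  have "(\<Sum>k\<in>UNIV. f k) = (\<Sum>p\<in>UNIV. f (Inl p)) + (\<Sum>i\<in>UNIV. f (Inr i))"
    unfolding UNIV_Plus_UNIV[symmetric] by (subst sum.Plus) simp_all
  also have "(\<Sum>p\<in>UNIV. f (Inl p)) = (\<Sum>q\<in>{(i, j). i \<le> j}. f (case q of (i, j) \<Rightarrow> var_A i j))"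
  proof (rule sum.reindex_bij_witness[of _ Abs_upper_pair Rep_upper_pair])
    fix p :: "'n upper_pair"
    show "Rep_upper_pair p \<in> {(i, j). i \<le> j}" by (rule Rep_upper_pair)
    show "f (case Rep_upper_pair p of (i, j) \<Rightarrow> var_A i j) = f (Inl p)"
      using Rep_upper_pair_inverse[of p] by (simp add: var_A_def case_prod_beta)
  qed (auto simp: Rep_upper_pair_inverse Abs_upper_pair_inverse)
  finally show ?thesis by (simp add: var_X_def case_prod_beta)
qed

lemma sum_symmetric:
  fixes G :: "'n::{finite,linorder} \<Rightarrow> 'n \<Rightarrow> 'k::comm_ring_1"
  assumes sym: "\<And>i j. G i j = G j i"
  shows "(\<Sum>i\<in>UNIV. \<Sum>j\<in>UNIV. G i j) = (\<Sum>(i, j)\<in>{(i, j). i \<le> j}. if i = j then G i i else 2 * G i j)"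
proof -
  have split: "{(i, j). i \<le> j} = {(i, j). i = j} \<union> {(i :: 'n, j). i < j}" by auto
  have "(\<Sum>i\<in>UNIV. \<Sum>j\<in>UNIV. G i j) = (\<Sum>(i, j)\<in>UNIV. G i j)"
    by (simp add: sum.cartesian_product)
  also have "(UNIV :: ('n \<times> 'n) set) = {(i, j). i \<le> j} \<union> {(i, j). j < i}" by auto
  also have "(\<Sum>(i, j)\<in>{(i, j). i \<le> j} \<union> {(i, j). j < i}. G i j)
      = (\<Sum>(i, j)\<in>{(i, j). i \<le> j}. G i j) + (\<Sum>(i, j)\<in>{(i, j). j < i}. G i j)"
    by (rule sum.union_disjoint) auto
  also have "(\<Sum>(i, j)\<in>{(i, j). j < i}. G i j) = (\<Sum>(i, j)\<in>{(i, j). i < j}. G i j)"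
    by (rule sum.reindex_bij_witness[of _ "\<lambda>(i, j). (j, i)" "\<lambda>(i, j). (j, i)"]) (auto simp: sym)
  also have "(\<Sum>(i, j)\<in>{(i, j). i \<le> j}. G i j) + (\<Sum>(i, j)\<in>{(i, j). i < j}. G i j)
      = (\<Sum>(i, j)\<in>{(i, j). i = j}. G i j) + (\<Sum>(i, j)\<in>{(i, j). i < j}. 2 * G i j)"
    unfolding split by (subst sum.union_disjoint) (auto simp: sum_distrib_left case_prod_beta intro!: sum.cong)
  also have "\<dots> = (\<Sum>(i, j)\<in>{(i, j). i \<le> j}. if i = j then G i i else 2 * G i j)"
    unfolding split by (subst sum.union_disjoint) (auto intro!: arg_cong2[where f = "(+)"] sum.cong)
  finally show ?thesis .
qed

lemma pairing_quad:
  fixes v t :: "'k::field_char_0^('n::{finite,linorder} quad_var)"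
  shows "pairing v t = (\<Sum>i\<in>UNIV. \<Sum>j\<in>UNIV. dual_matrix v $ i $ j * form_matrix t $ i $ j)
     + pairing (x_part v) (x_part t)"
proof -
  have "(\<Sum>i\<in>UNIV. \<Sum>j\<in>UNIV. dual_matrix v $ i $ j * form_matrix t $ i $ j)
      = (\<Sum>(i, j)\<in>{(i, j). i \<le> j}. if i = j then dual_matrix v $ i $ i * form_matrix t $ i $ i
          else 2 * (dual_matrix v $ i $ j * form_matrix t $ i $ j))"
  proof (rule sum_symmetric)
    fix i j
    show "dual_matrix v $ i $ j * form_matrix t $ i $ j = dual_matrix v $ j $ i * form_matrix t $ j $ i"
      using symmetric_nth[OF symmetric_form_matrix, of t i j] symmetric_nth[OF symmetric_dual_matrix, of v i j]
      by simp
  qed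
  also have "\<dots> = (\<Sum>(i, j)\<in>{(i, j). i \<le> j}. v $ var_A i j * t $ var_A i j)"
    by (intro sum.cong refl) (auto simp: dual_matrix_def form_matrix_def min_def max_def)
  finally show ?thesis
    unfolding pairing_def[of v t] sum_quad_var by (simp add: pairing_def x_part_def)
qed

lemma pdiff_sum: "pdiff (\<Sum>a\<in>A. P a) x = (\<Sum>a\<in>A. pdiff (P a) x)"
  by (induction A rule: infinite_finite_induct) (auto simp: pdiff_add)

lemma pdiff_generic_quadric:
  fixes x :: "'k::field_char_0^('n::{finite,linorder} quad_var)"
  shows "dual_matrix (pdiff generic_quadric x) = (\<chi> i j. x_part x $ i * x_part x $ j)"
    "x_part (pdiff generic_quadric x) = 2 *s (form_matrix x *v x_part x)"
proof -
  let ?X = "\<lambda>i. x $ var_X i"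
  have d: "pdiff generic_quadric x = (\<Sum>(i, j)\<in>{(i, j). i \<le> j}.
      (?X i * ?X j) *s axis (var_A i j) 1 + (x $ var_A i j * ?X j) *s axis (var_X i) 1
      + (x $ var_A i j * ?X i) *s axis (var_X j) 1)"
    unfolding generic_quadric_def pdiff_sum
    by (intro sum.cong refl)
       (auto simp: pdiff_mult pdiff_pvar vec_eq_iff algebra_simps)
  have dA: "pdiff generic_quadric x $ var_A k l = ?X k * ?X l" if "k \<le> l" for k l
  proof -
    have "pdiff generic_quadric x $ var_A k l
        = (\<Sum>p\<in>{(i, j). i \<le> j}. if p = (k, l) then ?X k * ?X l else 0)"
      unfolding d sum_component using that by (intro sum.cong refl) (auto simp: axis_def split: if_splits)
    then show ?thesis using that by (simp add: sum.delta)
  qed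
  show "dual_matrix (pdiff generic_quadric x) = (\<chi> i j. x_part x $ i * x_part x $ j)"
    by (auto simp: vec_eq_iff dual_matrix_def dA x_part_def min_def max_def)
  have dX: "pdiff generic_quadric x $ var_X m = 2 * (form_matrix x *v x_part x) $ m" for m
  proof -
    let ?F = "\<lambda>i j. form_matrix x $ i $ j"
    have "pdiff generic_quadric x $ var_X m = (\<Sum>(i, j)\<in>{(i, j). i \<le> j}.
        x $ var_A i j * ((if i = m then ?X j else 0) + (if j = m then ?X i else 0)))"
      unfolding d sum_component by (intro sum.cong refl) (auto simp: axis_def algebra_simps)
    also have "\<dots> = (\<Sum>(i, j)\<in>{(i, j). i \<le> j}. if i = j
        then ?F i i * ((if i = m then ?X i else 0) + (if i = m then ?X i else 0))
        else 2 * (?F i j * ((if i = m then ?X j else 0) + (if j = m then ?X i else 0))))"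
      by (intro sum.cong refl) (auto simp: form_matrix_def min_def max_def)
    also have "\<dots> = (\<Sum>i\<in>UNIV. \<Sum>j\<in>UNIV. ?F i j * ((if i = m then ?X j else 0) + (if j = m then ?X i else 0)))"
    proof (rule sum_symmetric[symmetric])
      fix i j
      show "?F i j * ((if i = m then ?X j else 0) + (if j = m then ?X i else 0))
        = ?F j i * ((if j = m then ?X i else 0) + (if i = m then ?X j else 0))"
        using symmetric_nth[OF symmetric_form_matrix, of x i j] by simp
    qed
    also have "\<dots> = (\<Sum>i\<in>UNIV. \<Sum>j\<in>UNIV. if i = m then ?F m j * ?X j else 0)
        + (\<Sum>i\<in>UNIV. \<Sum>j\<in>UNIV. if j = m then ?F i m * ?X i else 0)"
      unfolding sum.distrib[symmetric] by (intro sum.cong refl) (auto simp: distrib_left)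
    also have "(\<Sum>i\<in>UNIV. \<Sum>j\<in>UNIV. if i = m then ?F m j * ?X j else 0) = (\<Sum>j\<in>UNIV. ?F m j * ?X j)"
      by (subst sum.swap) simp
    also have "(\<Sum>i\<in>UNIV. \<Sum>j\<in>UNIV. if j = m then ?F i m * ?X i else 0) = (\<Sum>j\<in>UNIV. ?F m j * ?X j)"
      by (simp, intro sum.cong refl) (simp only: symmetric_nth[OF symmetric_form_matrix, of x m])
    finally show ?thesis by (simp add: matrix_vector_mult_def x_part_def)
  qed
  then show "x_part (pdiff generic_quadric x) = 2 *s (form_matrix x *v x_part x)"
    by (simp add: vec_eq_iff x_part_def)
qed

lemma pdiff_generic_quadric_eq_0:
  "pdiff (generic_quadric :: ('n::{finite,linorder} quad_var, 'k::field_char_0) mpoly) x = 0 \<longleftrightarrow> x_part x = 0"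
proof
  assume "pdiff generic_quadric x = 0"
  then have "dual_matrix (pdiff generic_quadric x) = 0" by simp
  then have "x_part x $ i * x_part x $ i = 0" for i
    unfolding pdiff_generic_quadric by (simp add: vec_eq_iff)
  then show "x_part x = 0" by (simp add: vec_eq_iff)
next
  assume X: "x_part x = 0"
  show "pdiff generic_quadric x = 0"
    by (rule quad_vec_eqI_dual) (simp_all add: pdiff_generic_quadric X vec_eq_iff)
qed

lemma Sing_generic_quadric:
  "Sing (generic_quadric :: ('n::{finite,linorder} quad_var, 'k::field_char_0) mpoly) = {x. x_part x = 0}"
proof -
  have "pval generic_quadric x = 0" if "x_part x = 0" for x :: "'k^('n quad_var)"
  proof -
    have "x $ var_X i = 0" for i using that by (simp add: vec_eq_iff x_part_def)
    then show ?thesis by (simp add: generic_quadric_def case_prod_beta)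
  qed
  then show ?thesis by (auto simp: Sing_def pdiff_generic_quadric_eq_0)
qed

lemma polyfun_quad:
  "polyfun coord (\<lambda>x. form_matrix x $ i $ j)" "polyfun coord (\<lambda>x. x_part x $ i)"
  "polyfun pair_coords (\<lambda>z. form_matrix (fst z) $ i $ j)" "polyfun pair_coords (\<lambda>z. x_part (fst z) $ i)"
  "polyfun pair_coords (\<lambda>z. dual_matrix (snd z) $ i $ j)" "polyfun pair_coords (\<lambda>z. x_part (snd z) $ i)"
proof -
  have c: "polyfun coord (\<lambda>x. x $ k)" for k by (rule polyfun_closed(2))
  have half: "polyfun coord (\<lambda>x. x $ k / 2)" for k
    using polyfun_closed(4)[OF c polyfun_closed(1), of k "1 / 2"] by simp
  show F: "polyfun coord (\<lambda>x. form_matrix x $ i $ j)" for i j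
    by (cases "i = j") (simp_all add: form_matrix_def c half)
  show X: "polyfun coord (\<lambda>x. x_part x $ i)" for i by (simp add: x_part_def c)
  show "polyfun pair_coords (\<lambda>z. form_matrix (fst z) $ i $ j)" "polyfun pair_coords (\<lambda>z. x_part (fst z) $ i)"
    by (rule polyfun_fst(1)[OF F], rule polyfun_fst(1)[OF X])
  show "polyfun pair_coords (\<lambda>z. dual_matrix (snd z) $ i $ j)" "polyfun pair_coords (\<lambda>z. x_part (snd z) $ i)"
    by (simp_all add: dual_matrix_def x_part_def polyfun_pair_coords)
qed

section \<open>The rank strata\<close>

lemma rank_stratum_eq: "rank_stratum q = {x. x_part x = 0 \<and> rank (form_matrix x) = q}"
  by (auto simp: rank_stratum_def x_part_def vec_eq_iff)

definition low_rank :: "nat \<Rightarrow> ('k::field^('n::{finite,linorder} quad_var)) set" where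
  "low_rank q = {x. x_part x = 0 \<and> rank (form_matrix x) \<le> q}"

lemma rank_stratum_subset_low_rank: "rank_stratum q \<subseteq> low_rank q"
  by (auto simp: rank_stratum_eq low_rank_def)

text \<open>Adding a fixed matrix of complementary rank makes all nearby matrices invertible.\<close>

lemma rank_nearby:
  fixes x :: "'k::field^('n::{finite,linorder} quad_var)"
  obtains D where "polyfun coord D" "D x \<noteq> 0"
    "\<And>y. D y \<noteq> 0 \<Longrightarrow> rank (form_matrix x) \<le> rank (form_matrix y)"
proof -
  obtain E where E: "rank E + rank (form_matrix x) \<le> CARD('n)" "invertible (form_matrix x + E)"
    by (rule rank_complement)
  show thesis
  proof (rule that[of "\<lambda>y. det (form_matrix y + E)"])
    show "polyfun coord (\<lambda>y. det (form_matrix y + E))"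
      by (rule polyfun_det) (simp add: polyfun_closed(1,3) polyfun_quad)
    show "det (form_matrix x + E) \<noteq> 0" using E(2) by (simp add: invertible_det_nz)
    fix y :: "'k^('n quad_var)" assume "det (form_matrix y + E) \<noteq> 0"
    then have "CARD('n) = rank (form_matrix y + E)"
      by (simp add: rank_invertible invertible_det_nz)
    also have "\<dots> \<le> rank (form_matrix y) + rank E" by (rule rank_add_le)
    finally show "rank (form_matrix x) \<le> rank (form_matrix y)" using E(1) by linarith
  qed
qed

lemma closedin_if_separated:
  assumes "\<And>x. x \<notin> S \<Longrightarrow> \<exists>D. polyfun coord D \<and> D x \<noteq> 0 \<and> (\<forall>y\<in>S. D y = 0)"
  shows "closedin zariski S"
proof -
  have "zariski closure_of S \<subseteq> S"
  proof (rule subsetI, rule ccontr)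
    fix x assume x: "x \<in> zariski closure_of S" "x \<notin> S"
    from assms[OF x(2)] obtain D where D: "polyfun coord D \<and> D x \<noteq> 0 \<and> (\<forall>y\<in>S. D y = 0)" ..
    have "D x = 0"
      by (rule x(1)[unfolded zariski_def in_closure_zariski_coords, rule_format]) (use D in simp)
    then show False using D by simp
  qed
  then show ?thesis using subset_closure_zariski[of S] by (simp add: closure_of_eq[symmetric])
qed

lemma closedin_rank_le:
  "closedin zariski {x :: 'k::field^('n::{finite,linorder} quad_var). rank (form_matrix x) \<le> q}"
proof (rule closedin_if_separated)
  fix x :: "'k^('n quad_var)" assume x: "x \<notin> {x. rank (form_matrix x) \<le> q}"
  obtain D where D: "polyfun coord D" "D x \<noteq> 0"
    "\<And>y. D y \<noteq> 0 \<Longrightarrow> rank (form_matrix x) \<le> rank (form_matrix y)" by (rule rank_nearby[of x]) blast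
  have "\<forall>y\<in>{x. rank (form_matrix x) \<le> q}. D y = 0"
  proof (rule ballI, rule ccontr)
    fix y :: "'k^('n quad_var)" assume "y \<in> {x. rank (form_matrix x) \<le> q}" "D y \<noteq> 0"
    then show False using D(3)[of y] x by simp
  qed
  then show "\<exists>D. polyfun coord D \<and> D x \<noteq> 0 \<and> (\<forall>y\<in>{x. rank (form_matrix x) \<le> q}. D y = 0)"
    using D(1,2) by (intro exI[of _ D]) simp
qed

lemma closedin_low_rank: "closedin zariski (low_rank q :: ('k::field^('n::{finite,linorder} quad_var)) set)"
proof -
  have eq: "low_rank q = {x :: 'k^('n quad_var). \<forall>i\<in>UNIV. x_part x $ i = 0} \<inter> {x. rank (form_matrix x) \<le> q}"
    by (auto simp: low_rank_def vec_eq_iff)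
  have "closedin zariski {x :: 'k^('n quad_var). \<forall>i\<in>UNIV. x_part x $ i = 0}"
    by (rule closedin_zariski_zeros) (rule polyfun_quad)
  then show ?thesis unfolding eq using closedin_rank_le by (rule closedin_Int)
qed

lemma low_rank_congruent:
  fixes x :: "'k::field_char_0^('n::{finite,linorder} quad_var)"
  assumes "rank (form_matrix x) \<le> card I"
  obtains h C :: "(('k, 'n) vec, 'n) vec" where "form_matrix x = h ** C ** transpose h" "transpose C = C"
    "\<And>i j. j \<notin> I \<Longrightarrow> C $ i $ j = 0"
proof -
  obtain I' where I': "I' \<subseteq> I" "card I' = rank (form_matrix x)"
    using obtain_subset_with_card_n[OF assms] by metis
  obtain g h C R :: "(('k, 'n) vec, 'n) vec" where "form_matrix x = h ** C ** transpose h" "transpose C = C"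
    "\<And>i j. j \<notin> I' \<Longrightarrow> C $ i $ j = 0"
    by (rule symmetric_normal_form[OF symmetric_form_matrix I'(2)]) blast
  with I'(1) show thesis by (intro that) auto
qed

lemma upoly_matrix_mult:
  assumes "\<And>i j. upoly (\<lambda>t. A t $ i $ j)" "\<And>i j. upoly (\<lambda>t. B t $ i $ j)"
  shows "upoly (\<lambda>t. (A t ** B t) $ i $ j)"
  unfolding matrix_matrix_mult_def vec_lambda_beta
  by (intro upoly_sum upoly_closed(4) assms)

text \<open>Forms of bounded rank are congruent to forms in a fixed set of variables; interpolating the forms
  and the base changes joins any two of them by a polynomial curve of such forms.\<close>

lemma low_rank_irreducible:
  assumes "q \<le> CARD('n::{finite,linorder})"
  shows "zariski_irreducible (low_rank q :: ('k::field_char_0^('n quad_var)) set)"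
proof (rule irreducible_if_curves)
  have "0 \<in> (low_rank q :: ('k^('n quad_var)) set)"
  proof -
    have "rank (0 :: (('k, 'n) vec, 'n) vec) = card ({} :: 'n set)"
      using rank_proj[of "{}", where 'k = 'k] by (simp add: diag_def zero_vec_def)
    then show ?thesis by (simp add: low_rank_def)
  qed
  then show "low_rank q \<noteq> ({} :: ('k^('n quad_var)) set)" by blast
  fix a b :: "'k^('n quad_var)" assume ab: "a \<in> low_rank q" "b \<in> low_rank q"
  obtain I :: "'n set" where I: "card I = q" using obtain_subset_with_card_n[OF assms] by metis
  have ra: "rank (form_matrix a) \<le> card I" and rb: "rank (form_matrix b) \<le> card I"
    using ab I by (simp_all add: low_rank_def)
  obtain h C :: "(('k, 'n) vec, 'n) vec" where a: "form_matrix a = h ** C ** transpose h" "transpose C = C"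
    "\<And>i j. j \<notin> I \<Longrightarrow> C $ i $ j = 0" by (rule low_rank_congruent[OF ra]) blast
  obtain h' C' :: "(('k, 'n) vec, 'n) vec" where b: "form_matrix b = h' ** C' ** transpose h'" "transpose C' = C'"
    "\<And>i j. j \<notin> I \<Longrightarrow> C' $ i $ j = 0" by (rule low_rank_congruent[OF rb]) blast
  define H where "H t = (\<chi> i j. h $ i $ j + t * (h' $ i $ j - h $ i $ j))" for t
  define D where "D t = (\<chi> i j. C $ i $ j + t * (C' $ i $ j - C $ i $ j))" for t
  define w where "w t = from_form (H t ** D t ** transpose (H t)) 0" for t
  have symD: "transpose (D t) = D t" for t
    using symmetric_nth[OF a(2)] symmetric_nth[OF b(2)] by (intro symmetricI) (simp add: D_def)
  have fw: "form_matrix (w t) = H t ** D t ** transpose (H t)" "x_part (w t) = 0" for t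
    unfolding w_def by (simp_all add: symmetric_congruence[OF symD])
  have H01: "H 0 = h" "D 0 = C" "H 1 = h'" "D 1 = C'" by (simp_all add: H_def D_def vec_eq_iff)
  have xa: "x_part a = 0" "x_part b = 0" using ab by (simp_all add: low_rank_def)
  show "\<exists>w. (\<forall>i. upoly (\<lambda>t. w t $ i)) \<and> w 0 = a \<and> w 1 = b \<and> (\<forall>t. w t \<in> low_rank q)"
  proof (intro exI[of _ w] conjI allI)
    show "w 0 = a" by (rule quad_vec_eqI_form) (simp_all add: fw H01 a xa)
    show "w 1 = b" by (rule quad_vec_eqI_form) (simp_all add: fw H01 b xa)
    show "w t \<in> low_rank q" for t
    proof -
      have "rank (H t ** D t ** transpose (H t)) \<le> card I"
        by (rule rank_congruence_le) (simp add: D_def a(3) b(3))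
      then show ?thesis by (simp add: low_rank_def fw I)
    qed
    fix k
    have uH: "upoly (\<lambda>t. H t $ i $ j)" "upoly (\<lambda>t. D t $ i $ j)" "upoly (\<lambda>t. transpose (H t) $ i $ j)" for i j
      by (simp_all add: H_def D_def transpose_def upoly_closed)
    have u: "upoly (\<lambda>t. (H t ** D t ** transpose (H t)) $ i $ j)" for i j
      by (intro upoly_matrix_mult uH)
    show "upoly (\<lambda>t. w t $ k)"
    proof (cases k rule: quad_var_cases)
      case (1 i j)
      then show ?thesis
        by (cases "i = j") (simp_all add: w_def u upoly_closed(1,4))
    qed (simp add: w_def upoly_closed(1))
  qed
qed

text \<open>Forms of rank exactly \<open>q\<close> make up a nonempty open part of the irreducible set \<open>low_rank q\<close>.\<close>

lemma low_rank_dense: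
  assumes "q \<le> CARD('n::{finite,linorder})"
  shows "zariski closure_of (rank_stratum q :: ('k::field_char_0^('n quad_var)) set) = low_rank q"
    "rank_stratum q \<noteq> ({} :: ('k^('n quad_var)) set)"
proof -
  obtain I :: "'n set" where I: "card I = q" using obtain_subset_with_card_n[OF assms] by metis
  define b :: "'k^('n quad_var)" where "b = from_form (proj I) 0"
  have b: "b \<in> rank_stratum q" by (simp add: rank_stratum_eq b_def rank_proj I)
  then show "rank_stratum q \<noteq> ({} :: ('k^('n quad_var)) set)" by blast
  obtain D where D: "polyfun coord D" "D b \<noteq> 0"
    "\<And>y. D y \<noteq> 0 \<Longrightarrow> rank (form_matrix b) \<le> rank (form_matrix y)" by (rule rank_nearby[of b]) blast
  have "low_rank q \<subseteq> zariski closure_of (low_rank q \<inter> {x. D x \<noteq> 0})"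
    using b rank_stratum_subset_low_rank
    by (intro irreducible_open_dense[OF low_rank_irreducible[OF assms] D(1) _ D(2)]) blast
  also have "\<dots> \<subseteq> zariski closure_of rank_stratum q"
  proof (rule closure_zariski_mono, rule subsetI)
    fix x assume "x \<in> low_rank q \<inter> {x. D x \<noteq> 0}"
    then have "x_part x = 0" "rank (form_matrix x) \<le> q" "rank (form_matrix b) \<le> rank (form_matrix x)"
      using D(3)[of x] by (simp_all add: low_rank_def)
    then show "x \<in> rank_stratum q" using b by (simp add: rank_stratum_eq)
  qed
  finally show "zariski closure_of (rank_stratum q :: ('k^('n quad_var)) set) = low_rank q"
    using closure_zariski_minimal[OF rank_stratum_subset_low_rank closedin_low_rank] by blast
qed

lemma rank_stratum_irreducible:
  assumes "q \<le> CARD('n::{finite,linorder})"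
  shows "zariski_irreducible (rank_stratum q :: ('k::field_char_0^('n quad_var)) set)"
  using low_rank_irreducible[OF assms, where 'k = 'k]
  by (simp flip: low_rank_dense(1)[OF assms])

lemma rank_stratum_locally_closed:
  obtains U where "openin zariski U"
    "(rank_stratum q :: ('k::field^('n::{finite,linorder} quad_var)) set) = U \<inter> low_rank q"
proof (cases q)
  case 0
  have "openin zariski (UNIV :: ('k^('n quad_var)) set)" using openin_topspace[of zariski] by simp
  with that[of UNIV] show thesis by (simp add: rank_stratum_eq low_rank_def 0)
next
  case (Suc p)
  have "openin zariski (UNIV - {x :: 'k^('n quad_var). rank (form_matrix x) \<le> p})"
    using closedin_rank_le[of p, where 'k = 'k and 'n = 'n] unfolding closedin_def by simp
  moreover have "(rank_stratum q :: ('k^('n quad_var)) set) = (UNIV - {x. rank (form_matrix x) \<le> p}) \<inter> low_rank q"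
    by (auto simp: rank_stratum_eq low_rank_def Suc)
  ultimately show thesis by (rule that)
qed

lemma constructible_rank_stratum: "constructible (rank_stratum q :: ('k::field^('n::{finite,linorder} quad_var)) set)"
proof -
  obtain U where U: "openin zariski U" "(rank_stratum q :: ('k^('n quad_var)) set) = U \<inter> low_rank q"
    by (rule rank_stratum_locally_closed)
  show ?thesis
    unfolding constructible_def
  proof (intro exI[of _ "{rank_stratum q}"] conjI ballI)
    fix F :: "('k^('n quad_var)) set" assume "F \<in> {rank_stratum q}"
    then show "\<exists>U C. openin zariski U \<and> closedin zariski C \<and> F = U \<inter> C"
      using U closedin_low_rank by (intro exI[of _ U] exI[of _ "low_rank q"]) simp
  qed simp_all
qed

lemma open_in_closure_rank_stratum:
  assumes "q \<le> CARD('n::{finite,linorder})"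
  shows "open_in_closure (rank_stratum q :: ('k::field_char_0^('n quad_var)) set)"
proof -
  obtain U where U: "openin zariski U" "(rank_stratum q :: ('k^('n quad_var)) set) = U \<inter> low_rank q"
    by (rule rank_stratum_locally_closed)
  then show ?thesis
    unfolding open_in_closure_def low_rank_dense(1)[OF assms] openin_subtopology by blast
qed

section \<open>Tangent spaces of the rank strata\<close>

text \<open>By \<open>orbit_tangent\<close> this is the tangent space of the congruence orbit of the form.\<close>

definition form_tangent :: "'k::field^('n::{finite,linorder} quad_var) \<Rightarrow> ('k^('n quad_var)) set" where
  "form_tangent x = {t. x_part t = 0 \<and>
     (\<forall>u. form_matrix x *v u = 0 \<longrightarrow> pairing u (form_matrix t *v u) = 0)}"

lemma form_matrix_line:
  "form_matrix (x + s *s t) *v u = form_matrix x *v u + s *s (form_matrix t *v u)"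
  by (simp add: vec_eq_iff matrix_vector_mult_def distrib_right sum.distrib sum_distrib_left mult.assoc)

lemma pairing_transpose:
  fixes g :: "'k::field^'n::finite^'n"
  shows "pairing (transpose g *v z) w = pairing z (g *v w)"
proof -
  have "pairing (transpose g *v z) w = (\<Sum>i\<in>UNIV. \<Sum>k\<in>UNIV. g $ k $ i * z $ k * w $ i)"
    by (simp add: pairing_def matrix_vector_mult_def transpose_def sum_distrib_right del: transpose_matrix_vector)
  also have "\<dots> = (\<Sum>k\<in>UNIV. \<Sum>i\<in>UNIV. g $ k $ i * z $ k * w $ i)" by (rule sum.swap)
  also have "\<dots> = pairing z (g *v w)"
    by (simp add: pairing_def matrix_vector_mult_def sum_distrib_left mult_ac)
  finally show ?thesis .
qed

lemma derivative_along_line: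
  fixes P :: "('v::finite, 'k::field_char_0) mpoly"
  assumes "\<And>s. pval P (x + s *s t) = s * r s" "upoly r"
  shows "pairing (pdiff P x) t = r 0"
proof -
  obtain p where p: "\<And>s. poly p s = pval P (\<chi> i. poly [:x $ i, t $ i:] s)"
    "\<And>s. poly (pderiv p) s = pairing (pdiff P (\<chi> i. poly [:x $ i, t $ i:] s)) (\<chi> i. poly (pderiv [:x $ i, t $ i:]) s)"
    by (rule chain_rule_pval[of P "\<lambda>i. [:x $ i, t $ i:]"]) blast
  from assms(2)[unfolded upoly_def] obtain q where q: "\<forall>s. r s = poly q s" ..
  have "poly p s = poly (pCons 0 q) s" for s
  proof -
    have "(\<chi> i. poly [:x $ i, t $ i:] s) = x + s *s t" by (simp add: vec_eq_iff)
    then show ?thesis by (simp add: p(1) assms(1) q[rule_format])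
  qed
  then have "poly p = poly (pCons 0 q)" by (rule ext)
  then have "p = pCons 0 q" by (simp only: poly_eq_poly_eq_iff)
  then have "poly (pderiv p) 0 = r 0" by (simp add: pderiv_pCons q[rule_format])
  moreover have "(\<chi> i. poly [:x $ i, t $ i:] 0) = x" "(\<chi> i. poly (pderiv [:x $ i, t $ i:]) 0) = t"
    by (simp_all add: vec_eq_iff pderiv_pCons)
  ultimately show ?thesis using p(2)[of 0] by simp
qed

text \<open>Let \<open>J\<close> index a basis of the kernel in normal form. A nearby form \<open>M\<close> has rank \<open>q\<close> iff the \<open>J\<close>-block of
  \<open>(M + proj J)\<^sup>-\<^sup>1\<close> is the identity: this makes the columns with index in \<open>J\<close> kernel vectors of \<open>M\<close>.
  Cleared of denominators by Cramer's rule, the entries with \<open>k \<le> l\<close> are polynomial equations whose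
  differentials at the point are, up to a factor, the entries of the \<open>J\<close>-block of the tangent form.\<close>

lemma rank_stratum_local_equations:
  fixes x :: "'k::field_char_0^('n::{finite,linorder} quad_var)"
  assumes x: "x \<in> rank_stratum q"
  shows "nonsingular_point (rank_stratum q) x" "zariski_tangent (rank_stratum q) x \<subseteq> form_tangent x"
proof -
  let ?B = "rank_stratum q :: ('k^('n quad_var)) set"
  define a where "a = form_matrix x"
  have rk: "rank a = q" and x0: "x_part x = 0" using x by (simp_all add: rank_stratum_eq a_def)
  obtain I :: "'n set" where I: "card I = rank a" using obtain_subset_with_card_n[OF rank_le_CARD[of a]] by metis
  have syma: "transpose a = a" by (simp add: a_def)
  obtain g h C R :: "(('k, 'n) vec, 'n) vec" where nf: "g ** h = mat 1" "h ** g = mat 1" "C = g ** a ** transpose g"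
    "transpose C = C" "\<And>i j. i \<notin> I \<Longrightarrow> C $ i $ j = 0" "\<And>i j. j \<notin> I \<Longrightarrow> C $ i $ j = 0"
    "invertible (C + proj (- I))"
    "\<And>u i. a *v u = 0 \<Longrightarrow> i \<in> I \<Longrightarrow> (transpose h *v u) $ i = 0"
    by (rule symmetric_normal_form[OF syma I]) blast
  have T: "transpose g ** transpose h = mat 1" "transpose h ** transpose g = mat 1"
    using nf(1,2) by (simp_all flip: matrix_transpose_mul)
  define J where "J = - I"
  have cJ: "card J + q = CARD('n)" using rk I card_mono[of UNIV I] by (simp add: J_def card_Compl)
  define M where "M y = g ** form_matrix y ** transpose g" for y
  define N where "N y = M y + proj J" for y
  have symN: "transpose (N y) = N y" for y
    by (simp add: N_def M_def transpose_add symmetric_congruence)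
  \<comment> \<open>the Cramer numerator of the entry \<open>(k, l)\<close> of the inverse of \<open>N y\<close>; the additional factor
    \<open>det (N y)\<close> of \<open>Pf\<close> makes it vanish also at points of the stratum where \<open>N y\<close> is singular\<close>
  define adj where "adj k l y = det (\<chi> i j. if j = k then axis l 1 $ i else N y $ i $ j)" for k l y
  define Pf where "Pf k l y = det (N y) * (det (N y) * (if k = l then 1 else 0) - adj k l y)" for k l y
  have cramer: "adj k l y = \<xi> $ k * det (N y)" if "N y *v \<xi> = axis l 1" for k l y \<xi>
    using cramer_lemma[of k "N y" \<xi>] unfolding that adj_def .
  have solve: "\<exists>\<xi>. N y *v \<xi> = axis l 1" if d: "det (N y) \<noteq> 0" for l y
  proof -
    have "invertible (N y)" using d by (simp add: invertible_det_nz)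
    from this[unfolded invertible_def] obtain B where "N y ** B = mat 1 \<and> B ** N y = mat 1" ..
    then have "N y *v (B *v axis l 1) = axis l 1" by (simp add: matrix_vector_mul_assoc)
    then show ?thesis by (rule exI)
  qed
  have pN: "polyfun coord (\<lambda>y. N y $ i $ j)" for i j
    unfolding N_def M_def vector_add_component congruence_nth pairing_def matrix_vector_mult_def vec_lambda_beta
    by (intro polyfun_closed(3,4) polyfun_sum polyfun_closed(1) polyfun_quad)
  have pdet: "polyfun coord (\<lambda>y. det (N y))" by (rule polyfun_det) (rule pN)
  have padj: "polyfun coord (adj k l)" for k l
    unfolding adj_def
  proof (rule polyfun_det)
    fix i j show "polyfun coord (\<lambda>y. (\<chi> i j. if j = k then axis l 1 $ i else N y $ i $ j) $ i $ j)"
      using pN[of i j] by (cases "j = k") (simp_all add: polyfun_closed(1))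
  qed
  have "polyfun coord (Pf k l)" for k l
    unfolding Pf_def by (intro polyfun_closed(4,5) pdet padj polyfun_closed(1))
  then have "\<exists>P. \<forall>y. Pf k l y = pval P y" for k l unfolding polyfun_coord by blast
  then have "\<forall>kl. \<exists>P. \<forall>y. Pf (fst kl) (snd kl) y = pval P y" by simp
  from choice[OF this] obtain P' where P': "\<forall>kl. \<forall>y. Pf (fst kl) (snd kl) y = pval (P' kl) y" ..
  define P where "P k l = P' (k, l)" for k l
  have P: "pval (P k l) y = Pf k l y" for k l y using P'[rule_format, of "(k, l)" y] by (simp add: P_def)
  have projJ: "proj J *v axis l 1 = (axis l 1 :: ('k, 'n) vec)" if "l \<in> J" for l
    using that by (auto simp: vec_eq_iff axis_def)
  have rkM: "rank (M y) = rank (form_matrix y)" for y unfolding M_def by (rule rank_congruence[OF nf(1,2)])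
  have van: "Pf k l y = 0" if y: "y \<in> ?B" and kl: "k \<in> J" "l \<in> J" for k l y
  proof (cases "det (N y) = 0")
    case False
    then obtain \<xi> where \<xi>: "N y *v \<xi> = axis l 1" using solve by blast
    have "M y *v \<xi> = 0"
    proof (rule complementary_kernel[of "M y" "proj J" \<xi> "axis l 1"])
      show "invertible (M y + proj J)" using False by (simp add: invertible_det_nz N_def)
      show "rank (M y) + rank (proj J :: (('k, 'n) vec, 'n) vec) \<le> CARD('n)"
        using y cJ by (simp add: rkM rank_proj rank_stratum_eq)
      show "(M y + proj J) *v \<xi> = proj J *v axis l 1" using \<xi> projJ[OF kl(2)] by (simp add: N_def)
    qed
    then have "proj J *v \<xi> = axis l 1" using \<xi> by (simp add: N_def matrix_vector_mult_add_rdistrib)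
    then have "(proj J *v \<xi>) $ k = axis l 1 $ k" by simp
    then have "\<xi> $ k = (if k = l then 1 else 0)" using kl(1) by (simp add: axis_def)
    then show ?thesis by (simp add: Pf_def cramer[OF \<xi>] mult.commute)
  qed (simp add: Pf_def)
  have conv: "rank (form_matrix y) = q"
    if d: "det (N y) \<noteq> 0" and eq: "\<And>k l. k \<in> J \<Longrightarrow> l \<in> J \<Longrightarrow> k \<le> l \<Longrightarrow> Pf k l y = 0" for y
  proof -
    have "\<forall>l. \<exists>\<xi>. N y *v \<xi> = axis l 1" using solve[OF d] by simp
    from choice[OF this] obtain \<xi> where \<xi>: "\<forall>l. N y *v \<xi> l = axis l 1" ..
    have swap: "\<xi> l $ k = \<xi> k $ l" for k l
      using pairing_matrix_symmetric[OF symN, of "\<xi> l" y "\<xi> k"] \<xi> by simp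
    have le: "\<xi> l $ k = (if k = l then 1 else 0)" if "k \<in> J" "l \<in> J" "k \<le> l" for k l
      using eq[OF that] d cramer[OF \<xi>[rule_format, of l], of k] by (auto simp: Pf_def split: if_splits)
    have one: "\<xi> l $ k = (if k = l then 1 else 0)" if "k \<in> J" "l \<in> J" for k l
      using le[OF that] le[OF that(2,1)] swap[of l k] by (cases "k \<le> l") auto
    have ker: "M y *v \<xi> l = 0" if l: "l \<in> J" for l
    proof -
      have "(M y *v \<xi> l) $ i = 0" for i
      proof -
        have "(N y *v \<xi> l) $ i = axis l 1 $ i" using \<xi> by simp
        then have "(M y *v \<xi> l) $ i + (if i \<in> J then 1 else 0) * \<xi> l $ i = axis l 1 $ i"
          by (simp add: N_def matrix_vector_mult_add_rdistrib)
        then show ?thesis using one[OF _ l, of i] l by (cases "i \<in> J") (auto simp: axis_def)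
      qed
      then show ?thesis by (simp add: vec_eq_iff)
    qed
    have dual: "pairing (\<xi> k) (axis l 1) = (if k = l then 1 else 0)" if "k \<in> J" "l \<in> J" for k l
      using one[OF that(2,1)] by auto
    from independent_by_dual[OF _ one_neq_zero dual, of J]
    have ind: "inj_on \<xi> J" "vec.independent (\<xi> ` J)" by simp_all
    have "\<xi> ` J \<subseteq> {v. M y *v v = 0}" using ker by blast
    from vec.independent_card_le_dim[OF this ind(2)]
    have "card J \<le> CARD('n) - rank (M y)" by (simp add: card_image[OF ind(1)] dim_kernel)
    then have le: "rank (M y) \<le> q" using cJ rank_le_CARD[of "M y"] by linarith
    have "invertible (N y)" using d by (simp add: invertible_det_nz)
    from rank_invertible[OF this] have "CARD('n) \<le> rank (M y) + card J"
      using rank_add_le[of "M y" "proj J"] by (simp add: N_def rank_proj)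
    then show ?thesis using le cJ by (simp add: rkM)
  qed
  have Mx: "M x = C" by (simp add: M_def nf(3) a_def)
  have dx: "det (N x) \<noteq> 0" using nf(7) by (simp add: N_def Mx J_def invertible_det_nz)
  have deriv: "pairing (pdiff (P k l) x) t = det (N x) ^ 2 * (g ** form_matrix t ** transpose g) $ k $ l"
    if kl: "k \<in> J" "l \<in> J" for k l t
  proof -
    let ?S = "g ** form_matrix t ** transpose g"
    let ?y = "\<lambda>s. x + s *s t"
    \<comment> \<open>Row \<open>k\<close> of \<open>N \<xi> = e\<^sub>l\<close> shows that \<open>Pf\<close> is divisible by \<open>s\<close> along a line, with quotient \<open>r\<close>.\<close>
    define r where "r s = det (N (?y s)) * (\<Sum>m\<in>UNIV. ?S $ k $ m * adj m l (?y s))" for s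
    have My: "M (?y s) $ i $ j = C $ i $ j + s * ?S $ i $ j" for s i j
      unfolding M_def congruence_nth form_matrix_line pairing_add_right pairing_scale_right
      by (simp add: nf(3) congruence_nth a_def)
    have "pval (P k l) (?y s) = s * r s" for s
    proof (cases "det (N (?y s)) = 0")
      case False
      then obtain \<xi> where \<xi>: "N (?y s) *v \<xi> = axis l 1" using solve by blast
      have "N (?y s) $ k $ m = (if m = k then 1 else 0) + s * ?S $ k $ m" for m
        using kl(1) nf(5)[of k m] by (simp add: N_def My diag_def J_def)
      then have "(N (?y s) *v \<xi>) $ k = (\<Sum>m\<in>UNIV. (if m = k then \<xi> $ m else 0) + s * (?S $ k $ m * \<xi> $ m))"
        unfolding matrix_vector_mult_def vec_lambda_beta by (intro sum.cong refl) (simp add: distrib_right)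
      then have "axis l 1 $ k = \<xi> $ k + s * (\<Sum>m\<in>UNIV. ?S $ k $ m * \<xi> $ m)"
        by (simp add: \<xi> sum.distrib sum_distrib_left)
      then have row: "(if k = l then 1 else 0) - \<xi> $ k = s * (\<Sum>m\<in>UNIV. ?S $ k $ m * \<xi> $ m)"
        by (simp add: axis_def)
      have "pval (P k l) (?y s) = det (N (?y s)) * (det (N (?y s)) * ((if k = l then 1 else 0) - \<xi> $ k))"
        by (simp add: P Pf_def cramer[OF \<xi>] right_diff_distrib mult.commute)
      also have "\<dots> = s * r s"
        unfolding row r_def cramer[OF \<xi>] by (simp add: sum_distrib_left mult_ac)
      finally show ?thesis .
    qed (simp add: P Pf_def r_def)
    moreover have "upoly r"
    proof -
      have "polyfun coord (\<lambda>y. det (N y) * (\<Sum>m\<in>UNIV. ?S $ k $ m * adj m l y))"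
        by (intro polyfun_closed(4) pdet polyfun_sum polyfun_closed(1) padj)
      from this[unfolded polyfun_coord] obtain Q where
        "\<forall>y. det (N y) * (\<Sum>m\<in>UNIV. ?S $ k $ m * adj m l y) = pval Q y" ..
      then have "r = (\<lambda>s. peval Q (\<lambda>i. ?y s $ i))" by (simp add: fun_eq_iff r_def pval_def)
      moreover have "upoly (\<lambda>s. peval Q (\<lambda>i. ?y s $ i))" by (rule upoly_compose) (rule upoly_affine)
      ultimately show ?thesis by simp
    qed
    ultimately have "pairing (pdiff (P k l) x) t = r 0" by (rule derivative_along_line)
    also have "N x *v axis l 1 = axis l 1"
    proof -
      have "C *v axis l 1 = 0"
        using nf(6)[of l] kl(2) by (simp add: vec_eq_iff matrix_vector_mult_pairing J_def)
      then show ?thesis by (simp add: N_def Mx matrix_vector_mult_add_rdistrib projJ[OF kl(2)])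
    qed
    from cramer[OF this] have "r 0 = det (N x) * (\<Sum>m\<in>UNIV. if m = l then ?S $ k $ m * det (N x) else 0)"
      unfolding r_def by (intro arg_cong2[where f = "(*)"] sum.cong) (auto simp: axis_def)
    also have "\<dots> = det (N x) ^ 2 * ?S $ k $ l" by (simp add: power2_eq_square mult_ac)
    finally show ?thesis .
  qed
  have Pvan: "P k l \<in> vanishing_ideal ?B" if "k \<in> J" "l \<in> J" for k l
    using van that by (intro vanishing_idealI) (simp add: P)
  have Xvan: "pvar (var_X m) \<in> vanishing_ideal ?B" for m
    by (intro vanishing_idealI) (simp add: rank_stratum_def)
  \<comment> \<open>The equations of the stratum, and tangent vectors \<open>tt\<close> dual to their differentials, which prove
    these linearly independent.\<close>
  define PP where "PP c = (case c of Inl kl \<Rightarrow> P (fst kl) (snd kl) | Inr m \<Rightarrow> pvar (var_X m))"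
    for c :: "'n \<times> 'n + 'n"
  define K where "K = Inl ` {(k, l). k \<in> J \<and> l \<in> J \<and> k \<le> l} \<union> range (Inr :: 'n \<Rightarrow> 'n \<times> 'n + 'n)"
  define tt where "tt c = (case c of
      Inl kl \<Rightarrow> (1 / det (N x) ^ 2) *s from_form (h ** (\<chi> i j. if (i, j) = kl \<or> (j, i) = kl then 1 else 0) ** transpose h) 0
    | Inr m \<Rightarrow> from_form 0 (axis m 1))" for c :: "'n \<times> 'n + 'n"
  have undo: "g ** (h ** E ** transpose h) ** transpose g = E" for E
  proof -
    have "g ** (h ** E ** transpose h) ** transpose g = (g ** h) ** E ** (transpose h ** transpose g)"
      by (simp only: matrix_mul_assoc)
    then show ?thesis by (simp only: nf(1) T matrix_mul_lid matrix_mul_rid)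
  qed
  have dual: "pairing (pdiff (PP c) x) (tt c') = (if c = c' then 1 else 0)" if cc: "c \<in> K" "c' \<in> K" for c c'
  proof (cases c)
    case (Inl kl)
    obtain k l where kl: "kl = (k, l)" "k \<in> J" "l \<in> J" "k \<le> l" using cc(1) by (auto simp: K_def Inl)
    have PPc: "pairing (pdiff (PP c) x) t = det (N x) ^ 2 * (g ** form_matrix t ** transpose g) $ k $ l" for t
      using deriv[OF kl(2,3)] by (simp add: PP_def Inl kl(1))
    show ?thesis
    proof (cases c')
      case (Inl kl')
      let ?E = "\<chi> i j. if (i, j) = kl' \<or> (j, i) = kl' then (1::'k) else 0"
      have kl': "fst kl' \<le> snd kl'" using cc(2) by (auto simp: K_def Inl)
      have symE: "transpose ?E = ?E" by (rule symmetricI) auto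
      have "pairing (pdiff (PP c) x) (tt c') = 1 / det (N x) ^ 2 * (det (N x) ^ 2 * ?E $ k $ l)"
        unfolding tt_def Inl sum.case pairing_scale_right PPc
          form_matrix_from_form[OF symmetric_congruence[OF symE]] undo ..
      then show ?thesis using dx kl kl' \<open>c = Inl kl\<close> Inl by (cases kl') auto
    next
      case (Inr m)
      have "form_matrix (from_form (0 :: (('k, 'n) vec, 'n) vec) (axis m 1)) = 0"
        by (rule form_matrix_from_form) (simp add: transpose_def vec_eq_iff)
      then have "pairing (pdiff (PP c) x) (tt c') = 0"
        unfolding PPc tt_def Inr sum.case by (simp add: congruence_nth)
      then show ?thesis using \<open>c = Inl kl\<close> Inr by simp
    qed
  next
    case (Inr m)
    have "pairing (pdiff (PP c) x) t = t $ var_X m" for t by (simp add: PP_def Inr pdiff_pvar)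
    then show ?thesis using Inr by (cases c') (auto simp: tt_def axis_def)
  qed
  have finK: "finite K" by (simp add: K_def)
  from independent_by_dual[OF finK one_neq_zero dual]
  have ind: "inj_on (\<lambda>c. pdiff (PP c) x) K" "vec.independent ((\<lambda>c. pdiff (PP c) x) ` K)" by auto
  have loc: "?B \<inter> {y. det (N y) \<noteq> 0} = {y \<in> {y. det (N y) \<noteq> 0}. \<forall>Q\<in>PP ` K. pval Q y = 0}"
  proof (intro equalityI subsetI)
    fix y assume y: "y \<in> ?B \<inter> {y. det (N y) \<noteq> 0}"
    have "pval (PP c) y = 0" if "c \<in> K" for c
    proof (cases c)
      case (Inl kl)
      then show ?thesis using that y van by (auto simp: K_def PP_def P)
    next
      case (Inr m)
      then show ?thesis using y by (simp add: PP_def rank_stratum_def)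
    qed
    with y show "y \<in> {y \<in> {y. det (N y) \<noteq> 0}. \<forall>Q\<in>PP ` K. pval Q y = 0}" by simp
  next
    fix y assume y: "y \<in> {y \<in> {y. det (N y) \<noteq> 0}. \<forall>Q\<in>PP ` K. pval Q y = 0}"
    then have z: "pval (PP c) y = 0" if "c \<in> K" for c using that by simp
    have "y $ var_X m = 0" for m using z[of "Inr m"] by (simp add: K_def PP_def)
    moreover have "rank (form_matrix y) = q"
    proof (rule conv)
      show "det (N y) \<noteq> 0" using y by simp
      fix k l assume "k \<in> J" "l \<in> J" "k \<le> l"
      then show "Pf k l y = 0" using z[of "Inl (k, l)"] by (simp add: K_def PP_def P image_iff)
    qed
    ultimately show "y \<in> ?B \<inter> {y. det (N y) \<noteq> 0}" using y by (simp add: rank_stratum_def)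
  qed
  show "nonsingular_point ?B x"
    unfolding nonsingular_point_def
  proof (intro conjI exI[of _ "PP ` K"] exI[of _ "{y. det (N y) \<noteq> 0}"] x)
    show "finite (PP ` K)" using finK by simp
    show "PP ` K \<subseteq> vanishing_ideal ?B" using Pvan Xvan by (auto simp: K_def PP_def)
    show "inj_on (\<lambda>P. pdiff P x) (PP ` K)"
      using ind(1) inj_on_imageI[of "\<lambda>P. pdiff P x" PP K] by (simp add: comp_def)
    show "vec.independent ((\<lambda>P. pdiff P x) ` PP ` K)" using ind(2) by (simp add: image_image)
    show "openin zariski {y. det (N y) \<noteq> 0}" by (rule openin_zariski[OF pdet])
    show "x \<in> {y. det (N y) \<noteq> 0}" using dx by simp
    show "?B \<inter> {y. det (N y) \<noteq> 0} = {y \<in> {y. det (N y) \<noteq> 0}. \<forall>Q\<in>PP ` K. pval Q y = 0}" by (rule loc)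
  qed
  show "zariski_tangent ?B x \<subseteq> form_tangent x"
  proof
    fix t assume t: "t \<in> zariski_tangent ?B x"
    let ?S = "g ** form_matrix t ** transpose g"
    have "t $ var_X m = 0" for m
    proof -
      have "pairing (pdiff (pvar (var_X m)) x) t = 0" using t Xvan unfolding zariski_tangent_def by blast
      then show ?thesis by (simp add: pdiff_pvar)
    qed
    then have "x_part t = 0" by (simp add: vec_eq_iff x_part_def)
    moreover have "pairing u (form_matrix t *v u) = 0" if u: "form_matrix x *v u = 0" for u
    proof -
      define z where "z = transpose h *v u"
      have uz: "u = transpose g *v z"
        unfolding z_def by (simp only: matrix_vector_mul_assoc T matrix_vector_mul_lid)
      have zI: "z $ i = 0" if "i \<in> I" for i unfolding z_def by (rule nf(8)[OF _ that]) (simp add: a_def u)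
      have SJ: "?S $ k $ l = 0" if "k \<in> J" "l \<in> J" for k l
      proof -
        have "pairing (pdiff (P k l) x) t = 0" using t Pvan[OF that] unfolding zariski_tangent_def by blast
        then show ?thesis using deriv[OF that] dx by simp
      qed
      have "pairing u (form_matrix t *v u) = pairing z (?S *v z)"
        unfolding uz pairing_transpose by (simp only: matrix_vector_mul_assoc matrix_mul_assoc)
      also have "\<dots> = (\<Sum>k\<in>UNIV. \<Sum>l\<in>UNIV. z $ k * (?S $ k $ l * z $ l))"
        by (simp add: pairing_def matrix_vector_mult_def sum_distrib_left)
      also have "\<dots> = 0"
      proof (intro sum.neutral ballI)
        fix k l show "z $ k * (?S $ k $ l * z $ l) = 0"
          using zI[of k] zI[of l] SJ[of k l] by (cases "k \<in> I"; cases "l \<in> I") (auto simp: J_def)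
      qed
      finally show ?thesis .
    qed
    ultimately show "t \<in> form_tangent x" by (simp add: form_tangent_def)
  qed
qed

lemma matrix_axis: "((M :: 'k::field^'n::finite^'m::finite) *v axis j 1) $ k = M $ k $ j"
  by (simp add: matrix_vector_mult_pairing)

text \<open>The vector \<open>Z a + a Z\<^sup>T\<close> is the velocity at \<open>s = 0\<close> of the curve \<open>(1 + s Z) a (1 + s Z)\<^sup>T\<close>, along
  which the rank does not exceed that of \<open>a\<close>.\<close>

lemma form_tangent_subset_tangent:
  fixes x :: "'k::field_char_0^('n::{finite,linorder} quad_var)"
  assumes x: "x \<in> rank_stratum q"
  shows "form_tangent x \<subseteq> zariski_tangent (rank_stratum q) x"
proof
  fix t assume t: "t \<in> form_tangent x"
  define a where "a = form_matrix x"
  have rk: "rank (form_matrix x) = q" and x0: "x_part x = 0" using x by (simp_all add: rank_stratum_eq)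
  have q: "q \<le> CARD('n)" unfolding rk[symmetric] by (rule rank_le_CARD)
  obtain I :: "'n set" where I: "card I = q" using obtain_subset_with_card_n[OF q] by metis
  have rI: "rank (form_matrix x) \<le> card I" by (simp add: rk I)
  obtain h C :: "(('k, 'n) vec, 'n) vec" where C: "form_matrix x = h ** C ** transpose h" "transpose C = C"
    "\<And>i j. j \<notin> I \<Longrightarrow> C $ i $ j = 0" by (rule low_rank_congruent[OF rI]) blast
  have ker: "pairing u (form_matrix t *v u) = 0" if "a *v u = 0" for u
    using t that by (simp add: form_tangent_def a_def)
  have syma: "transpose a = a" by (simp add: a_def)
  obtain Z :: "(('k, 'n) vec, 'n) vec" where Z: "form_matrix t = Z ** a + a ** transpose Z"
    by (rule orbit_tangent[OF syma symmetric_form_matrix ker])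
  define r :: "'k^('n quad_var)" where "r = from_form (Z ** a ** transpose Z) 0"
  define y where "y s = x + s *s t + (s * s) *s r" for s
  define U :: "'k \<Rightarrow> (('k, 'n) vec, 'n) vec" where "U s = (\<chi> i. axis i 1 + s *s Z $ i)" for s
  have fr: "form_matrix r = Z ** a ** transpose Z"
    unfolding r_def by (rule form_matrix_from_form[OF symmetric_congruence[OF syma]])
  have Za: "(Z ** a) $ i $ j = pairing (Z $ i) (a *v axis j 1)" for i j
    by (simp add: matrix_matrix_mult_def pairing_def matrix_axis)
  have aZ: "(a ** transpose Z) $ i $ j = (a *v Z $ j) $ i" for i j
    by (simp add: matrix_matrix_mult_def transpose_def matrix_vector_mult_def)
  have fy: "form_matrix (y s) = U s ** a ** transpose (U s)" for s
  proof -
    have "form_matrix (y s) $ i $ j = (U s ** a ** transpose (U s)) $ i $ j" for i j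
      unfolding congruence_nth
      by (simp add: y_def U_def Z fr congruence_nth Za aZ a_def[symmetric] matrix_vector_right_distrib
          vector_scalar_commute pairing_add_left pairing_add_right matrix_axis algebra_simps)
    then show ?thesis by (simp add: vec_eq_iff)
  qed
  have low: "y s \<in> low_rank q" for s
  proof -
    have "form_matrix (y s) = (U s ** h) ** C ** transpose (U s ** h)"
      unfolding fy a_def C(1) by (simp only: matrix_transpose_mul matrix_mul_assoc)
    then have "rank (form_matrix (y s)) \<le> card I" using rank_congruence_le[of I C "U s ** h"] C(3) by simp
    moreover have "x_part (y s) = 0" using t x0 by (simp add: y_def r_def form_tangent_def)
    ultimately show ?thesis by (simp add: low_rank_def I)
  qed
  show "t \<in> zariski_tangent (rank_stratum q) x"
    unfolding zariski_tangent_def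
  proof (intro CollectI ballI)
    fix P :: "('n quad_var, 'k) mpoly" assume "P \<in> vanishing_ideal (rank_stratum q)"
    then have P: "P \<in> vanishing_ideal (low_rank q)"
      using vanishing_ideal_closure[of "rank_stratum q :: ('k^('n quad_var)) set"]
      by (simp only: low_rank_dense(1)[OF q])
    obtain p where p: "\<And>s. poly p s = pval P (\<chi> k. poly [:x $ k, t $ k, r $ k:] s)"
      "\<And>s. poly (pderiv p) s = pairing (pdiff P (\<chi> k. poly [:x $ k, t $ k, r $ k:] s))
         (\<chi> k. poly (pderiv [:x $ k, t $ k, r $ k:]) s)"
      by (rule chain_rule_pval[of P "\<lambda>k. [:x $ k, t $ k, r $ k:]"]) blast
    have "poly p s = poly 0 s" for s
    proof -
      have "(\<chi> k. poly [:x $ k, t $ k, r $ k:] s) = y s"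
        by (simp add: vec_eq_iff y_def algebra_simps)
      then show ?thesis using vanishing_idealD[OF P low[of s]] by (simp add: p(1))
    qed
    then have "poly p = poly 0" by (rule ext)
    then have "p = 0" by (simp only: poly_eq_poly_eq_iff)
    moreover have "(\<chi> k. poly [:x $ k, t $ k, r $ k:] 0) = x"
      "(\<chi> k. poly (pderiv [:x $ k, t $ k, r $ k:]) 0) = t"
      by (simp_all add: vec_eq_iff pderiv_pCons)
    ultimately show "pairing (pdiff P x) t = 0" using p(2)[of 0] by simp
  qed
qed

section \<open>Limits of differentials at a singular point\<close>

text \<open>The covectors \<open>(V, w)\<close> with \<open>A V = 0\<close>; over singular points they form the fibers of the Glaeser
  bundle.\<close>

definition limit_covectors :: "'k::field^('n::{finite,linorder} quad_var) \<Rightarrow> ('k^('n quad_var)) set" where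
  "limit_covectors x = {v. form_matrix x ** dual_matrix v = 0}"

lemma limit_covectors_iff:
  "v \<in> limit_covectors x \<longleftrightarrow> (\<forall>i j. (\<Sum>k\<in>UNIV. form_matrix x $ i $ k * dual_matrix v $ k $ j) = 0)"
  by (simp add: limit_covectors_def matrix_matrix_mult_def vec_eq_iff)

lemma subspace_limit_covectors: "vec.subspace (limit_covectors x)"
proof (rule vec.subspaceI)
  show "0 \<in> limit_covectors x" by (simp add: limit_covectors_iff)
  fix v w assume "v \<in> limit_covectors x" "w \<in> limit_covectors x"
  then show "v + w \<in> limit_covectors x"
    by (simp add: limit_covectors_iff distrib_left sum.distrib)
next
  fix c v assume v: "v \<in> limit_covectors x"
  have "(\<Sum>k\<in>UNIV. form_matrix x $ i $ k * dual_matrix (c *s v) $ k $ j)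
    = c * (\<Sum>k\<in>UNIV. form_matrix x $ i $ k * dual_matrix v $ k $ j)" for i j
    by (simp add: sum_distrib_left mult.left_commute)
  then show "c *s v \<in> limit_covectors x" using v by (simp add: limit_covectors_iff)
qed

text \<open>The matrix \<open>u u\<^sup>T\<close> of the covector that evaluates a quadratic form at \<open>u\<close>.\<close>

definition square :: "('k::field, 'n::finite) vec \<Rightarrow> (('k, 'n) vec, 'n) vec" where
  "square u = (\<chi> i j. u $ i * u $ j)"

lemma transpose_square [simp]: "transpose (square u) = square u"
  by (rule symmetricI) (simp add: square_def)

lemma transpose_zero [simp]: "transpose 0 = 0"
  by (simp add: transpose_def vec_eq_iff)

lemma square_nonzero: "u \<noteq> 0 \<Longrightarrow> square u \<noteq> 0"
  by (auto simp: square_def vec_eq_iff)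

lemma sum_square: "(\<Sum>i\<in>UNIV. \<Sum>j\<in>UNIV. square u $ i $ j * F $ i $ j) = pairing u (F *v u)"
  by (simp add: square_def pairing_def matrix_vector_mult_def sum_distrib_left mult_ac)

lemma square_limit_covector:
  fixes x :: "'k::field^('n::{finite,linorder} quad_var)"
  assumes "form_matrix x *v u = 0"
  shows "from_dual (square u) w \<in> limit_covectors x"
  unfolding limit_covectors_iff
proof (intro allI)
  fix i j
  have "(\<Sum>k\<in>UNIV. form_matrix x $ i $ k * dual_matrix (from_dual (square u) w) $ k $ j)
    = (form_matrix x *v u) $ i * u $ j"
    unfolding dual_matrix_from_dual[OF transpose_square]
    by (simp add: square_def matrix_vector_mult_def sum_distrib_right mult.assoc)
  then show "(\<Sum>k\<in>UNIV. form_matrix x $ i $ k * dual_matrix (from_dual (square u) w) $ k $ j) = 0"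
    by (simp add: assms)
qed

text \<open>The trace of \<open>V (Z a + a Z\<^sup>T)\<close> vanishes if \<open>a V = 0\<close>. Conversely the covectors \<open>(u u\<^sup>T, 0)\<close> with \<open>u\<close> in
  the kernel of \<open>a\<close> and the covectors \<open>(0, w)\<close> detect the two conditions of \<open>form_tangent\<close>.\<close>

lemma form_tangent_eq_ann:
  fixes x :: "'k::field_char_0^('n::{finite,linorder} quad_var)"
  shows "form_tangent x = ann (limit_covectors x)"
proof (intro equalityI subsetI)
  fix t assume t: "t \<in> form_tangent x"
  define a where "a = form_matrix x"
  have syma: "transpose a = a" by (simp add: a_def)
  have ker: "pairing u (form_matrix t *v u) = 0" if "a *v u = 0" for u
    using t that by (simp add: form_tangent_def a_def)
  obtain Z :: "(('k, 'n) vec, 'n) vec" where Z: "form_matrix t = Z ** a + a ** transpose Z"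
    by (rule orbit_tangent[OF syma symmetric_form_matrix ker])
  have "pairing v t = 0" if v: "v \<in> limit_covectors x" for v
  proof -
    define V where "V = dual_matrix v"
    have symV: "V $ i $ j = V $ j $ i" for i j unfolding V_def by (rule symmetric_nth) simp
    have aV: "(\<Sum>k\<in>UNIV. a $ i $ k * V $ k $ j) = 0" for i j
      using v by (simp add: limit_covectors_iff a_def V_def)
    have row: "(\<Sum>j\<in>UNIV. V $ i $ j * (Z ** a) $ i $ j) = 0" for i
    proof -
      have "(\<Sum>j\<in>UNIV. V $ i $ j * (Z ** a) $ i $ j) = (\<Sum>j\<in>UNIV. \<Sum>k\<in>UNIV. Z $ i $ k * (a $ k $ j * V $ j $ i))"
        unfolding symV[of i] by (simp add: matrix_matrix_mult_def sum_distrib_left mult_ac)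
      also have "\<dots> = (\<Sum>k\<in>UNIV. \<Sum>j\<in>UNIV. Z $ i $ k * (a $ k $ j * V $ j $ i))" by (rule sum.swap)
      also have "\<dots> = 0" unfolding sum_distrib_left[symmetric] aV by simp
      finally show ?thesis .
    qed
    have tr: "(a ** transpose Z) $ i $ j = (Z ** a) $ j $ i" for i j
    proof -
      have "a ** transpose Z = transpose (Z ** a)" by (simp add: matrix_transpose_mul syma)
      then show ?thesis by (simp add: transpose_def)
    qed
    have "(\<Sum>i\<in>UNIV. \<Sum>j\<in>UNIV. V $ i $ j * (a ** transpose Z) $ i $ j)
        = (\<Sum>i\<in>UNIV. \<Sum>j\<in>UNIV. V $ j $ i * (Z ** a) $ j $ i)"
      by (intro sum.cong refl) (simp only: tr symV)
    also have "\<dots> = (\<Sum>j\<in>UNIV. \<Sum>i\<in>UNIV. V $ j $ i * (Z ** a) $ j $ i)" by (rule sum.swap)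
    finally have "(\<Sum>i\<in>UNIV. \<Sum>j\<in>UNIV. V $ i $ j * form_matrix t $ i $ j) = 0"
      unfolding Z vector_add_component distrib_left sum.distrib by (simp add: row)
    moreover have "x_part t = 0" using t by (simp add: form_tangent_def)
    ultimately show ?thesis unfolding pairing_quad by (simp add: V_def)
  qed
  then show "t \<in> ann (limit_covectors x)" by (simp add: ann_def)
next
  fix t assume "t \<in> ann (limit_covectors x)"
  then have t: "pairing v t = 0" if "v \<in> limit_covectors x" for v using that by (simp add: ann_def)
  have "x_part t $ m = 0" for m
    using t[of "from_dual 0 (axis m 1)"] by (simp add: limit_covectors_def pairing_quad)
  then have "x_part t = 0" by (simp add: vec_eq_iff)
  moreover have "pairing u (form_matrix t *v u) = 0" if u: "form_matrix x *v u = 0" for u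
    using t[OF square_limit_covector[OF u, of 0]] by (simp add: pairing_quad sum_square)
  ultimately show "t \<in> form_tangent x" by (simp add: form_tangent_def)
qed

lemma tangent_rank_stratum:
  fixes x :: "'k::field_char_0^('n::{finite,linorder} quad_var)"
  assumes "x \<in> rank_stratum q"
  shows "zariski_tangent (rank_stratum q) x = ann (limit_covectors x)"
  using rank_stratum_local_equations(2)[OF assms] form_tangent_subset_tangent[OF assms]
  unfolding form_tangent_eq_ann by (rule equalityI)

lemma span_scale_singleton: "c \<noteq> 0 \<Longrightarrow> vec.span {c *s v} = vec.span {v}" for c :: "'k::field"
proof -
  assume c: "c \<noteq> 0"
  have "(1 / c) *s (c *s v) \<in> vec.span {c *s v}" by (intro vec.span_scale vec.span_base) simp
  moreover have "(1 / c) *s (c *s v) = v" using c by (simp add: vec_eq_iff)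
  ultimately have "v \<in> vec.span {c *s v}" by simp
  moreover have "c *s v \<in> vec.span {v}" by (intro vec.span_scale vec.span_base) simp
  ultimately show ?thesis by (simp add: vec.span_eq)
qed

text \<open>At \<open>(a + s S, s u)\<close> with \<open>a u = 0\<close> the differential is \<open>s\<^sup>2\<close> times the fixed covector
  \<open>(u u\<^sup>T, 2 S u)\<close>.\<close>

lemma df_limit_kernel:
  fixes x :: "'k::field_char_0^('n::{finite,linorder} quad_var)"
  assumes x: "x_part x = 0" and u: "form_matrix x *v u = 0" "u \<noteq> 0" and S: "transpose S = S"
  shows "df_limit generic_quadric x (from_dual (square u) (2 *s (S *v u)))"
proof -
  let ?v = "from_dual (square u) (2 *s (S *v u)) :: 'k^('n quad_var)"
  have v: "?v \<noteq> 0"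
  proof
    assume "?v = 0"
    then have "dual_matrix ?v = dual_matrix 0" by (rule arg_cong)
    then show False using square_nonzero[OF u(2)] by simp
  qed
  have p: "pdiff generic_quadric (x + s *s from_form S u) = (s * s) *s ?v" for s
  proof (rule quad_vec_eqI_dual)
    show "dual_matrix (pdiff generic_quadric (x + s *s from_form S u)) = dual_matrix ((s * s) *s ?v)"
      by (simp add: pdiff_generic_quadric x vec_eq_iff) (simp add: square_def)
    show "x_part (pdiff generic_quadric (x + s *s from_form S u)) = x_part ((s * s) *s ?v)"
      by (simp add: pdiff_generic_quadric form_matrix_line x u S vector_scalar_commute vec_eq_iff)
  qed
  show ?thesis
    unfolding df_limit_def
  proof (rule conjI[OF v], rule exI[of _ "from_form S u"], rule exI[of _ 0], intro allI impI conjI)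
    fix s :: 'k assume "s \<noteq> 0"
    then show "pdiff generic_quadric (x + s *s from_form S u) \<noteq> 0"
      "vec.span {?v + s *s 0} = vec.span {pdiff generic_quadric (x + s *s from_form S u)}"
      unfolding p using v by (simp_all add: span_scale_singleton)
  qed
qed

text \<open>At \<open>(a, s u)\<close> the differential is \<open>s\<close> times \<open>(s u u\<^sup>T, 2 a u)\<close>.\<close>

lemma df_limit_nondegenerate:
  fixes x :: "'k::field_char_0^('n::{finite,linorder} quad_var)"
  assumes x: "x_part x = 0" and u: "form_matrix x *v u \<noteq> 0"
  shows "df_limit generic_quadric x (from_dual 0 (2 *s (form_matrix x *v u)))"
proof -
  let ?v = "from_dual 0 (2 *s (form_matrix x *v u)) :: 'k^('n quad_var)"
  let ?w = "from_dual (square u) 0 :: 'k^('n quad_var)"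
  let ?x = "\<lambda>s. x + s *s from_form 0 u"
  have v: "?v \<noteq> 0"
  proof
    assume "?v = 0"
    then have "x_part ?v = x_part 0" by (rule arg_cong)
    then show False using u by simp
  qed
  have u0: "u \<noteq> 0" using u by auto
  have p: "pdiff generic_quadric (?x s) = s *s (?v + s *s ?w)" for s
  proof (rule quad_vec_eqI_dual)
    show "dual_matrix (pdiff generic_quadric (?x s)) = dual_matrix (s *s (?v + s *s ?w))"
      by (simp add: pdiff_generic_quadric x vec_eq_iff) (simp add: square_def)
    show "x_part (pdiff generic_quadric (?x s)) = x_part (s *s (?v + s *s ?w))"
      by (simp add: pdiff_generic_quadric form_matrix_line x vector_scalar_commute vec_eq_iff)
  qed
  show ?thesis
    unfolding df_limit_def
  proof (rule conjI[OF v], rule exI[of _ "from_form 0 u"], rule exI[of _ ?w], intro allI impI conjI)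
    fix s :: 'k assume s: "s \<noteq> 0"
    show "pdiff generic_quadric (?x s) \<noteq> 0"
      using s u0 by (simp add: pdiff_generic_quadric_eq_0 x)
    show "vec.span {?v + s *s ?w} = vec.span {pdiff generic_quadric (?x s)}"
      unfolding p by (rule span_scale_singleton[OF s, symmetric])
  qed
qed

text \<open>The segments with \<open>a u = 0\<close> yield \<open>(u u\<^sup>T, 2 S u)\<close> with arbitrary symmetric \<open>S\<close>, whose \<open>w\<close>-parts are
  all vectors. If \<open>a\<close> is nondegenerate there are none of these, but the covectors \<open>(0, 2 a u)\<close>
  suffice.\<close>

lemma ann_df_limits:
  fixes x :: "'k::field_char_0^('n::{finite,linorder} quad_var)"
  assumes x: "x_part x = 0"
  shows "ann {v. df_limit generic_quadric x v} \<subseteq> form_tangent x"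
proof
  fix t assume "t \<in> ann {v. df_limit generic_quadric x v}"
  then have t: "pairing v t = 0" if "df_limit generic_quadric x v" for v using that by (simp add: ann_def)
  have test: "pairing u (form_matrix t *v u) + 2 * pairing (S *v u) (x_part t) = 0"
    if "form_matrix x *v u = 0" "u \<noteq> 0" "transpose S = S" for u and S :: "(('k, 'n) vec, 'n) vec"
    using t[OF df_limit_kernel[OF x that]] by (simp add: pairing_quad sum_square)
  have quad: "pairing u (form_matrix t *v u) = 0" if "form_matrix x *v u = 0" for u
    using test[OF that, of 0] by (cases "u = 0") simp_all
  have "x_part t = 0"
  proof (cases "\<exists>u. form_matrix x *v u = 0 \<and> u \<noteq> 0")
    case True
    then obtain u where u: "form_matrix x *v u = 0" "u \<noteq> 0" by auto
    have S: "pairing (S *v u) (x_part t) = 0" if "transpose S = S" for S :: "(('k, 'n) vec, 'n) vec"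
      using test[OF u that] quad[OF u(1)] by simp
    \<comment> \<open>Testing with the elementary symmetric matrices \<open>E\<^sub>p\<^sub>p\<close> and \<open>E\<^sub>m\<^sub>p + E\<^sub>p\<^sub>m\<close> isolates the
      coordinates of the \<open>X\<close>-part of \<open>t\<close>.\<close>
    obtain p where p: "u $ p \<noteq> 0" using u(2) by (auto simp: vec_eq_iff)
    have tp: "x_part t $ p = 0"
    proof -
      have "diag (\<lambda>i. if i = p then 1 else 0) *v u = axis p (u $ p)"
        by (simp add: vec_eq_iff) (simp add: axis_def)
      then show ?thesis using S[OF transpose_diag, of "\<lambda>i. if i = p then 1 else 0"] p by simp
    qed
    have "x_part t $ m = 0" for m
    proof (cases "m = p")
      case False
      let ?S = "\<chi> i j. if (i, j) = (m, p) \<or> (i, j) = (p, m) then (1 :: 'k) else 0"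
      have "(?S *v u) $ i = (axis m (u $ p) + axis p (u $ m)) $ i" for i
      proof -
        have "(?S *v u) $ i = (\<Sum>j\<in>UNIV. if j = (if i = m then p else m) then (if i = m \<or> i = p then u $ j else 0) else 0)"
          unfolding matrix_vector_mult_def vec_lambda_beta using False by (intro sum.cong refl) auto
        then show ?thesis using False by (simp add: axis_def)
      qed
      then have "?S *v u = axis m (u $ p) + axis p (u $ m)" by (simp add: vec_eq_iff)
      moreover have "transpose ?S = ?S" by (rule symmetricI) auto
      ultimately show ?thesis using S[of ?S] p tp by (simp add: pairing_add_left)
    qed (simp add: tp)
    then show ?thesis by (simp add: vec_eq_iff)
  next
    case False
    have "pairing (form_matrix x *v u) (x_part t) = 0" for u
    proof (cases "form_matrix x *v u = 0")
      case nz: False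
      show ?thesis using t[OF df_limit_nondegenerate[OF x nz]] by (simp add: pairing_quad)
    qed simp
    then have "pairing u (form_matrix x *v x_part t) = 0" for u
      using pairing_matrix_symmetric[OF symmetric_form_matrix, of u x "x_part t"] pairing_commute by metis
    from this[of "axis _ 1"] have "form_matrix x *v x_part t = 0" by (simp add: vec_eq_iff)
    then show ?thesis using False by auto
  qed
  with quad show "t \<in> form_tangent x" by (simp add: form_tangent_def)
qed

section \<open>The fiber dimension depends exactly on the rank\<close>

text \<open>The action of a change of basis on covectors.\<close>

definition dual_congruence ::
  "(('k::field, 'n::{finite,linorder}) vec, 'n) vec \<Rightarrow> 'k^('n quad_var) \<Rightarrow> 'k^('n quad_var)" where
  "dual_congruence h v = from_dual (transpose h ** dual_matrix v ** h) (x_part v)"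

lemma dual_congruence_parts:
  "dual_matrix (dual_congruence h v) = transpose h ** dual_matrix v ** h"
  "x_part (dual_congruence h v) = x_part v"
proof -
  have "transpose (transpose h ** dual_matrix v ** h) = transpose h ** dual_matrix v ** h"
    using symmetric_congruence[OF symmetric_dual_matrix, of "transpose h" v] by simp
  then show "dual_matrix (dual_congruence h v) = transpose h ** dual_matrix v ** h"
    unfolding dual_congruence_def by (rule dual_matrix_from_dual)
  show "x_part (dual_congruence h v) = x_part v" by (simp add: dual_congruence_def)
qed

lemma linear_dual_congruence: "Vector_Spaces.linear (*s) (*s) (dual_congruence h)"
proof (intro Vector_Spaces.linear_iff[THEN iffD2] conjI allI)
  fix v w and c
  have e: "(transpose h ** M ** h) $ i $ j = (\<Sum>k\<in>UNIV. \<Sum>l\<in>UNIV. h $ l $ i * M $ l $ k * h $ k $ j)" for M i j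
    by (simp add: matrix_matrix_mult_def transpose_def sum_distrib_right)
  show "dual_congruence h (v + w) = dual_congruence h v + dual_congruence h w"
    by (rule quad_vec_eqI_dual)
       (simp_all add: vec_eq_iff dual_congruence_parts e distrib_left distrib_right sum.distrib)
  show "dual_congruence h (c *s v) = c *s dual_congruence h v"
    by (rule quad_vec_eqI_dual)
       (simp_all add: vec_eq_iff dual_congruence_parts e sum_distrib_left mult_ac)
qed (rule vec.vector_space_axioms)+

lemma dual_congruence_inverse: "h ** g = mat 1 \<Longrightarrow> dual_congruence g (dual_congruence h v) = v"
proof (rule quad_vec_eqI_dual)
  assume hg: "h ** g = mat 1"
  have "dual_matrix (dual_congruence g (dual_congruence h v))
    = transpose (h ** g) ** dual_matrix v ** (h ** g)"
    unfolding dual_congruence_parts by (simp only: matrix_transpose_mul matrix_mul_assoc)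
  then show "dual_matrix (dual_congruence g (dual_congruence h v)) = dual_matrix v"
    by (simp add: hg)
qed (simp add: dual_congruence_parts)

lemma dim_le_dual_congruence:
  assumes "h ** g = mat 1" "dual_congruence h ` S \<subseteq> T"
  shows "vec.dim S \<le> vec.dim T"
proof -
  have "inj (dual_congruence h)"
    by (rule inj_on_inverseI) (rule dual_congruence_inverse[OF assms(1)])
  then have "inj_on (dual_congruence h) (vec.span S)" using inj_on_subset subset_UNIV by blast
  then have "vec.dim (dual_congruence h ` S) = vec.dim S"
    by (rule vec.dim_image_eq[OF linear_dual_congruence])
  then show ?thesis using vec.dim_subset[OF assms(2)] by simp
qed

text \<open>A change of basis identifies the solutions of \<open>A V = 0\<close> with those for the normal form of \<open>A\<close>, and
  \<open>C V = 0\<close> only depends on the row space of \<open>C\<close>, which is that of \<open>proj I\<close>.\<close>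

lemma dim_limit_covectors_normal_form:
  fixes x :: "'k::field_char_0^('n::{finite,linorder} quad_var)"
  assumes I: "card I = rank (form_matrix x)"
  shows "vec.dim (limit_covectors x) = vec.dim (limit_covectors (from_form (proj I) 0 :: 'k^('n quad_var)))"
proof -
  define a where "a = form_matrix x"
  have syma: "transpose a = a" by (simp add: a_def)
  have Ia: "card I = rank a" by (simp add: a_def I)
  obtain g h C R :: "(('k, 'n) vec, 'n) vec" where nf: "g ** h = mat 1" "h ** g = mat 1"
    "C = g ** a ** transpose g" "a = h ** C ** transpose h"
    "\<And>i j. j \<notin> I \<Longrightarrow> C $ i $ j = 0" "R ** C = proj I"
    by (rule symmetric_normal_form[OF syma Ia]) blast
  have T: "transpose g ** transpose h = mat 1" "transpose h ** transpose g = mat 1"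
    using nf(1,2) by (simp_all flip: matrix_transpose_mul)
  have CI: "C ** proj I = C"
  proof -
    have "(C ** proj I) $ i $ j = C $ i $ j" for i j using nf(5)[of j i] by simp
    then show ?thesis by (simp add: vec_eq_iff)
  qed
  have "vec.dim (limit_covectors x) \<le> vec.dim (limit_covectors (from_form (proj I) 0 :: 'k^('n quad_var)))"
  proof (rule dim_le_dual_congruence[OF nf(2)], rule image_subsetI)
    fix v :: "'k^('n quad_var)" assume "v \<in> limit_covectors x"
    then have v: "a ** dual_matrix v = 0" by (simp add: limit_covectors_def a_def)
    have "proj I ** (transpose h ** dual_matrix v ** h)
        = R ** (g ** h) ** C ** transpose h ** dual_matrix v ** h"
      by (simp only: nf(1) matrix_mul_rid nf(6)[symmetric] matrix_mul_assoc)
    also have "\<dots> = R ** g ** (a ** dual_matrix v) ** h"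
      by (subst nf(4)) (simp only: matrix_mul_assoc)
    finally show "dual_congruence h v \<in> limit_covectors (from_form (proj I) 0)"
      by (simp add: limit_covectors_def dual_congruence_parts v)
  qed
  moreover have "vec.dim (limit_covectors (from_form (proj I) 0 :: 'k^('n quad_var))) \<le> vec.dim (limit_covectors x)"
  proof (rule dim_le_dual_congruence[OF nf(1)], rule image_subsetI)
    fix v :: "'k^('n quad_var)" assume "v \<in> limit_covectors (from_form (proj I) 0)"
    then have v: "proj I ** dual_matrix v = 0" by (simp add: limit_covectors_def)
    have "a ** (transpose g ** dual_matrix v ** g)
        = h ** C ** (transpose h ** transpose g) ** dual_matrix v ** g"
      by (subst nf(4)) (simp only: matrix_mul_assoc)
    also have "\<dots> = h ** (C ** proj I) ** dual_matrix v ** g" by (simp only: T matrix_mul_rid CI)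
    also have "\<dots> = h ** C ** (proj I ** dual_matrix v) ** g" by (simp only: matrix_mul_assoc)
    finally show "dual_congruence g v \<in> limit_covectors x"
      by (simp add: limit_covectors_def dual_congruence_parts v a_def)
  qed
  ultimately show ?thesis by (rule antisym)
qed

lemma limit_covectors_proj:
  "v \<in> limit_covectors (from_form (proj I) 0 :: 'k::field_char_0^('n::{finite,linorder} quad_var))
    \<longleftrightarrow> (\<forall>i\<in>I. \<forall>j. dual_matrix v $ i $ j = 0)"
  by (auto simp: limit_covectors_def vec_eq_iff)

text \<open>For nested index sets the solution spaces of the normal forms are nested the other way round, and
  an elementary diagonal matrix distinguishes them.\<close>

lemma dim_limit_covectors_less:
  fixes x y :: "'k::field_char_0^('n::{finite,linorder} quad_var)"
  assumes less: "rank (form_matrix x) < rank (form_matrix y)"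
  shows "vec.dim (limit_covectors y) < vec.dim (limit_covectors x)"
proof -
  obtain I' :: "'n set" where I': "card I' = rank (form_matrix y)"
    by (rule obtain_subset_with_card_n[OF rank_le_CARD[of "form_matrix y"]])
  have "rank (form_matrix x) \<le> card I'" using less I' by simp
  then obtain I where I: "I \<subseteq> I'" "card I = rank (form_matrix x)"
    by (rule obtain_subset_with_card_n)
  have "I \<noteq> I'" using I(2) I' less by auto
  then obtain m where m: "m \<in> I'" "m \<notin> I" using I(1) by auto
  let ?L = "\<lambda>I. limit_covectors (from_form (proj I) 0 :: 'k^('n quad_var))"
  define v :: "'k^('n quad_var)" where "v = from_dual (square (axis m 1)) 0"
  have v: "dual_matrix v $ i $ j = (if i = m \<and> j = m then 1 else 0)" for i j
    by (simp add: v_def) (simp add: square_def axis_def)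
  have "?L I' \<subseteq> ?L I"
  proof
    fix w assume "w \<in> ?L I'"
    then have w: "\<forall>i\<in>I'. \<forall>j. dual_matrix w $ i $ j = 0" by (simp only: limit_covectors_proj)
    have "dual_matrix w $ i $ j = 0" if "i \<in> I" for i j
      using bspec[OF w subsetD[OF I(1) that]] by (rule spec)
    then show "w \<in> ?L I" by (simp add: limit_covectors_proj)
  qed
  moreover have "v \<in> ?L I" using m(2) by (auto simp: limit_covectors_proj v)
  moreover have "v \<notin> ?L I'"
  proof
    assume "v \<in> ?L I'"
    then have "dual_matrix v $ m $ m = 0" using m(1) by (simp add: limit_covectors_proj)
    then show False by (simp add: v)
  qed
  ultimately have "?L I' \<subset> ?L I" by blast
  then have "vec.span (?L I') \<subset> vec.span (?L I)"
    unfolding vec.span_eq_iff[THEN iffD2, OF subspace_limit_covectors] .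
  then have "vec.dim (?L I') < vec.dim (?L I)" by (rule vec.dim_psubset)
  then show ?thesis
    by (simp only: dim_limit_covectors_normal_form[OF I'] dim_limit_covectors_normal_form[OF I(2)])
qed

lemma dim_limit_covectors_eq_iff:
  fixes x y :: "'k::field_char_0^('n::{finite,linorder} quad_var)"
  shows "vec.dim (limit_covectors x) = vec.dim (limit_covectors y)
    \<longleftrightarrow> rank (form_matrix x) = rank (form_matrix y)"
proof
  assume r: "rank (form_matrix x) = rank (form_matrix y)"
  obtain I :: "'n set" where I: "card I = rank (form_matrix y)"
    by (rule obtain_subset_with_card_n[OF rank_le_CARD[of "form_matrix y"]])
  then show "vec.dim (limit_covectors x) = vec.dim (limit_covectors y)"
    using dim_limit_covectors_normal_form[of I x] dim_limit_covectors_normal_form[of I y] r by simp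
next
  assume "vec.dim (limit_covectors x) = vec.dim (limit_covectors y)"
  then show "rank (form_matrix x) = rank (form_matrix y)"
    using dim_limit_covectors_less[of x y] dim_limit_covectors_less[of y x] by linarith
qed

section \<open>The Glaeser bundle\<close>

text \<open>The entries of \<open>2 A V - w X\<^sup>T\<close>, which vanish for all multiples of the differential.\<close>

definition limit_equation :: "'n \<times> 'n \<Rightarrow>
   ('k::field_char_0^('n::{finite,linorder} quad_var)) \<times> ('k^('n quad_var)) \<Rightarrow> 'k" where
  "limit_equation = (\<lambda>(i, j) z. 2 * (form_matrix (fst z) ** dual_matrix (snd z)) $ i $ j
     - x_part (snd z) $ i * x_part (fst z) $ j)"

text \<open>Where the differential does not vanish the second condition leaves only its multiples; over
  singular points it is void and the first one reads \<open>A V = 0\<close>.\<close>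

definition covector_bundle ::
  "(('k::field_char_0^('n::{finite,linorder} quad_var)) \<times> ('k^('n quad_var))) set" where
  "covector_bundle = {z. (\<forall>a. limit_equation a z = 0) \<and>
     (\<forall>k l. snd z $ k * pdiff generic_quadric (fst z) $ l = snd z $ l * pdiff generic_quadric (fst z) $ k)}"

lemma polyfun_form_dual: "polyfun pair_coords (\<lambda>z. (form_matrix (fst z) ** dual_matrix (snd z)) $ i $ j)"
  unfolding matrix_matrix_mult_def vec_lambda_beta
  by (intro polyfun_sum polyfun_closed(4) polyfun_quad)

lemma polyfun_limit_equation: "polyfun pair_coords (limit_equation a)"
  unfolding limit_equation_def case_prod_beta
  by (intro polyfun_closed(1,4,5) polyfun_form_dual polyfun_quad)

lemma polyfun_pdiff: "polyfun coord (\<lambda>x. pdiff P x $ i)"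
  by (simp add: pdiff_def polyfun_pval)

lemma limit_equation_multiple:
  fixes x :: "'k::field_char_0^('n::{finite,linorder} quad_var)"
  shows "limit_equation a (x, c *s pdiff generic_quadric x) = 0"
proof -
  obtain i j where a: "a = (i, j)" by (cases a)
  have "2 * (form_matrix x ** dual_matrix (c *s pdiff generic_quadric x)) $ i $ j
    = c * 2 * (form_matrix x *v x_part x) $ i * x_part x $ j"
    by (simp add: matrix_matrix_mult_def matrix_vector_mult_def pdiff_generic_quadric sum_distrib_left
        sum_distrib_right mult_ac)
  then show ?thesis by (simp add: a limit_equation_def pdiff_generic_quadric)
qed

lemma closure_covector_bundle:
  fixes \<beta> :: "(('k::field_char_0^('n::{finite,linorder} quad_var)) \<times> ('k^('n quad_var))) topology"
  assumes \<beta>: "poly_topology pair_coords \<beta>" and S: "S \<subseteq> covector_bundle"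
  shows "\<beta> closure_of S \<subseteq> covector_bundle"
proof
  fix z assume z: "z \<in> \<beta> closure_of S"
  have S': "y \<in> covector_bundle" if "y \<in> S" for y using S that by (rule subsetD)
  have "limit_equation a z = 0" for a
  proof (rule poly_topology_zero[OF \<beta> polyfun_limit_equation _ z])
    show "limit_equation a y = 0" if "y \<in> S" for y
      using S'[OF that] unfolding covector_bundle_def by blast
  qed
  moreover have "snd z $ k * pdiff generic_quadric (fst z) $ l - snd z $ l * pdiff generic_quadric (fst z) $ k = 0" for k l
  proof (rule poly_topology_zero[OF \<beta> _ _ z])
    show "polyfun pair_coords (\<lambda>z :: ('k^('n quad_var)) \<times> ('k^('n quad_var)).
        snd z $ k * pdiff generic_quadric (fst z) $ l - snd z $ l * pdiff generic_quadric (fst z) $ k)"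
      by (intro polyfun_closed(4,5) polyfun_pair_coords polyfun_fst(1) polyfun_pdiff)
    show "snd y $ k * pdiff generic_quadric (fst y) $ l - snd y $ l * pdiff generic_quadric (fst y) $ k = 0"
      if "y \<in> S" for y using S'[OF that] by (simp add: covector_bundle_def)
  qed
  ultimately show "z \<in> covector_bundle" by (simp add: covector_bundle_def)
qed

lemma df_bundle_subset_covector_bundle: "df_bundle generic_quadric \<subseteq> covector_bundle"
proof
  fix z :: "('k::field_char_0^('n::{finite,linorder} quad_var)) \<times> ('k^('n quad_var))"
  assume "z \<in> df_bundle generic_quadric"
  then obtain x c where z: "z = (x, c *s pdiff generic_quadric x)"
    unfolding df_bundle_def vec.span_singleton by (cases z) auto
  show "z \<in> covector_bundle"
    unfolding covector_bundle_def z by (simp add: limit_equation_multiple mult_ac)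
qed

lemma subspace_covector_bundle: "vec.subspace (fiber covector_bundle x)"
proof (rule vec.subspaceI)
  have eq: "limit_equation a (x, v + w) = limit_equation a (x, v) + limit_equation a (x, w)"
    "limit_equation a (x, c *s v) = c * limit_equation a (x, v)" for a c v w
    by (cases a, simp add: limit_equation_def matrix_matrix_mult_def distrib_left distrib_right sum.distrib
        sum_distrib_left algebra_simps)+
  show "0 \<in> fiber covector_bundle x" using eq(2)[of _ 0] by (simp add: fiber_def covector_bundle_def)
  show "v + w \<in> fiber covector_bundle x" if "v \<in> fiber covector_bundle x" "w \<in> fiber covector_bundle x" for v w
    using that by (simp add: fiber_def covector_bundle_def distrib_right eq)
  show "c *s v \<in> fiber covector_bundle x" if "v \<in> fiber covector_bundle x" for c v
    using that by (simp add: fiber_def covector_bundle_def mult.assoc eq)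
qed

lemma fiber_covector_bundle:
  assumes "x_part x = 0"
  shows "fiber covector_bundle x = limit_covectors x"
proof -
  have "pdiff generic_quadric x = 0" using assms by (simp add: pdiff_generic_quadric_eq_0)
  then show ?thesis
    by (simp add: fiber_def covector_bundle_def limit_equation_def limit_covectors_def assms vec_eq_iff)
qed

text \<open>The closure of the bundle of differentials lies in the closed set \<open>covector_bundle\<close>, and over a
  singular point its fiber contains the limits along segments, which span by \<open>ann_df_limits\<close>.\<close>

lemma glaeser_iter_1:
  fixes \<beta> :: "(('k::field_char_0^('n::{finite,linorder} quad_var)) \<times> ('k^('n quad_var))) topology"
  assumes \<beta>: "poly_topology pair_coords \<beta>"
  shows "glaeser_iter \<beta> (df_bundle generic_quadric) 1 = covector_bundle"
proof -
  let ?T = "\<beta> closure_of df_bundle generic_quadric"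
  have T: "fiber ?T x \<subseteq> fiber covector_bundle x" for x
    unfolding fiber_def using closure_covector_bundle[OF \<beta> df_bundle_subset_covector_bundle] by blast
  have "vec.span (fiber ?T x) = fiber covector_bundle x" for x
  proof (rule equalityI)
    show "vec.span (fiber ?T x) \<subseteq> fiber covector_bundle x"
      by (rule vec.span_minimal[OF T subspace_covector_bundle])
    show "fiber covector_bundle x \<subseteq> vec.span (fiber ?T x)"
    proof (cases "x_part x = 0")
      case True
      have sub: "{v. df_limit generic_quadric x v} \<subseteq> fiber ?T x"
      proof
        fix v assume "v \<in> {v. df_limit generic_quadric x v}"
        then have "df_limit generic_quadric x v" by simp
        from df_limit_closure[OF \<beta> this] show "v \<in> fiber ?T x" by (simp add: fiber_def)
      qed
      have "limit_covectors x = ann (ann (limit_covectors x))"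
        by (rule ann_ann_subspace[OF subspace_limit_covectors, symmetric])
      also have "\<dots> \<subseteq> ann (ann {v. df_limit generic_quadric x v})"
        using ann_df_limits[OF True] unfolding form_tangent_eq_ann by (rule ann_antimono)
      also have "\<dots> \<subseteq> vec.span (fiber ?T x)" unfolding ann_ann by (rule vec.span_mono[OF sub])
      finally show ?thesis by (simp only: fiber_covector_bundle[OF True])
    next
      case False
      let ?d = "pdiff generic_quadric x"
      have d: "?d \<noteq> 0" using False by (simp add: pdiff_generic_quadric_eq_0)
      then obtain l where l: "?d $ l \<noteq> 0" by (auto simp: vec_eq_iff)
      show ?thesis
      proof
        fix v assume "v \<in> fiber covector_bundle x"
        then have "v $ k * ?d $ l = v $ l * ?d $ k" for k by (simp add: fiber_def covector_bundle_def)
        then have "v $ k = (v $ l / ?d $ l) * ?d $ k" for k using l by (simp add: nonzero_eq_divide_eq)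
        then have v: "v = (v $ l / ?d $ l) *s ?d" unfolding vec_eq_iff vector_smult_component by (rule allI)
        have "v \<in> vec.span {?d}" by (subst v) (intro vec.span_scale vec.span_base, simp)
        then have "(x, v) \<in> df_bundle generic_quadric" using d by (simp add: df_bundle_def)
        then have "(x, v) \<in> ?T" by (rule subsetD[OF poly_topology_subset[OF \<beta>]])
        then show "v \<in> vec.span (fiber ?T x)" by (intro vec.span_base) (simp add: fiber_def)
      qed
    qed
  qed
  then show ?thesis by (simp add: fiber_def)
qed

lemma glaeser_generic_quadric:
  fixes \<beta> :: "(('k::field_char_0^('n::{finite,linorder} quad_var)) \<times> ('k^('n quad_var))) topology"
  assumes \<beta>: "poly_topology pair_coords \<beta>"
  shows "glaeser \<beta> (df_bundle generic_quadric) = covector_bundle"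
    "stabilization_index \<beta> (generic_quadric :: ('n quad_var, 'k) mpoly) = 1"
proof -
  let ?it = "glaeser_iter \<beta> (df_bundle generic_quadric)"
  have cl: "\<beta> closure_of covector_bundle = covector_bundle"
    using closure_covector_bundle[OF \<beta> subset_refl] poly_topology_subset[OF \<beta>] by (rule equalityI)
  have sp: "vec.span (fiber covector_bundle x) = fiber covector_bundle x" for x :: "'k^('n quad_var)"
    by (rule vec.span_eq_iff[THEN iffD2, OF subspace_covector_bundle])
  have it2: "?it (Suc 1) = covector_bundle"
    unfolding glaeser_iter.simps(2)[of \<beta> _ 1] glaeser_iter_1[OF \<beta>] cl sp by (simp add: fiber_def)
  \<comment> \<open>The fiber of \<open>df_bundle\<close> over a critical point is empty, so the chain does not stop at once.\<close>
  have zero: "(0 :: 'k^('n quad_var), 0) \<in> covector_bundle" "(0, 0) \<notin> ?it 0"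
    by (simp_all add: covector_bundle_def limit_equation_def matrix_matrix_mult_def split_beta
        df_bundle_def pdiff_generic_quadric_eq_0)
  have "(LEAST p. ?it (Suc p) = ?it p) = 1"
  proof (rule Least_equality)
    show "?it (Suc 1) = ?it 1" by (simp only: it2 glaeser_iter_1[OF \<beta>])
    fix p assume p: "?it (Suc p) = ?it p"
    have "p \<noteq> 0"
    proof
      assume "p = 0"
      with p have "?it 1 = ?it 0" by (simp only: One_nat_def)
      then show False using zero unfolding glaeser_iter_1[OF \<beta>] by simp
    qed
    then show "1 \<le> p" by simp
  qed
  then show gl: "glaeser \<beta> (df_bundle generic_quadric) = covector_bundle"
    unfolding glaeser_def by (simp only: glaeser_iter_1[OF \<beta>])
  have S: "(0 :: 'k^('n quad_var)) \<in> Sing generic_quadric" by (simp add: Sing_generic_quadric)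
  show "stabilization_index \<beta> (generic_quadric :: ('n quad_var, 'k) mpoly) = 1"
    unfolding stabilization_index_def
  proof (rule Least_equality)
    show "G_iter \<beta> (generic_quadric :: ('n quad_var, 'k) mpoly) 1 = G_bundle \<beta> generic_quadric"
      unfolding G_iter_def G_bundle_def gl glaeser_iter_1[OF \<beta>] ..
    fix p assume p: "G_iter \<beta> (generic_quadric :: ('n quad_var, 'k) mpoly) p = G_bundle \<beta> generic_quadric"
    have "p \<noteq> 0"
    proof
      assume 0: "p = 0"
      have "(0, 0) \<in> G_bundle \<beta> (generic_quadric :: ('n quad_var, 'k) mpoly)"
        unfolding G_bundle_def gl restrict_bundle_def using zero(1) S by simp
      then show False using zero(2) unfolding p[symmetric] 0 G_iter_def restrict_bundle_def by simp
    qed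
    then show "1 \<le> p" by simp
  qed
qed

lemma fiber_G_bundle:
  fixes \<beta> :: "(('k::field_char_0^('n::{finite,linorder} quad_var)) \<times> ('k^('n quad_var))) topology"
  assumes \<beta>: "poly_topology pair_coords \<beta>" and x: "x \<in> Sing generic_quadric"
  shows "fiber (G_bundle \<beta> generic_quadric) x = limit_covectors x"
proof -
  have "fiber (G_bundle \<beta> generic_quadric) x = fiber covector_bundle x"
    unfolding G_bundle_def glaeser_generic_quadric(1)[OF \<beta>] using x by (simp add: fiber_def restrict_bundle_def)
  then show ?thesis using x by (simp add: Sing_generic_quadric fiber_covector_bundle)
qed

section \<open>The rank stratification\<close>

lemma dim_tangent_rank_stratum:
  fixes x y :: "'k::field_char_0^('n::{finite,linorder} quad_var)"
  assumes "x \<in> rank_stratum q" "y \<in> rank_stratum q"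
  shows "vec.dim (zariski_tangent (rank_stratum q) x) = vec.dim (zariski_tangent (rank_stratum q) y)"
proof -
  have "vec.dim (limit_covectors x) = vec.dim (limit_covectors y)"
    using assms by (simp add: dim_limit_covectors_eq_iff rank_stratum_eq)
  then show ?thesis by (simp add: tangent_rank_stratum assms dim_ann)
qed

lemma gauss_regular_rank_stratum:
  fixes \<gamma> :: "(('k::field_char_0^('n::{finite,linorder} quad_var)) \<times> ('k^('n quad_var)^('n quad_var))) topology"
  assumes \<gamma>: "poly_topology frame_coords \<gamma>" and q: "q \<le> CARD('n)"
  shows "gauss_regular \<gamma> (rank_stratum q)"
    "\<And>x. x \<in> rank_stratum q \<Longrightarrow> tangent_at \<gamma> (rank_stratum q) x = ann (limit_covectors x)"
proof -
  obtain b :: "'k^('n quad_var)" where b: "b \<in> rank_stratum q" using low_rank_dense(2)[OF q] by blast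
  have dim: "vec.dim (zariski_tangent (rank_stratum q) x) = vec.dim (zariski_tangent (rank_stratum q) b)"
    if "x \<in> rank_stratum q" for x :: "'k^('n quad_var)" by (rule dim_tangent_rank_stratum[OF that b])
  note reg = gauss_regular_if_smooth[OF \<gamma> open_in_closure_rank_stratum[OF q] rank_stratum_local_equations(1) dim]
  show "gauss_regular \<gamma> (rank_stratum q)" by (rule reg(1)) simp_all
  show "tangent_at \<gamma> (rank_stratum q) x = ann (limit_covectors x)" if "x \<in> rank_stratum q" for x
    using reg(2)[OF _ _ that] tangent_rank_stratum[OF that] by simp
qed

text \<open>The equations \<open>2 A V = w X\<^sup>T\<close> pass to limits of lines.\<close>

lemma limit_line_subset:
  fixes \<gamma> :: "(('k::field_char_0^('n::{finite,linorder} quad_var)) \<times> ('k^('n quad_var)^('n quad_var))) topology"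
  assumes \<gamma>: "poly_topology frame_coords \<gamma>" and x: "x_part x = 0"
    and V: "(x, V) \<in> plane_closure \<gamma> (df_lines generic_quadric)"
  shows "V \<subseteq> limit_covectors x"
proof (rule limit_plane_subset[OF \<gamma> V, where F = limit_equation and I = UNIV])
  show "polyfun pair_coords (limit_equation a)" for a by (rule polyfun_limit_equation)
  show "vec.subspace (limit_covectors x)" by (rule subspace_limit_covectors)
  fix a :: "'n \<times> 'n" and y v :: "'k^('n quad_var)" and U
  assume "(y, U) \<in> df_lines generic_quadric" "v \<in> U"
  then obtain c where "v = c *s pdiff generic_quadric y" by (auto simp: df_lines_def vec.span_singleton)
  then show "limit_equation a (y, v) = 0" by (simp only: limit_equation_multiple)
next
  fix v assume "\<And>a. a \<in> UNIV \<Longrightarrow> limit_equation a (x, v) = 0"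
  then have "limit_equation (i, j) (x, v) = 0" for i j by simp
  then show "v \<in> limit_covectors x"
    by (simp add: limit_equation_def limit_covectors_def x vec_eq_iff)
qed

lemma thom_rank_stratum:
  fixes \<gamma> :: "(('k::field_char_0^('n::{finite,linorder} quad_var)) \<times> ('k^('n quad_var)^('n quad_var))) topology"
  assumes \<gamma>: "poly_topology frame_coords \<gamma>" and q: "q \<le> CARD('n)"
  shows "thom_condition \<gamma> generic_quadric (rank_stratum q)"
  unfolding thom_condition_def
proof (intro ballI allI impI)
  fix x :: "'k^('n quad_var)" and V
  assume x: "x \<in> rank_stratum q" and V: "(x, V) \<in> plane_closure \<gamma> (df_lines generic_quadric)"
  have "V \<subseteq> limit_covectors x" using x by (intro limit_line_subset[OF \<gamma> _ V]) (simp add: rank_stratum_eq)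
  then show "annihilates V (tangent_at \<gamma> (rank_stratum q) x)"
    unfolding annihilates_iff gauss_regular_rank_stratum(2)[OF \<gamma> q x] by (rule ann_antimono)
qed

text \<open>By duality the claim is that the annihilator of a limit of tangent spaces \<open>ann {V. A V = 0}\<close>
  satisfies the equation \<open>A V = 0\<close> in the limit, which is \<open>limit_kernel\<close>.\<close>

lemma whitney_rank_stratum:
  fixes \<gamma> :: "(('k::field_char_0^('n::{finite,linorder} quad_var)) \<times> ('k^('n quad_var)^('n quad_var))) topology"
  assumes \<gamma>: "poly_topology frame_coords \<gamma>" and q: "q \<le> CARD('n)" "q' \<le> CARD('n)"
  shows "whitney_a \<gamma> (rank_stratum q) (rank_stratum q')"
  unfolding whitney_a_def
proof (intro ballI allI impI)
  let ?Z = "{(y, tangent_at \<gamma> (rank_stratum q) y) |y. y \<in> rank_stratum q}"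
  fix x :: "'k^('n quad_var)" and W
  assume x: "x \<in> rank_stratum q'" and W: "(x, W) \<in> plane_closure \<gamma> ?Z"
  obtain M :: "'k^('n quad_var)^('n quad_var)" where M: "W = vec.span (rows M)"
    "(x, M) \<in> \<gamma> closure_of frames_over ?Z (rank M)"
    using W by (rule plane_closureE)
  have "ann W \<subseteq> limit_covectors x"
  proof
    fix v assume "v \<in> ann W"
    then have v: "M *v v = 0" using kernel_eq_ann[of M] unfolding M(1) ann_span by blast
    let ?F = "\<lambda>i j (z :: ('k^('n quad_var)) \<times> ('k^('n quad_var))). (form_matrix (fst z) ** dual_matrix (snd z)) $ i $ j"
    have "?F i j (x, v) = 0" for i j
    proof (rule limit_kernel[OF \<gamma> M(2) _ _ _ v])
      show "polyfun pair_coords (?F i j)" by (rule polyfun_form_dual)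
      show "?F i j (y, c *s w) = c * ?F i j (y, w)" for y c w
        by (simp add: matrix_matrix_mult_def sum_distrib_left mult.left_commute)
      fix y U w assume yU: "(y, U) \<in> ?Z" and w: "w \<in> ann U"
      then have y: "y \<in> rank_stratum q" and U: "U = ann (limit_covectors y)"
        using gauss_regular_rank_stratum(2)[OF \<gamma> q(1)] by auto
      have "w \<in> limit_covectors y"
        using w unfolding U ann_ann_subspace[OF subspace_limit_covectors] .
      then show "?F i j (y, w) = 0" by (simp add: limit_covectors_def)
    qed
    then show "v \<in> limit_covectors x" by (simp add: limit_covectors_def vec_eq_iff)
  qed
  then have "ann (limit_covectors x) \<subseteq> ann (ann W)" by (rule ann_antimono)
  also have "\<dots> = W" by (rule ann_ann_subspace) (simp add: M(1))
  finally show "tangent_at \<gamma> (rank_stratum q') x \<subseteq> W"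
    by (simp only: gauss_regular_rank_stratum(2)[OF \<gamma> q(2) x])
qed

abbreviation rank_strata :: "('k::field^('n::{finite,linorder} quad_var)) set set" where
  "rank_strata \<equiv> {rank_stratum q |q. q \<le> CARD('n)}"

lemma partition_rank_strata:
  "partition_on (Sing (generic_quadric :: ('n::{finite,linorder} quad_var, 'k::field_char_0) mpoly)) rank_strata"
proof (rule partition_onI)
  show "\<Union>rank_strata = Sing (generic_quadric :: ('n quad_var, 'k) mpoly)"
  proof (intro equalityI subsetI)
    fix x :: "'k^('n quad_var)" assume "x \<in> Sing generic_quadric"
    then have "x \<in> rank_stratum (rank (form_matrix x))" by (simp add: Sing_generic_quadric rank_stratum_eq)
    moreover have "rank (form_matrix x) \<le> CARD('n)" by (rule rank_le_CARD)
    ultimately show "x \<in> \<Union>rank_strata" by blast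
  qed (auto simp: Sing_generic_quadric rank_stratum_eq)
  show "disjnt p p'" if "p \<in> rank_strata" "p' \<in> rank_strata" "p \<noteq> p'" for p p' :: "('k^('n quad_var)) set"
    using that by (auto simp: disjnt_def rank_stratum_eq)
  show "{} \<notin> (rank_strata :: ('k^('n quad_var)) set set)"
    using low_rank_dense(2)[where 'k = 'k and 'n = 'n] by auto
qed

lemma thom_whitney_rank_strata:
  fixes \<gamma> :: "(('k::field_char_0^('n::{finite,linorder} quad_var)) \<times> ('k^('n quad_var)^('n quad_var))) topology"
  assumes \<gamma>: "poly_topology frame_coords \<gamma>"
  shows "thom_whitney_a_stratification \<gamma> (generic_quadric :: ('n quad_var, 'k) mpoly) rank_strata"
  unfolding thom_whitney_a_stratification_def TWG_stratification_def
proof (intro conjI ballI)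
  show "finite (rank_strata :: ('k^('n quad_var)) set set)" by simp
  show "partition_on (Sing (generic_quadric :: ('n quad_var, 'k) mpoly)) rank_strata"
    by (rule partition_rank_strata)
next
  fix S :: "('k^('n quad_var)) set" assume "S \<in> rank_strata"
  then obtain q where S: "S = rank_stratum q" "q \<le> CARD('n)" by auto
  show "constructible S" "gauss_regular \<gamma> S" "thom_condition \<gamma> generic_quadric S"
    unfolding S(1) by (rule constructible_rank_stratum gauss_regular_rank_stratum(1)[OF \<gamma> S(2)]
        thom_rank_stratum[OF \<gamma> S(2)])+
  show "smooth_stratum S" unfolding smooth_stratum_def S(1) by (intro ballI rank_stratum_local_equations(1))
  fix S' :: "('k^('n quad_var)) set" assume "S' \<in> rank_strata"
  then obtain q' where S': "S' = rank_stratum q'" "q' \<le> CARD('n)" by auto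
  show "whitney_a \<gamma> S S'" unfolding S(1) S'(1) by (rule whitney_rank_stratum[OF \<gamma> S(2) S'(2)])
qed

text \<open>The hypothesis of \<open>universal_component\<close> holds because the limits of differentials at a point
  annihilate nothing more than the tangent space of the rank stratum.\<close>

lemma universal_rank_strata:
  fixes \<gamma> :: "(('k::field_char_0^('n::{finite,linorder} quad_var)) \<times> ('k^('n quad_var)^('n quad_var))) topology"
  assumes \<gamma>: "poly_topology frame_coords \<gamma>"
  shows "universal_stratification \<gamma> (generic_quadric :: ('n quad_var, 'k) mpoly) rank_strata"
  unfolding universal_stratification_def
proof (intro conjI ballI allI impI)
  show "TWG_stratification \<gamma> (generic_quadric :: ('n quad_var, 'k) mpoly) rank_strata"
    using thom_whitney_rank_strata[OF \<gamma>] by (simp add: thom_whitney_a_stratification_def)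
  fix S :: "('k^('n quad_var)) set" and \<S>' :: "('k^('n quad_var)) set set"
  assume "S \<in> (\<Union>Q\<in>rank_strata. constructible_components Q)"
    and TWG: "TWG_stratification \<gamma> generic_quadric \<S>'"
  then obtain q where q: "q \<le> CARD('n)" "S \<in> constructible_components (rank_stratum q)" by auto
  have irr: "zariski_irreducible (rank_stratum q :: ('k^('n quad_var)) set)"
    by (rule rank_stratum_irreducible[OF q(1)])
  have S: "S = rank_stratum q"
    using q(2) unfolding constructible_components_irreducible[OF irr] by (rule singletonD)
  obtain b :: "'k^('n quad_var)" where b: "b \<in> rank_stratum q" using low_rank_dense(2)[OF q(1)] by blast
  show "\<exists>S'\<in>(\<Union>Q\<in>\<S>'. constructible_components Q). open_dense_in (S \<inter> S') S \<and> open_dense_in (S \<inter> S') S'"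
    unfolding S
  proof (rule universal_component[OF \<gamma> irr open_in_closure_rank_stratum[OF q(1)] _ _ _ TWG])
    show "rank_stratum q \<subseteq> Sing (generic_quadric :: ('n quad_var, 'k) mpoly)"
      by (auto simp: Sing_generic_quadric rank_stratum_eq)
    show "vec.dim (zariski_tangent (rank_stratum q) x) = vec.dim (zariski_tangent (rank_stratum q) b)"
      if "x \<in> rank_stratum q" for x :: "'k^('n quad_var)" by (rule dim_tangent_rank_stratum[OF that b])
    fix x :: "'k^('n quad_var)" and U
    assume x: "x \<in> rank_stratum q"
      and U: "\<And>V. (x, V) \<in> plane_closure \<gamma> (df_lines generic_quadric) \<Longrightarrow> annihilates V U"
    have x0: "x_part x = 0" using x by (simp add: rank_stratum_eq)
    have "U \<subseteq> ann {v. df_limit generic_quadric x v}"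
    proof
      fix t assume t: "t \<in> U"
      have "pairing v t = 0" if v: "df_limit generic_quadric x v" for v
      proof -
        have "annihilates (vec.span {v}) U" by (rule U[OF df_limit_plane[OF \<gamma> v]])
        then show ?thesis using t vec.span_base[of v "{v}"] unfolding annihilates_def by simp
      qed
      then show "t \<in> ann {v. df_limit generic_quadric x v}" by (simp add: ann_def)
    qed
    also have "\<dots> \<subseteq> form_tangent x" by (rule ann_df_limits[OF x0])
    also have "\<dots> \<subseteq> zariski_tangent (rank_stratum q) x" by (rule form_tangent_subset_tangent[OF x])
    finally show "U \<subseteq> zariski_tangent (rank_stratum q) x" .
  qed
qed

text \<open>The fiber dimension of \<open>G\<close> determines the rank and is determined by it.\<close>

lemma quasistrata_generic_quadric:
  fixes \<beta> :: "(('k::field_char_0^('n::{finite,linorder} quad_var)) \<times> ('k^('n quad_var))) topology"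
  assumes \<beta>: "poly_topology pair_coords \<beta>"
  shows "range (quasistratum \<beta> (generic_quadric :: ('n quad_var, 'k) mpoly)) - {{}} = rank_strata"
proof -
  have mem: "y \<in> quasistratum \<beta> generic_quadric k \<longleftrightarrow> x_part y = 0 \<and> vec.dim (limit_covectors y) = k"
    for y :: "'k^('n quad_var)" and k
    using fiber_G_bundle[OF \<beta>, of y] by (auto simp: quasistratum_def Sing_generic_quadric)
  have eq: "quasistratum \<beta> generic_quadric (vec.dim (limit_covectors x)) = rank_stratum (rank (form_matrix x))"
    for x :: "'k^('n quad_var)"
    by (rule set_eqI) (simp add: mem rank_stratum_eq dim_limit_covectors_eq_iff)
  show ?thesis
  proof (intro equalityI subsetI)
    fix S :: "('k^('n quad_var)) set" assume "S \<in> range (quasistratum \<beta> generic_quadric) - {{}}"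
    then obtain k x where S: "S = quasistratum \<beta> generic_quadric k" "x \<in> S" by auto
    then have "k = vec.dim (limit_covectors x)" by (simp add: mem)
    then have "S = rank_stratum (rank (form_matrix x))" by (simp only: S(1) eq)
    moreover have "rank (form_matrix x) \<le> CARD('n)" by (rule rank_le_CARD)
    ultimately show "S \<in> rank_strata" by blast
  next
    fix S :: "('k^('n quad_var)) set" assume "S \<in> rank_strata"
    then obtain q where S: "S = rank_stratum q" "q \<le> CARD('n)" by auto
    obtain x :: "'k^('n quad_var)" where x: "x \<in> rank_stratum q" using low_rank_dense(2)[OF S(2)] by blast
    then have "S = quasistratum \<beta> generic_quadric (vec.dim (limit_covectors x))"
      by (simp add: eq S(1) rank_stratum_eq)
    then show "S \<in> range (quasistratum \<beta> generic_quadric) - {{}}" using x S(1) by auto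
  qed
qed

theorem generic_quadric_stratification:
  fixes \<beta> :: "(('k::field_char_0^('n::{finite,linorder} quad_var)) \<times> ('k^('n quad_var))) topology"
    and \<gamma> :: "(('k^('n quad_var)) \<times> ('k^('n quad_var)^('n quad_var))) topology"
  assumes \<beta>: "poly_topology pair_coords \<beta>" and \<gamma>: "poly_topology frame_coords \<gamma>"
  shows "stabilization_index \<beta> (generic_quadric :: ('n quad_var, 'k) mpoly) = 1 \<and>
    thom_whitney_a_stratification \<gamma> (generic_quadric :: ('n quad_var, 'k) mpoly) rank_strata \<and>
    functorial_stratification \<beta> \<gamma> (generic_quadric :: ('n quad_var, 'k) mpoly) rank_strata"
  unfolding functorial_stratification_def quasistrata_generic_quadric[OF \<beta>]
  by (intro conjI glaeser_generic_quadric(2)[OF \<beta>] thom_whitney_rank_strata[OF \<gamma>] universal_rank_strata[OF \<gamma>] refl)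

theorem proposition7p1:
  shows
    "(stabilization_index euclidean
        (generic_quadric :: ('n::{finite,linorder} quad_var, real) mpoly) = 1 \<and>
      thom_whitney_a_stratification euclidean
        (generic_quadric :: ('n quad_var, real) mpoly)
        {rank_stratum q |q. q \<le> CARD('n)} \<and>
      functorial_stratification euclidean euclidean
        (generic_quadric :: ('n quad_var, real) mpoly)
        {rank_stratum q |q. q \<le> CARD('n)}) \<and>
     (stabilization_index euclidean
        (generic_quadric :: ('n quad_var, complex) mpoly) = 1 \<and>
      thom_whitney_a_stratification euclidean
        (generic_quadric :: ('n quad_var, complex) mpoly)
        {rank_stratum q |q. q \<le> CARD('n)} \<and>
      functorial_stratification euclidean euclidean
        (generic_quadric :: ('n quad_var, complex) mpoly)
        {rank_stratum q |q. q \<le> CARD('n)}) \<and>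
     (stabilization_index zariski_pair
        (generic_quadric :: ('n quad_var, 'k::{alg_closed_field,field_char_0}) mpoly) = 1 \<and>
      thom_whitney_a_stratification zariski_frame
        (generic_quadric :: ('n quad_var, 'k) mpoly)
        {rank_stratum q |q. q \<le> CARD('n)} \<and>
      functorial_stratification zariski_pair zariski_frame
        (generic_quadric :: ('n quad_var, 'k) mpoly)
        {rank_stratum q |q. q \<le> CARD('n)})"
  by (intro conjI[OF generic_quadric_stratification conjI[OF generic_quadric_stratification
        generic_quadric_stratification]] poly_topology_instances)

end
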